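(* For $(i,j)\in\mathcal C=\{(i,j)\in\mathbb Z^2: i\ge0\text{ or }j\ge0\}$, let $C_{i,j}$ be the length generating function (in the variable $t$) of square lattice walks going from $(0,0)$ to $(i,j)$ and confined to $\mathcal C$. Let $T$ be the unique series in $t$ with constant term $1$ satisfying $T=1+256\,t^2\frac{T^3}{(T+3)^3}$, and let $Z=\sqrt T$. For $j\ge0$, the series $C_{-1,j}$ belongs to $t^{j+1}\mathbb Q(Z)$, and is thus algebraic. More generally, for $i\ge1$ and $j\ge0$, the series $C_{-i,j}$ is D-finite, of the form $$-\frac13Q_{i-2,j}+t^{i+j}\,\mathrm{Rat}(Z)$$ for some rational function $\mathrm{Rat}$ (with coefficients in $\mathbb Q$, depending on $i,j$). It is transcendental as soon as $i\ge2$. Finally, for $i\ge0$ and $j\ge0$, the series $C_{i,j}$ is of the form $$\frac13Q_{i,j}+t^{i+j}\,\mathrm{Rat}(Z)$$ for some rational function $\mathrm{Rat}$. It is D-finite and transcendental.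
   Context: Square lattice walks take steps in $\{(1,0),(-1,0),(0,1),(0,-1)\}$; a walk is confined to a set if all its vertices lie in it. The length generating function of a set of walks is $\sum_n c(n)t^n$, where $c(n)$ is the number of walks of length $n$. For $i,j\ge0$, $Q_{i,j}$ is the length generating function of square lattice walks from $(0,0)$ to $(i,j)$ confined to $\{(i,j):i\ge0,\ j\ge0\}$: $$Q_{i,j}=\sum_{n\ge0}\frac{(i+1)(j+1)}{(n+1)(n+2)}\binom{n+2}{\frac{n-i-j}2}\binom{n+2}{\frac{n+i-j+2}2}t^n,$$ the sum being restricted to $n$ having the same parity as $i+j$; by convention $Q_{-1,j}=0$. A power series in $t$ is D-finite if it satisfies a nontrivial linear differential equation with coefficients in $\mathbb Q(t)$; algebraic/transcendental refers to $\mathbb Q(t)$. *)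

theory Defs
  imports "HOL-Computational_Algebra.Computational_Algebra"
begin

section \<open>Square lattice walks\<close>

definition lattice_step :: "int \<times> int \<Rightarrow> int \<times> int \<Rightarrow> bool" where
  "lattice_step p q \<longleftrightarrow>
     (fst q - fst p, snd q - snd p) \<in> {(1, 0), (-1, 0), (0, 1), (0, -1)}"

text \<open>A walk is encoded by the list of its vertices, so a walk of length \<open>n\<close> has \<open>n + 1\<close> entries.\<close>

definition walks :: "(int \<times> int) set \<Rightarrow> int \<times> int \<Rightarrow> int \<times> int \<Rightarrow> nat \<Rightarrow> (int \<times> int) list set" where
  "walks A u v n =
     {w. length w = n + 1 \<and> hd w = u \<and> last w = v \<and> successively lattice_step w \<and> set w \<subseteq> A}"

definition walk_gf :: "(int \<times> int) set \<Rightarrow> int \<times> int \<Rightarrow> int \<times> int \<Rightarrow> rat fps" where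
  "walk_gf A u v = Abs_fps (\<lambda>n. of_nat (card (walks A u v n)))"

definition quadrant :: "(int \<times> int) set" where
  "quadrant = {(i, j). i \<ge> 0 \<and> j \<ge> 0}"

definition three_quadrants :: "(int \<times> int) set" where
  "three_quadrants = {(i, j). i \<ge> 0 \<or> j \<ge> 0}"

text \<open>\<open>Q_gf (-1) j = 0\<close> holds automatically, since the endpoint is outside the quadrant.\<close>

definition Q_gf :: "int \<Rightarrow> int \<Rightarrow> rat fps" where
  "Q_gf i j = walk_gf quadrant (0, 0) (i, j)"

definition C_gf :: "int \<Rightarrow> int \<Rightarrow> rat fps" where
  "C_gf i j = walk_gf three_quadrants (0, 0) (i, j)"

lemma Q_gf_neg: "Q_gf (-1) j = 0"
proof -
  have "walks quadrant (0, 0) (-1, j) n = {}" for n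
  proof (rule equals0I)
    fix w assume "w \<in> walks quadrant (0, 0) (-1, j) n"
    then have w: "length w = n + 1" "last w = (-1, j)" "set w \<subseteq> quadrant"
      by (auto simp: walks_def)
    then have "last w \<in> set w"
      by (intro last_in_set) auto
    with w show False
      by (auto simp: quadrant_def)
  qed
  then show ?thesis
    by (simp add: Q_gf_def walk_gf_def fps_eq_iff)
qed

section \<open>Rational functions, algebraic series, D-finite series\<close>

text \<open>
  The field \<open>\<rat>(z)\<close> inside a field of characteristic 0. For \<open>z = fls_X\<close> this is the field
  \<open>\<rat>(t)\<close> as a subfield of the field \<open>\<rat>((t))\<close> of Laurent series.
\<close>

definition rat_funs :: "'a::field_char_0 \<Rightarrow> 'a set" where
  "rat_funs z = {poly (map_poly of_rat p) z / poly (map_poly of_rat q) z | p q.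
                   poly (map_poly of_rat q) z \<noteq> 0}"

definition algebraic_series :: "rat fps \<Rightarrow> bool" where
  "algebraic_series F \<longleftrightarrow>
     (\<exists>p. (\<forall>i. coeff p i \<in> rat_funs fls_X) \<and> p \<noteq> 0 \<and> poly p (fps_to_fls F) = 0)"

abbreviation transcendental_series :: "rat fps \<Rightarrow> bool" where
  "transcendental_series F \<equiv> \<not> algebraic_series F"

definition D_finite :: "rat fps \<Rightarrow> bool" where
  "D_finite F \<longleftrightarrow>
     (\<exists>n a. (\<forall>k\<le>n. a k \<in> rat_funs fls_X) \<and> (\<exists>k\<le>n. a k \<noteq> 0) \<and>
            (\<Sum>k\<le>n. a k * fps_to_fls ((fps_deriv ^^ k) F)) = 0)"

section \<open>The series \<open>T\<close> and \<open>Z\<close>\<close>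

definition T_eqn :: "rat fps \<Rightarrow> bool" where
  "T_eqn T \<longleftrightarrow> fps_nth T 0 = 1 \<and> T = 1 + 256 * fps_X ^ 2 * (T ^ 3 / (T + 3) ^ 3)"

definition T_series :: "rat fps" where
  "T_series = (THE T. T_eqn T)"

definition Z_series :: "rat fps" where
  "Z_series = (THE Z. fps_nth Z 0 = 1 \<and> Z ^ 2 = T_series)"

lemma T_eqn_iff:
  "T_eqn T \<longleftrightarrow> fps_nth T 0 = 1 \<and> (T - 1) * (T + 3) ^ 3 = 256 * fps_X ^ 2 * T ^ 3"
proof (cases "fps_nth T 0 = 1")
  case True
  then have nz: "fps_nth ((T + 3) ^ 3) 0 \<noteq> 0"
    by (simp add: fps_nth_power_0 flip: numeral_fps_const)
  let ?I = "inverse ((T + 3) ^ 3)"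
  have I: "?I * (T + 3) ^ 3 = 1"
    by (rule inverse_mult_eq_1[OF nz])
  have D: "T ^ 3 / (T + 3) ^ 3 = T ^ 3 * ?I"
    by (rule fps_divide_unit[OF nz])
  have "T = 1 + 256 * fps_X ^ 2 * (T ^ 3 * ?I)
        \<longleftrightarrow> (T - 1) * (T + 3) ^ 3 = 256 * fps_X ^ 2 * T ^ 3"
  proof
    assume "T = 1 + 256 * fps_X ^ 2 * (T ^ 3 * ?I)"
    then have "T - 1 = 256 * fps_X ^ 2 * (T ^ 3 * ?I)"
      by (metis add_diff_cancel_left')
    then have "(T - 1) * (T + 3) ^ 3 = 256 * fps_X ^ 2 * T ^ 3 * (?I * (T + 3) ^ 3)"
      by (simp only: mult_ac)
    then show "(T - 1) * (T + 3) ^ 3 = 256 * fps_X ^ 2 * T ^ 3"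
      by (simp only: I mult_1_right)
  next
    assume "(T - 1) * (T + 3) ^ 3 = 256 * fps_X ^ 2 * T ^ 3"
    then have "?I * ((T - 1) * (T + 3) ^ 3) = ?I * (256 * fps_X ^ 2 * T ^ 3)"
      by (simp only:)
    then have "(T - 1) * (?I * (T + 3) ^ 3) = 256 * fps_X ^ 2 * (T ^ 3 * ?I)"
      by (simp only: mult_ac)
    then have "T - 1 = 256 * fps_X ^ 2 * (T ^ 3 * ?I)"
      by (simp only: I mult_1_right)
    then show "T = 1 + 256 * fps_X ^ 2 * (T ^ 3 * ?I)"
      by (metis add.commute diff_add_cancel)
  qed
  with True D show ?thesis
    by (simp add: T_eqn_def)
qed (simp add: T_eqn_def)

lemma T_eqn_unique:
  assumes "T_eqn S" "T_eqn T"
  shows "S = T"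
proof -
  define E where "E = (S + 3) ^ 3 + (T - 1) * ((S + 3) ^ 2 + (S + 3) * (T + 3) + (T + 3) ^ 2)
                      - 256 * fps_X ^ 2 * (S ^ 2 + S * T + T ^ 2)"
  have S: "fps_nth S 0 = 1" "(S - 1) * (S + 3) ^ 3 = 256 * fps_X ^ 2 * S ^ 3"
   and T: "fps_nth T 0 = 1" "(T - 1) * (T + 3) ^ 3 = 256 * fps_X ^ 2 * T ^ 3"
    using assms by (simp_all add: T_eqn_iff)
  have "(S - T) * E = ((S - 1) * (S + 3) ^ 3 - 256 * fps_X ^ 2 * S ^ 3)
                    - ((T - 1) * (T + 3) ^ 3 - 256 * fps_X ^ 2 * T ^ 3)"
    unfolding E_def by algebra
  then have "(S - T) * E = 0"
    using S T by simp
  moreover have "fps_nth E 0 = 64"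
    using S(1) T(1) by (simp add: E_def fps_nth_power_0 flip: numeral_fps_const)
  then have "E \<noteq> 0"
    by force
  ultimately show ?thesis
    by simp
qed

lemma T_eqn_exists: "\<exists>T. T_eqn T"
proof -
  define a :: "rat fps" where
    "a = fps_X * ((fps_X + 4) ^ 3 * inverse (256 * (1 + fps_X) ^ 3))"
  have nz: "fps_nth (256 * (1 + fps_X) ^ 3 :: rat fps) 0 \<noteq> 0"
    by (simp add: fps_nth_power_0 flip: numeral_fps_const)
  have a0: "fps_nth a 0 = 0"
    by (simp add: a_def)
  have a1: "fps_nth a 1 \<noteq> 0"
    by (simp add: a_def fps_nth_power_0 flip: numeral_fps_const)
  have i0: "fps_nth (fps_inv a) 0 = 0"
    by (simp add: fps_inv_def)
  define U where "U = fps_inv a oo fps_X ^ 2"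
  have U0: "fps_nth U 0 = 0"
    by (simp add: U_def i0)
  have "a oo U = (a oo fps_inv a) oo fps_X ^ 2"
    unfolding U_def by (rule fps_compose_assoc) (simp_all add: i0)
  then have aU: "a oo U = fps_X ^ 2"
    by (simp add: fps_inv_right[OF a0 a1])
  have "a * (256 * (1 + fps_X) ^ 3) =
          fps_X * (fps_X + 4) ^ 3 * (inverse (256 * (1 + fps_X) ^ 3) * (256 * (1 + fps_X) ^ 3))"
    unfolding a_def by (simp only: mult_ac)
  also have "\<dots> = fps_X * (fps_X + 4) ^ 3"
    by (simp only: inverse_mult_eq_1[OF nz] mult_1_right)
  finally have "(a * (256 * (1 + fps_X) ^ 3)) oo U = (fps_X * (fps_X + 4) ^ 3) oo U"
    by simp
  then have "fps_X ^ 2 * (256 * (1 + U) ^ 3) = U * (U + 4) ^ 3"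
    by (simp add: fps_compose_mult_distrib[OF U0] fps_compose_power[OF U0, symmetric]
        fps_compose_add_distrib aU fps_X_fps_compose_startby0[OF U0] flip: numeral_fps_const)
  then have "T_eqn (1 + U)"
    unfolding T_eqn_iff by (simp add: U0 algebra_simps)
  then show ?thesis ..
qed

lemma T_eqn_ex1: "\<exists>!T. T_eqn T"
  using T_eqn_exists T_eqn_unique by blast

lemma T_eqn_T_series: "T_eqn T_series"
  unfolding T_series_def using T_eqn_ex1 by (rule theI')

lemma Z_series_sqrt: "fps_nth Z_series 0 = 1 \<and> Z_series ^ 2 = T_series"
proof -
  have T0: "fps_nth T_series 0 = 1"
    using T_eqn_T_series by (simp add: T_eqn_def)
  define Z where "Z = fps_radical (\<lambda>_ x. x) (Suc 1) T_series"
  have Z: "fps_nth Z 0 = 1 \<and> Z ^ 2 = T_series"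
    using power_radical[of T_series "\<lambda>_ x. x" 1] T0 by (simp add: Z_def numeral_2_eq_2)
  have "Y = Z" if "fps_nth Y 0 = 1 \<and> Y ^ 2 = T_series" for Y
  proof -
    have "(Y - Z) * (Y + Z) = 0"
      using that Z by (simp add: power2_eq_square algebra_simps)
    moreover have "fps_nth (Y + Z) 0 = 2"
      using that Z by simp
    then have "Y + Z \<noteq> 0"
      by force
    ultimately show ?thesis
      by simp
  qed
  with Z show ?thesis
    unfolding Z_series_def by (metis (mono_tags, lifting) theI)
qed

end

theory Submission
  imports Defs "HOL-Analysis.FPS_Convergence" "HOL-Real_Asymp.Real_Asymp"
begin

text \<open>
  Write \<open>t\<close> for the length variable. The three-quadrant series and the quadrant series satisfy the
  same recurrence away from their sources, and so does the antisymmetrized quadrant series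
  \<open>Q i j - Q (-i-2) j - Q i (-j-2)\<close>, whose sources are \<open>1\<close> at the origin and \<open>-1\<close> at \<open>(-2, 0)\<close> and
  \<open>(0, -2)\<close>. One third of it is subtracted from \<open>C\<close>; the multiple \<open>1/3\<close> is the one for which the sources
  of the difference \<open>A\<close> (which are \<open>2/3\<close>, \<open>1/3\<close> and \<open>1/3\<close>) have a vanishing orbit sum under the reflections
  of the axes. This is the reason to expect that \<open>A\<close> is algebraic. Indeed \<open>A i j\<close> lies in \<open>t^(|i|+|j|) \<rat>(Z)\<close> for \<open>j \<ge> 0\<close>,
  and the transcendental part of \<open>C i j\<close> is visible in the quadrant series.

  The series \<open>A\<close> is symmetric, so it suffices to know the half \<open>half a b = A (b-a) b\<close>. Its steps are Gessel's
  steps. The functional equation of this half (\<open>half_functional_equation\<close>) has the kernel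
  \<open>t (1 + v) (u^2 v + 1) - u v\<close>, and cancelling the kernel leaves one linear relation between two
  univariate series: \<open>E(u)\<close>, the boundary row \<open>b = 0\<close>, and \<open>D(v)\<close>, the diagonal \<open>a = 0\<close>. On the curve
  \<open>t = z^2\<close>, \<open>u = \<lambda> z\<close>, \<open>v = z/\<lambda> + \<dots>\<close> of zeros of the kernel this relation determines both series:
  at each order in \<open>z\<close>, \<open>E\<close> contributes positive and \<open>D\<close> nonpositive powers of \<open>\<lambda>\<close>
  (\<open>kernel_uniqueness\<close>). So it is enough to exhibit one solution.

  A solution is rational in three algebraic functions. With \<open>n = (Z-1)/(Z+1)\<close>, \<open>k = 1 - n + n^2\<close> and
  \<open>K = (1-n)(1+n)^3\<close> the equation of \<open>Z\<close> becomes \<open>K^2 t^2 = n k^3\<close>. Over \<open>\<rat>(n)\<close>, \<open>K t u\<close> and \<open>v\<close> are rational functions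
  of parameters \<open>x\<close> and \<open>w\<close>. Put \<open>g = K t (u + 1/u)\<close>. On the kernel \<open>g (K - g)\<close> is a rational function of \<open>v\<close>
  (\<open>kernel_invariant\<close>). There are a rational function of \<open>x\<close> and a rational function of \<open>w\<close> that satisfy one
  and the same cubic equation over \<open>\<rat>(n, g (K - g))\<close>; comparing leading terms shows that they are equal on the curve. Denote the
  common value by \<open>q\<close>. Also the square root of \<open>q (q - 4 n (1-n)^2)\<close> has a rational expression \<open>r\<close> in \<open>x\<close>, and
  one in \<open>w\<close> that contains the square root of the kernel's discriminant. The solution \<open>(E, D)\<close> is written in
  \<open>q\<close> and this square root (\<open>explicit_solution_at_kernel_point\<close>). Its
  coefficients are rational in \<open>n\<close>, hence in \<open>Z\<close>, and the recurrence carries this from the boundary to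
  all \<open>half a b\<close> (\<open>half_in_tpow\<close>).

  Algebraicity and D-finiteness come from finite-dimensional vector spaces over \<open>\<rat>(t)\<close> that are closed under
  differentiation: \<open>\<rat>(t)(Z)\<close> is one, and the closed form of the quadrant numbers gives another one for \<open>Q\<close>
  (\<open>quadrant_plus_algebraic_D_finite\<close>). If \<open>C i j\<close> were algebraic although its quadrant part is not zero, then \<open>Q\<close> and its derivatives would be
  algebraic as well. But the coefficients of \<open>(t d/dt)^2 Q\<close> grow like \<open>4^n/n\<close>, so this series tends to infinity like a
  logarithm at \<open>t = 1/4\<close>, and no nontrivial polynomial equation allows that
  (\<open>no_polynomial_relation_at_log_singularity\<close>).
\<close>

(* The dollar sign denotes coefficients of power series throughout. *)
unbundle no vec_syntax

section \<open>Counting walks by their last step\<close>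

lemma walks_0: "walks A u v 0 = (if u = v \<and> u \<in> A then {[u]} else {})"
  by (auto simp: walks_def length_Suc_conv)

text \<open>
  Removing the last vertex turns the count of walks into a recursion on the endpoint.
\<close>
lemma walks_Suc:
  "walks A u v (Suc n) = (if v \<in> A then
     (\<Union>p\<in>{p. lattice_step p v}. (\<lambda>w. w @ [v]) ` walks A u p n) else {})"
proof (intro set_eqI iffI)
  fix w assume w: "w \<in> walks A u v (Suc n)"
  then obtain w' x where w': "w = w' @ [x]"
    by (cases w rule: rev_cases) (auto simp: walks_def)
  have "w' \<noteq> []" "x = v" "v \<in> A" using w w' by (auto simp: walks_def)
  moreover have "w' \<in> walks A u (last w') n" "lattice_step (last w') v"
    using w w' \<open>w' \<noteq> []\<close> \<open>x = v\<close> by (auto simp: walks_def successively_append_iff)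
  ultimately show "w \<in> (if v \<in> A then
     (\<Union>p\<in>{p. lattice_step p v}. (\<lambda>w. w @ [v]) ` walks A u p n) else {})"
    using w' \<open>x = v\<close> \<open>v \<in> A\<close> by (simp only: if_True) blast
next
  fix w assume "w \<in> (if v \<in> A then
     (\<Union>p\<in>{p. lattice_step p v}. (\<lambda>w. w @ [v]) ` walks A u p n) else {})"
  then obtain p w' where *: "v \<in> A" "lattice_step p v" "w' \<in> walks A u p n" "w = w' @ [v]"
    by (auto split: if_splits)
  then have "w' \<noteq> []" by (auto simp: walks_def)
  with * show "w \<in> walks A u v (Suc n)"
    by (auto simp: walks_def successively_append_iff)
qed

lemma lattice_step_iff:
  "lattice_step p (i, j) \<longleftrightarrow> p \<in> {(i - 1, j), (i + 1, j), (i, j - 1), (i, j + 1)}"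
  by (cases p) (auto simp: lattice_step_def)

lemma finite_walks: "finite (walks A u v n)"
proof (induction n arbitrary: v)
  case 0 then show ?case by (simp add: walks_0)
next
  case (Suc n)
  have "finite {p. lattice_step p v}"
    by (cases v) (simp add: lattice_step_iff)
  then show ?case using Suc by (simp add: walks_Suc)
qed

lemma card_walks_Suc:
  "card (walks A u (i, j) (Suc n)) = (if (i, j) \<in> A then
     card (walks A u (i - 1, j) n) + card (walks A u (i + 1, j) n)
     + card (walks A u (i, j - 1) n) + card (walks A u (i, j + 1) n) else 0)"
proof -
  have last: "w \<in> walks A u p n \<Longrightarrow> last w = p" for w p by (simp add: walks_def)
  have inj: "inj_on (\<lambda>w. w @ [v]) S" for v :: "int \<times> int" and S by (auto simp: inj_on_def)
  have "card (\<Union>p\<in>{(i - 1, j), (i + 1, j), (i, j - 1), (i, j + 1)}. (\<lambda>w. w @ [(i, j)]) ` walks A u p n)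
      = (\<Sum>p\<in>{(i - 1, j), (i + 1, j), (i, j - 1), (i, j + 1)}. card ((\<lambda>w. w @ [(i, j)]) ` walks A u p n))"
    by (rule card_UN_disjoint) (auto simp: finite_walks dest!: last)
  moreover have "{p. lattice_step p (i, j)} = {(i - 1, j), (i + 1, j), (i, j - 1), (i, j + 1)}"
    by (auto simp: lattice_step_iff)
  ultimately show ?thesis
    by (simp add: walks_Suc card_image[OF inj] del: UN_insert)
qed

lemma walk_gf_rec:
  "walk_gf A u (i, j) = (if (i, j) \<in> A then
     (if u = (i, j) then 1 else 0) + fps_X * (walk_gf A u (i - 1, j) + walk_gf A u (i + 1, j)
       + walk_gf A u (i, j - 1) + walk_gf A u (i, j + 1)) else 0)"
proof (rule fps_ext)
  fix n
  show "walk_gf A u (i, j) $ n = (if (i, j) \<in> A then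
     (if u = (i, j) then 1 else 0) + fps_X * (walk_gf A u (i - 1, j) + walk_gf A u (i + 1, j)
       + walk_gf A u (i, j - 1) + walk_gf A u (i, j + 1)) else 0) $ n"
    by (cases n) (auto simp: walk_gf_def walks_0 card_walks_Suc)
qed

lemma Q_rec:
  assumes "i \<ge> 0" "j \<ge> 0"
  shows "Q_gf i j = (if i = 0 \<and> j = 0 then 1 else 0)
    + fps_X * (Q_gf (i - 1) j + Q_gf (i + 1) j + Q_gf i (j - 1) + Q_gf i (j + 1))"
  using assms walk_gf_rec[of quadrant "(0,0)" i j] by (auto simp: Q_gf_def quadrant_def)

lemma Q_outside: "i < 0 \<or> j < 0 \<Longrightarrow> Q_gf i j = 0"
  using walk_gf_rec[of quadrant "(0,0)" i j] by (auto simp: Q_gf_def quadrant_def)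

lemma C_rec:
  assumes "i \<ge> 0 \<or> j \<ge> 0"
  shows "C_gf i j = (if i = 0 \<and> j = 0 then 1 else 0)
    + fps_X * (C_gf (i - 1) j + C_gf (i + 1) j + C_gf i (j - 1) + C_gf i (j + 1))"
  using assms walk_gf_rec[of three_quadrants "(0,0)" i j] by (auto simp: C_gf_def three_quadrants_def)

lemma C_outside: "i < 0 \<and> j < 0 \<Longrightarrow> C_gf i j = 0"
  using walk_gf_rec[of three_quadrants "(0,0)" i j] by (auto simp: C_gf_def three_quadrants_def)

section \<open>The closed form for the quadrant\<close>

definition q_num :: "nat \<Rightarrow> nat \<Rightarrow> nat \<Rightarrow> rat" where
  "q_num n i j = Q_gf (int i) (int j) $ n"

lemma q_num_0: "q_num 0 i j = (if i = 0 \<and> j = 0 then 1 else 0)"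
  by (subst q_num_def, subst Q_rec) auto

lemma q_num_Suc:
  "q_num (Suc n) i j = (if i = 0 then 0 else q_num n (i - 1) j) + q_num n (i + 1) j
     + (if j = 0 then 0 else q_num n i (j - 1)) + q_num n i (j + 1)"
  by (subst q_num_def, subst Q_rec)
     (auto simp: q_num_def Q_outside of_nat_diff algebra_simps)

lemma q_num_eq_0: "n < i + j \<or> odd (n + i + j) \<Longrightarrow> q_num n i j = 0"
proof (induction n arbitrary: i j)
  case 0 then show ?case by (auto simp: q_num_0)
next
  case (Suc n)
  have "q_num n (i + 1) j = 0" "q_num n i (j + 1) = 0"
    by (rule Suc.IH; use Suc.prems in presburger)+
  moreover have "q_num n (i - 1) j = 0" if "i \<noteq> 0"
    by (rule Suc.IH) (use Suc.prems that in presburger)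
  moreover have "q_num n i (j - 1) = 0" if "j \<noteq> 0"
    by (rule Suc.IH) (use Suc.prems that in presburger)
  ultimately show ?case by (auto simp: q_num_Suc)
qed

text \<open>
  Stated with an explicit predecessor, because the arguments below are sums that are not literally successors.
\<close>
lemma fact_pred: "a = Suc b \<Longrightarrow> fact a = (of_nat a :: rat) * fact b"
  by simp

text \<open>
  The reflection principle gives a product of two ballot numbers. It is verified by induction on the length:
  after division by the common factor, the recurrence is one polynomial identity in \<open>i\<close>, \<open>j\<close> and \<open>m\<close>.
  Clearing the factorials avoids a case distinction on the size of the binomial arguments.
\<close>
lemma q_num_fact:
  "q_num (i + j + 2 * m) i j * (fact m * fact (m + i + j + 2) * fact (m + i + 1) * fact (m + j + 1))
     = of_nat ((i + 1) * (j + 1)) * fact (i + j + 2 * m) * fact (i + j + 2 * m + 2)"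
proof -
  define W where "W i j m = fact m * fact (m + i + j + 2) * fact (m + i + 1) * (fact (m + j + 1) :: rat)" for i j m
  (* The length becomes an independent variable, because the induction changes i, j and m. *)
  have "q_num n i j * W i j m = of_nat ((i + 1) * (j + 1)) * fact n * fact (n + 2)"
    if "n = i + j + 2 * m" for n
    using that
  proof (induction n arbitrary: i j m)
    case 0
    then show ?case by (simp add: q_num_0 W_def)
  next
    case (Suc n)
    define c where "c = fact n * (fact (n + 2) :: rat)"
    have scale: "q * w' = r \<Longrightarrow> w = a * w' \<Longrightarrow> q * w = a * r" for q w w' a r :: rat
      by (simp add: mult_ac)
    let ?i = "of_nat i :: rat" and ?j = "of_nat j :: rat" and ?m = "of_nat m :: rat"
    (* Facts 1 to 4 evaluate the four predecessors; the missing ones are covered because their factor vanishes. *)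
    have 1: "(if i = 0 then 0 else q_num n (i - 1) j) * W i j m
        = ?i * (?j + 1) * (?m + ?i + ?j + 2) * (?m + ?i + 1) * c"
    proof (cases i)
      case (Suc i')
      have "q_num n i' j * W i' j m = of_nat ((i' + 1) * (j + 1)) * fact n * fact (n + 2)"
        by (rule Suc.IH) (use Suc.prems Suc in auto)
      moreover have "W i j m = (?m + ?i + ?j + 2) * (?m + ?i + 1) * W i' j m"
      proof -
        have "fact (m + i + j + 2) = (?m + ?i + ?j + 2) * fact (m + i' + j + 2)"
          by (subst fact_pred[of _ "m + i' + j + 2"]) (simp_all add: Suc del: fact_Suc)
        moreover have "fact (m + i + 1) = (?m + ?i + 1) * fact (m + i' + 1)"
          by (subst fact_pred[of _ "m + i' + 1"]) (simp_all add: Suc del: fact_Suc)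
        ultimately show ?thesis by (simp only: W_def mult_ac)
      qed
      ultimately have "q_num n i' j * W i j m = (?m + ?i + ?j + 2) * (?m + ?i + 1) * (of_nat ((i' + 1) * (j + 1)) * fact n * fact (n + 2))" by (rule scale)
      then show ?thesis using Suc by (simp add: c_def algebra_simps del: fact_Suc)
    qed simp
    have 2: "(if j = 0 then 0 else q_num n i (j - 1)) * W i j m
        = ?j * (?i + 1) * (?m + ?i + ?j + 2) * (?m + ?j + 1) * c"
    proof (cases j)
      case (Suc j')
      have "q_num n i j' * W i j' m = of_nat ((i + 1) * (j' + 1)) * fact n * fact (n + 2)"
        by (rule Suc.IH) (use Suc.prems Suc in auto)
      moreover have "W i j m = (?m + ?i + ?j + 2) * (?m + ?j + 1) * W i j' m"
      proof -
        have "fact (m + i + j + 2) = (?m + ?i + ?j + 2) * fact (m + i + j' + 2)"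
          by (subst fact_pred[of _ "m + i + j' + 2"]) (simp_all add: Suc del: fact_Suc)
        moreover have "fact (m + j + 1) = (?m + ?j + 1) * fact (m + j' + 1)"
          by (subst fact_pred[of _ "m + j' + 1"]) (simp_all add: Suc del: fact_Suc)
        ultimately show ?thesis by (simp only: W_def mult_ac)
      qed
      ultimately have "q_num n i j' * W i j m = (?m + ?i + ?j + 2) * (?m + ?j + 1) * (of_nat ((i + 1) * (j' + 1)) * fact n * fact (n + 2))" by (rule scale)
      then show ?thesis using Suc by (simp add: c_def algebra_simps del: fact_Suc)
    qed simp
    have 3: "q_num n (i + 1) j * W i j m = (?i + 2) * (?j + 1) * ?m * (?m + ?j + 1) * c"
    proof (cases m)
      case 0
      then show ?thesis using Suc.prems by (simp add: q_num_eq_0)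
    next
      case (Suc m')
      have "q_num n (i + 1) j * W (i + 1) j m' = of_nat ((i + 1 + 1) * (j + 1)) * fact n * fact (n + 2)"
        by (rule Suc.IH) (use Suc.prems Suc in auto)
      moreover have "W i j m = ?m * (?m + ?j + 1) * W (i + 1) j m'"
      proof -
        have "fact (m + j + 1) = (?m + ?j + 1) * fact (m' + j + 1)"
          by (subst fact_pred[of _ "m' + j + 1"]) (simp_all add: Suc del: fact_Suc)
        moreover have "fact m = ?m * fact m'" by (rule fact_pred) (rule Suc)
        moreover have "m + i + j + 2 = m' + (i + 1) + j + 2" "m + i + 1 = m' + (i + 1) + 1"
          using Suc by simp_all
        ultimately show ?thesis by (simp only: W_def mult_ac)
      qed
      ultimately have "q_num n (i + 1) j * W i j m = ?m * (?m + ?j + 1) * (of_nat ((i + 1 + 1) * (j + 1)) * fact n * fact (n + 2))" by (rule scale)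
      then show ?thesis by (simp add: c_def algebra_simps del: fact_Suc)
    qed
    have 4: "q_num n i (j + 1) * W i j m = (?i + 1) * (?j + 2) * ?m * (?m + ?i + 1) * c"
    proof (cases m)
      case 0
      then show ?thesis using Suc.prems by (simp add: q_num_eq_0)
    next
      case (Suc m')
      have "q_num n i (j + 1) * W i (j + 1) m' = of_nat ((i + 1) * (j + 1 + 1)) * fact n * fact (n + 2)"
        by (rule Suc.IH) (use Suc.prems Suc in auto)
      moreover have "W i j m = ?m * (?m + ?i + 1) * W i (j + 1) m'"
      proof -
        have "fact (m + i + 1) = (?m + ?i + 1) * fact (m' + i + 1)"
          by (subst fact_pred[of _ "m' + i + 1"]) (simp_all add: Suc del: fact_Suc)
        moreover have "fact m = ?m * fact m'" by (rule fact_pred) (rule Suc)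
        moreover have "m + i + j + 2 = m' + i + (j + 1) + 2" "m + j + 1 = m' + (j + 1) + 1"
          using Suc by simp_all
        ultimately show ?thesis by (simp only: W_def mult_ac)
      qed
      ultimately have "q_num n i (j + 1) * W i j m = ?m * (?m + ?i + 1) * (of_nat ((i + 1) * (j + 1 + 1)) * fact n * fact (n + 2))" by (rule scale)
      then show ?thesis by (simp add: c_def algebra_simps del: fact_Suc)
    qed
    have n: "of_nat n + 1 = ?i + ?j + 2 * ?m"
      using arg_cong[OF Suc.prems, of "of_nat :: nat \<Rightarrow> rat"] by simp
    have "q_num (Suc n) i j * W i j m =
        (?i * (?j + 1) * (?m + ?i + ?j + 2) * (?m + ?i + 1)
        + (?i + 2) * (?j + 1) * ?m * (?m + ?j + 1)
        + ?j * (?i + 1) * (?m + ?i + ?j + 2) * (?m + ?j + 1)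
        + (?i + 1) * (?j + 2) * ?m * (?m + ?i + 1)) * c"
      unfolding q_num_Suc distrib_right 1 2 3 4 by simp
    also have "\<dots> = (?i + 1) * (?j + 1) * (?i + ?j + 2 * ?m) * (?i + ?j + 2 * ?m + 2) * c"
      by algebra
    also have "\<dots> = (?i + 1) * (?j + 1) * (of_nat n + 1) * (of_nat n + 3) * c"
      unfolding n[symmetric] by (simp only: add.assoc) simp
    also have "\<dots> = of_nat ((i + 1) * (j + 1)) * fact (Suc n) * fact (Suc n + 2)"
      unfolding c_def using fact_pred[of "Suc n" n] fact_pred[of "Suc n + 2" "n + 2"]
      by (simp add: algebra_simps del: fact_Suc)
    finally show ?case .
  qed
  then show ?thesis by (simp add: W_def)
qed

section \<open>The algebraic part of the three-quadrant series\<close>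

text \<open>
  The antisymmetric extension of \<open>Q\<close> by reflection in the lines \<open>i = -1\<close> and \<open>j = -1\<close>. It vanishes on
  these two lines, and this is why it obeys the walk recurrence across them.
\<close>
definition Q_refl :: "int \<Rightarrow> int \<Rightarrow> rat fps" where
  "Q_refl i j = Q_gf i j - Q_gf (- i - 2) j - Q_gf i (- j - 2)"

text \<open>
  Each reflected copy of the quadrant lies in one of the two additional quadrants of the three-quadrant
  domain, and it carries its own source with sign \<open>-1\<close>.
\<close>
lemma Q_refl_rec:
  assumes "i \<ge> 0 \<or> j \<ge> 0"
  shows "Q_refl i j = (if i = 0 \<and> j = 0 then 1 else if i = -2 \<and> j = 0 \<or> i = 0 \<and> j = -2 then -1 else 0)
    + fps_X * (Q_refl (i - 1) j + Q_refl (i + 1) j + Q_refl i (j - 1) + Q_refl i (j + 1))"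
proof -
  consider "i \<ge> 0" "j \<ge> 0" | "i = -1" "j \<ge> 0" | "i \<le> -2" "j \<ge> 0" | "j = -1" "i \<ge> 0" | "j \<le> -2" "i \<ge> 0"
    using assms by linarith
  then show ?thesis
  proof cases
    case 1
    then show ?thesis by (simp add: Q_refl_def Q_outside Q_rec[of i j])
  next
    case 2
    then show ?thesis by (simp add: Q_refl_def Q_outside)
  next
    case 3
    then show ?thesis
      using Q_rec[of "- i - 2" j] by (simp add: Q_refl_def Q_outside algebra_simps)
  next
    case 4
    then show ?thesis by (simp add: Q_refl_def Q_outside)
  next
    case 5
    then show ?thesis
      using Q_rec[of i "- j - 2"] by (simp add: Q_refl_def Q_outside algebra_simps)
  qed
qed

definition A_gf :: "int \<Rightarrow> int \<Rightarrow> rat fps" where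
  "A_gf i j = C_gf i j - fps_const (1/3) * Q_refl i j"

lemma A_rec:
  assumes "i \<ge> 0 \<or> j \<ge> 0"
  shows "A_gf i j = (if i = 0 \<and> j = 0 then fps_const (2/3)
      else if i = -2 \<and> j = 0 \<or> i = 0 \<and> j = -2 then fps_const (1/3) else 0)
    + fps_X * (A_gf (i - 1) j + A_gf (i + 1) j + A_gf i (j - 1) + A_gf i (j + 1))"
proof -
  have c: "1 - fps_const (1/3) = (fps_const (2/3) :: rat fps)"
    by (simp add: fps_eq_iff)
  show ?thesis
    unfolding A_gf_def C_rec[OF assms] Q_refl_rec[OF assms] c[symmetric]
    by (auto simp: algebra_simps)
qed

lemma A_outside: "i < 0 \<Longrightarrow> j < 0 \<Longrightarrow> A_gf i j = 0"
  by (simp add: A_gf_def Q_refl_def C_outside Q_outside)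

lemma A_sym: "A_gf i j = A_gf j i"
proof (rule fps_ext)
  fix n show "A_gf i j $ n = A_gf j i $ n"
  proof (induction n arbitrary: i j)
    case 0
    have "A_gf i j $ 0 = (if i = 0 \<and> j = 0 then 2/3
        else if i = -2 \<and> j = 0 \<or> i = 0 \<and> j = -2 then 1/3 else 0)" if "i \<ge> 0 \<or> j \<ge> 0" for i j
      by (subst A_rec[OF that]) simp
    then show ?case
      by (cases "i \<ge> 0 \<or> j \<ge> 0") (auto simp: A_outside)
  next
    case (Suc n)
    show ?case
    proof (cases "i \<ge> 0 \<or> j \<ge> 0")
      case True
      then show ?thesis
        using Suc[of "i - 1" j] Suc[of "i + 1" j] Suc[of i "j - 1"] Suc[of i "j + 1"]
        by (subst A_rec[of i j], simp, subst A_rec[of j i]) (auto)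
    qed (auto simp: A_outside)
  qed
qed

text \<open>
  The coordinates \<open>a = j - i\<close> and \<open>b = j\<close> straighten the half \<open>i \<le> j\<close> of the three-quadrant domain to a
  quadrant. In them the steps are \<open>(1, 0)\<close>, \<open>(-1, 0)\<close>, \<open>(1, 1)\<close> and \<open>(-1, -1)\<close>.
\<close>
definition half :: "nat \<Rightarrow> nat \<Rightarrow> rat fps" where
  "half a b = A_gf (int b - int a) (int b)"

lemma half_rec:
  assumes "a \<ge> 1"
  shows "half a b = (if a = 2 \<and> b = 0 then fps_const (1/3) else 0)
    + fps_X * (half (a - 1) b + half (a + 1) b + half (a + 1) (b + 1)
               + (if b = 0 then 0 else half (a - 1) (b - 1)))"
proof -
  have "A_gf (int b - int a) (int b - 1) = (if b = 0 then 0 else half (a - 1) (b - 1))"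
    using assms by (auto simp: half_def of_nat_diff A_outside)
  then show ?thesis
    using assms unfolding half_def
    by (subst A_rec) (auto simp: of_nat_diff algebra_simps)
qed

text \<open>
  On the diagonal the symmetry of \<open>A\<close> folds the two steps from below onto the two from above, hence the factor 2.
\<close>
lemma half_rec_diagonal:
  "half 0 b = (if b = 0 then fps_const (2/3) else 0)
    + fps_X * (fps_const 2 * (half 1 b + half 1 (b + 1)))"
  unfolding fps_numeral_fps_const[symmetric]
  using A_sym[of "int b + 1" "int b"] A_sym[of "int b" "int b - 1"]
  unfolding half_def by (subst A_rec) (auto simp: algebra_simps)

text \<open>
  The outer variable of \<open>halfH\<close> is \<open>v\<close> (exponent \<open>b\<close>), the inner one is \<open>u\<close> (exponent \<open>a\<close>). The row \<open>halfE\<close>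
  starts at \<open>a = 1\<close>, since the corner is already an entry of the diagonal \<open>halfD\<close>.
\<close>
definition halfH :: "rat fps fps fps" where
  "halfH = Abs_fps (\<lambda>b. Abs_fps (\<lambda>a. half a b))"
definition halfD :: "rat fps fps fps" where
  "halfD = Abs_fps (\<lambda>b. fps_const (half 0 b))"
definition halfE :: "rat fps fps" where
  "halfE = Abs_fps (\<lambda>a. if a = 0 then 0 else half a 0)"

text \<open>
  The recurrences are multiplied by \<open>u v\<close> and summed. Half of the folded recurrence on the diagonal fits the general
  pattern; this leaves the factor \<open>(u v - 2 t (1 + v)) / 2\<close> at the diagonal series. The step \<open>(-1, -1)\<close> is not possible from the
  bottom row, which gives the term \<open>t E(u)\<close>. The factor 6 clears denominators.
\<close>
lemma half_functional_equation:
  fixes t u v :: "rat fps fps fps"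
  defines "t \<equiv> fps_const (fps_const fps_X)" and "u \<equiv> fps_const fps_X" and "v \<equiv> fps_X"
  shows "6 * (u * v * halfH - t * ((1 + v) * (u ^ 2 * v + 1)) * halfH)
    = 2 * (u * v + u ^ 3 * v) + 3 * (u * v - 2 * (t * (1 + v))) * halfD - 6 * (t * fps_const halfE)"
proof -
  (* The equation is compared coefficientwise; the cases separate the diagonal, its neighbour and the bottom row. *)
  have "u * v * halfH - t * halfH - t * (v * halfH) - t * (u^2 * (v * halfH)) - t * (u^2 * (v^2 * halfH))
    = fps_const (fps_const (fps_const (1/3))) * (u * v + u ^ 3 * v)
     + fps_const (fps_const (fps_const (1/2))) * (u * v * halfD) - t * halfD - t * (v * halfD)
     - t * fps_const halfE" (is "?l = ?r")
  proof (intro fps_ext)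
    fix j i n :: nat
    have t: "t * F = fps_const (fps_const fps_X) * F" for F by (simp add: t_def)
    have uv: "u * v * F = fps_const fps_X * (fps_X * F)" for F by (simp add: u_def v_def mult_ac)
    have u3: "u * v + u ^ 3 * v = fps_const fps_X * fps_X + fps_const (fps_X ^ 3) * fps_X"
      by (simp add: u_def v_def)
    have u2: "u ^ 2 * F = fps_const (fps_X ^ 2) * F" for F by (simp add: u_def)
    consider "j = 0" | "j > 0" "i = 0" | "j > 0" "i = 1" | "j = 1" "i \<ge> 2" | "j \<ge> 2" "i \<ge> 2"
      by linarith
    then show "?l $ j $ i $ n = ?r $ j $ i $ n"
    proof cases
      case 1
      then show ?thesis
        unfolding u2 uv t u3 by (simp add: halfH_def halfD_def halfE_def v_def)
    next
      case 2
      then show ?thesis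
        unfolding u2 uv t u3
        by (simp add: halfH_def halfD_def halfE_def v_def fps_X_power_mult_nth fps_X_power_nth)
    next
      case 3
      then obtain j' where j: "j = Suc j'" by (cases j) auto
      show ?thesis
        using 3 j half_rec_diagonal[of j'] unfolding u2 uv t u3
        by (cases n; simp add: halfH_def halfD_def halfE_def v_def fps_X_power_mult_nth fps_X_power_nth)
    next
      case 4
      then have i: "i = Suc (Suc (i - 2))" by simp
      define i' where "i' = i - 2"
      note i = i[folded i'_def]
      show ?thesis
        using 4 i half_rec[of "Suc i'" 0] unfolding u2 uv t u3
        by (cases n; simp add: halfH_def halfD_def halfE_def v_def fps_X_power_mult_nth fps_X_power_nth)
    next
      case 5
      then have i: "i = Suc (Suc (i - 2))" "j = Suc (Suc (j - 2))" by simp_all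
      define i' j' where "i' = i - 2" and "j' = j - 2"
      note i = i[folded i'_def j'_def]
      show ?thesis
        using i half_rec[of "Suc i'" "Suc j'"] unfolding u2 uv t u3
        by (cases n; simp add: halfH_def halfD_def halfE_def v_def fps_X_power_mult_nth fps_X_power_nth)
    qed
  qed
  then have "6 * ?l = 6 * ?r" by simp
  also have "6 * ?r = (6 * fps_const (fps_const (fps_const (1/3)))) * (u * v + u ^ 3 * v)
     + (6 * fps_const (fps_const (fps_const (1/2)))) * (u * v * halfD) - 6 * t * halfD - 6 * t * (v * halfD)
     - 6 * (t * fps_const halfE)"
    by (simp only: ring_distribs mult.assoc)
  also have "6 * fps_const (fps_const (fps_const (1/3))) = (2 :: rat fps fps fps)"
    unfolding fps_numeral_fps_const by simp
  also have "6 * fps_const (fps_const (fps_const (1/2))) = (3 :: rat fps fps fps)"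
    unfolding fps_numeral_fps_const by simp
  finally show ?thesis by algebra
qed

section \<open>Fixed points and evaluation of power series\<close>

definition fps_agree :: "nat \<Rightarrow> 'a::comm_ring_1 fps \<Rightarrow> 'a fps \<Rightarrow> bool" where
  "fps_agree n f g \<longleftrightarrow> (\<forall>i<n. f $ i = g $ i)"

lemma fps_agree_refl: "fps_agree n f f"
  and fps_agree_add: "fps_agree n f g \<Longrightarrow> fps_agree n f' g' \<Longrightarrow> fps_agree n (f + f') (g + g')"
  and fps_agree_diff: "fps_agree n f g \<Longrightarrow> fps_agree n f' g' \<Longrightarrow> fps_agree n (f - f') (g - g')"
  and fps_agree_uminus: "fps_agree n f g \<Longrightarrow> fps_agree n (- f) (- g)"
  and fps_agree_mult: "fps_agree n f g \<Longrightarrow> fps_agree n f' g' \<Longrightarrow> fps_agree n (f * f') (g * g')"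
  by (auto simp: fps_agree_def fps_mult_nth intro!: sum.cong)

lemma fps_agree_power: "fps_agree n f g \<Longrightarrow> fps_agree n (f ^ k) (g ^ k)"
  by (induction k) (auto intro: fps_agree_mult fps_agree_refl)

lemmas fps_agree_intros = fps_agree_add fps_agree_diff fps_agree_uminus fps_agree_mult
  fps_agree_power fps_agree_refl

definition coeffs_in :: "'a::comm_ring_1 set \<Rightarrow> 'a fps \<Rightarrow> bool" where
  "coeffs_in B f \<longleftrightarrow> (\<forall>i. f $ i \<in> B)"

text \<open>
  Every map that preserves agreement up to each order becomes contracting after multiplication by the variable. The iterates
  starting at 0 stabilize in each coefficient, and a coefficient ring that is preserved by the map is inherited by
  the limit. The algebraic parameters below are constructed in this way, which shows at the same time that their coefficients are
  rational in \<open>Z\<close>.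
\<close>
lemma fps_fixpoint:
  fixes \<Psi> :: "'a::comm_ring_1 fps \<Rightarrow> 'a fps"
  assumes agree: "\<And>f g n. fps_agree n f g \<Longrightarrow> fps_agree n (\<Psi> f) (\<Psi> g)"
    and B: "\<And>f. coeffs_in B f \<Longrightarrow> coeffs_in B (\<Psi> f)" "c \<in> B" "0 \<in> B"
  shows "\<exists>f. f = fps_const c + fps_X * \<Psi> f \<and> coeffs_in B f"
proof -
  define \<Phi> where "\<Phi> f = fps_const c + fps_X * \<Psi> f" for f
  have \<Phi>: "fps_agree (Suc n) (\<Phi> f) (\<Phi> g)" if "fps_agree n f g" for f g n
    using agree[OF that] by (auto simp: \<Phi>_def fps_agree_def)
  have \<Phi>B: "coeffs_in B (\<Phi> f)" if "coeffs_in B f" for f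
    using B(1)[OF that] B(2,3) by (auto simp: \<Phi>_def coeffs_in_def)
  define F where "F k = (\<Phi> ^^ k) 0" for k
  have F_Suc: "F (Suc k) = \<Phi> (F k)" for k by (simp add: F_def)
  have FB: "coeffs_in B (F k)" for k
    by (induction k) (use \<Phi>B B(3) in \<open>auto simp: F_Suc\<close>, simp add: F_def coeffs_in_def)
  have step: "fps_agree k (F k) (F (Suc k))" for k
    by (induction k) (simp add: fps_agree_def, metis F_Suc \<Phi>)
  have F_stable: "F (i + Suc d) $ i = F (Suc i) $ i" for i d
  proof (induction d)
    case (Suc d)
    have "F (i + Suc d) $ i = F (Suc (i + Suc d)) $ i"
      using step[of "i + Suc d"] by (simp add: fps_agree_def)
    with Suc show ?case by simp
  qed simp
  (* Coefficient n is final after n + 1 iterations. *)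
  define f where "f = Abs_fps (\<lambda>n. F (Suc n) $ n)"
  have f: "fps_agree (Suc n) f (F (Suc n))" for n
    unfolding fps_agree_def f_def
  proof (intro allI impI)
    fix i assume "i < Suc n"
    then show "Abs_fps (\<lambda>n. F (Suc n) $ n) $ i = F (Suc n) $ i"
      using F_stable[of i "n - i"] by simp
  qed
  have "f = \<Phi> f"
  proof (rule fps_ext)
    fix n
    have "\<Phi> f $ n = F (Suc (Suc n)) $ n"
      using \<Phi>[OF f[of n]] by (simp add: fps_agree_def F_Suc)
    also have "\<dots> = f $ n" using F_stable[of n 1] by (simp add: f_def)
    finally show "f $ n = \<Phi> f $ n" by simp
  qed
  moreover have "coeffs_in B f" using FB by (auto simp: f_def coeffs_in_def)
  ultimately show ?thesis unfolding \<Phi>_def by blast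
qed

locale subring_set =
  fixes B :: "'a::comm_ring_1 set"
  assumes one_in: "1 \<in> B" and diff_in: "a \<in> B \<Longrightarrow> b \<in> B \<Longrightarrow> a - b \<in> B"
    and mult_in: "a \<in> B \<Longrightarrow> b \<in> B \<Longrightarrow> a * b \<in> B"
begin

lemma zero_in: "0 \<in> B" using diff_in[OF one_in one_in] by simp
lemma uminus_in: "a \<in> B \<Longrightarrow> - a \<in> B" using diff_in[OF zero_in] by simp
lemma add_in: "a \<in> B \<Longrightarrow> b \<in> B \<Longrightarrow> a + b \<in> B" using diff_in[of a "- b"] uminus_in by simp
lemma of_nat_in: "of_nat n \<in> B" by (induction n) (auto intro: zero_in one_in add_in)
lemma numeral_in: "numeral n \<in> B" using of_nat_in[of "numeral n"] by simp
lemma power_in: "a \<in> B \<Longrightarrow> a ^ n \<in> B" by (induction n) (auto intro: one_in mult_in)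
lemma sum_in: "(\<And>i. i \<in> I \<Longrightarrow> f i \<in> B) \<Longrightarrow> sum f I \<in> B"
  by (induction I rule: infinite_finite_induct) (auto intro: zero_in add_in)

lemma coeffs_in_const: "c \<in> B \<Longrightarrow> coeffs_in B (fps_const c)"
  by (simp add: coeffs_in_def zero_in)
lemma coeffs_in_X: "coeffs_in B fps_X" by (simp add: coeffs_in_def fps_X_def zero_in one_in)
lemma coeffs_in_subring: "subring_set (Collect (coeffs_in B))"
  by standard (auto simp: coeffs_in_def fps_mult_nth zero_in one_in intro!: diff_in sum_in mult_in)

lemmas coeffs_in_intros = coeffs_in_const coeffs_in_X subring_set.one_in[OF coeffs_in_subring, simplified] subring_set.diff_in[OF coeffs_in_subring, simplified]
  subring_set.mult_in[OF coeffs_in_subring, simplified] subring_set.add_in[OF coeffs_in_subring, simplified] subring_set.uminus_in[OF coeffs_in_subring, simplified]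
  subring_set.numeral_in[OF coeffs_in_subring, simplified] subring_set.power_in[OF coeffs_in_subring, simplified] subring_set.zero_in[OF coeffs_in_subring, simplified]

lemma fps_unit:
  assumes "coeffs_in B f" "f $ 0 = 1"
  shows "\<exists>g. f * g = 1 \<and> coeffs_in B g \<and> g $ 0 = 1"
proof -
  define h where "h = fps_shift 1 f"
  have f: "f = 1 + fps_X * h" using assms(2) by (auto simp: fps_eq_iff h_def)
  have h: "coeffs_in B h" using assms(1) by (auto simp: coeffs_in_def h_def)
  obtain g where g: "g = fps_const 1 + fps_X * (- (h * g))" "coeffs_in B g"
    using fps_fixpoint[of "\<lambda>g. - (h * g)" B 1] h
    by (auto intro!: fps_agree_intros coeffs_in_intros one_in zero_in)
  have "f * g = g + fps_X * h * g" by (simp add: f algebra_simps)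
  also have "\<dots> = 1" using g(1) by (simp add: algebra_simps eq_diff_eq)
  finally have "f * g = 1" .
  moreover have "g $ 0 = 1" by (subst g(1)) simp
  ultimately show ?thesis using g(2) by blast
qed

end

text \<open>
  Substitution of a series \<open>x\<close> without constant term for the variable, combined with a change of the
  coefficients by a ring homomorphism \<open>\<phi>\<close> into power series. Iterating it evaluates bivariate series.
\<close>
locale fps_eval =
  fixes \<phi> :: "'a::comm_ring_1 \<Rightarrow> 'b::comm_ring_1 fps" and x :: "'b fps"
  assumes hom_add: "\<phi> (a + b) = \<phi> a + \<phi> b" and hom_mult: "\<phi> (a * b) = \<phi> a * \<phi> b"
    and hom_1: "\<phi> 1 = 1" and x0: "x $ 0 = 0"
begin

lemma hom_0: "\<phi> 0 = 0" using hom_add[of 0 0] by simp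

lemma hom_sum: "\<phi> (sum f I) = (\<Sum>i\<in>I. \<phi> (f i))"
  by (induction I rule: infinite_finite_induct) (auto simp: hom_0 hom_add)

definition ev :: "'a fps \<Rightarrow> 'b fps" where
  "ev F = Abs_fps (\<lambda>N. (\<Sum>a\<le>N. \<phi> (F $ a) * x ^ a) $ N)"

lemma term_nth_0: "N < a \<Longrightarrow> (c * x ^ a) $ N = 0"
  using startsby_zero_power_prefix[OF x0, of a] by (auto simp: fps_mult_nth intro!: sum.neutral)

lemma ev_nth: "N \<le> M \<Longrightarrow> ev F $ N = (\<Sum>a\<le>M. \<phi> (F $ a) * x ^ a) $ N"
  unfolding ev_def fps_nth_Abs_fps fps_sum_nth
  by (rule sum.mono_neutral_left) (auto simp: term_nth_0)

lemma ev_add: "ev (F + G) = ev F + ev G"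
  by (rule fps_ext) (simp add: ev_def hom_add distrib_right sum.distrib)

lemma ev_mult: "ev (F * G) = ev F * ev G"
proof (rule fps_ext)
  fix N
  let ?g = "\<lambda>i j. \<phi> (F $ i) * \<phi> (G $ j) * x ^ (i + j)"
  have "(ev F * ev G) $ N = (\<Sum>k\<le>N. (\<Sum>a\<le>N. \<phi> (F $ a) * x ^ a) $ k * (\<Sum>a\<le>N. \<phi> (G $ a) * x ^ a) $ (N - k))"
    by (auto simp: fps_mult_nth atMost_atLeast0 ev_nth[of _ N] intro!: sum.cong)
  also have "\<dots> = ((\<Sum>a\<le>N. \<phi> (F $ a) * x ^ a) * (\<Sum>a\<le>N. \<phi> (G $ a) * x ^ a)) $ N"
    by (simp add: fps_mult_nth atMost_atLeast0)
  also have "(\<Sum>a\<le>N. \<phi> (F $ a) * x ^ a) * (\<Sum>a\<le>N. \<phi> (G $ a) * x ^ a) = (\<Sum>(i, j)\<in>{..N} \<times> {..N}. ?g i j)"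
    by (simp add: sum_product sum.cartesian_product power_add mult_ac)
  also have "\<dots> $ N = (\<Sum>(i, j)\<in>{(i, j). i + j \<le> N}. ?g i j $ N)"
    unfolding fps_sum_nth
    by (rule sum.mono_neutral_cong_right) (auto intro: leI dest: term_nth_0)
  also have "\<dots> = (\<Sum>k\<le>N. \<Sum>i\<le>k. ?g i (k - i) $ N)"
    by (rule sum.triangle_reindex_eq)
  also have "\<dots> = ev (F * G) $ N"
    by (simp add: ev_def fps_sum_nth fps_mult_nth hom_sum hom_mult sum_distrib_right atMost_atLeast0)
  finally show "ev (F * G) $ N = (ev F * ev G) $ N" by simp
qed

lemma ev_const: "ev (fps_const c) = \<phi> c"
proof (rule fps_ext)
  fix N
  have "ev (fps_const c) $ N = (\<Sum>a\<in>{0}. (\<phi> (fps_const c $ a) * x ^ a) $ N)"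
    unfolding ev_def fps_nth_Abs_fps fps_sum_nth
    by (rule sum.mono_neutral_right) (auto simp: hom_0)
  then show "ev (fps_const c) $ N = \<phi> c $ N" by simp
qed

lemma ev_1: "ev 1 = 1" using ev_const[of 1] hom_1 by simp

lemma ev_X: "ev fps_X = x"
proof (rule fps_ext)
  fix N
  show "ev fps_X $ N = x $ N"
  proof (cases "N = 0")
    case True then show ?thesis by (simp add: ev_def hom_0 x0)
  next
    case False
    have "ev fps_X $ N = (\<Sum>a\<in>{1}. (\<phi> (fps_X $ a) * x ^ a) $ N)"
      unfolding ev_def fps_nth_Abs_fps fps_sum_nth
      by (rule sum.mono_neutral_right) (use False in \<open>auto simp: hom_0 fps_X_def\<close>)
    then show ?thesis by (simp add: hom_1)
  qed
qed

lemma eval_ev: "y $ 0 = 0 \<Longrightarrow> fps_eval ev y"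
  by standard (auto simp: ev_add ev_mult ev_1)

lemma ev_0: "ev 0 = 0" using ev_add[of 0 0] by simp
lemma ev_uminus: "ev (- F) = - ev F" using ev_add[of F "- F"] by (simp add: ev_0 eq_neg_iff_add_eq_0 add.commute)
lemma ev_diff: "ev (F - G) = ev F - ev G" using ev_add[of F "- G"] by (simp add: ev_uminus)
lemma ev_of_nat: "ev (of_nat n) = of_nat n" by (induction n) (auto simp: ev_0 ev_1 ev_add)
lemma ev_numeral: "ev (numeral n) = numeral n" using ev_of_nat[of "numeral n"] by simp
lemma ev_power: "ev (F ^ n) = ev F ^ n" by (induction n) (auto simp: ev_1 ev_mult)

lemmas ev_simps = ev_0 ev_1 ev_add ev_mult ev_const ev_X ev_uminus ev_diff ev_numeral ev_power

lemma ev_nth_0: "ev F $ 0 = \<phi> (F $ 0) $ 0"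
  by (simp add: ev_def)

text \<open>
  If every contribution to orders below \<open>m\<close> vanishes, then at order \<open>m\<close> only the linear term of \<open>x\<close>
  counts, and each coefficient of \<open>F\<close> contributes only its own leading coefficient.
\<close>
lemma ev_lowest:
  assumes "\<And>i b. i < m \<Longrightarrow> b \<le> i \<Longrightarrow> \<phi> (F $ b) $ (i - b) = 0"
  shows "ev F $ m = (\<Sum>b\<le>m. \<phi> (F $ b) $ (m - b) * (x $ 1) ^ b)"
  unfolding ev_def fps_nth_Abs_fps fps_sum_nth
proof (rule sum.cong[OF refl])
  fix b assume b: "b \<in> {..m}"
  have "(\<phi> (F $ b) * x ^ b) $ m = (\<Sum>k\<in>{0..m}. \<phi> (F $ b) $ k * (x ^ b) $ (m - k))"
    by (simp add: fps_mult_nth)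
  also have "\<dots> = (\<Sum>k\<in>{m - b}. \<phi> (F $ b) $ k * (x ^ b) $ (m - k))"
  proof (rule sum.mono_neutral_right)
    show "\<forall>k\<in>{0..m} - {m - b}. \<phi> (F $ b) $ k * x ^ b $ (m - k) = 0"
    proof
      fix k assume k: "k \<in> {0..m} - {m - b}"
      then consider "k < m - b" | "m - k < b" using b by force
      then show "\<phi> (F $ b) $ k * x ^ b $ (m - k) = 0"
      proof cases
        case 1
        then show ?thesis using assms[of "k + b" b] by simp
      next
        case 2
        then show ?thesis using startsby_zero_power_prefix[OF x0, of b] by simp
      qed
    qed
  qed auto
  also have "\<dots> = \<phi> (F $ b) $ (m - b) * (x $ 1) ^ b"
    using b startsby_zero_power_nth_same[OF x0, of b] by simp
  finally show "(\<phi> (F $ b) * x ^ b) $ m = \<phi> (F $ b) $ (m - b) * (x $ 1) ^ b" .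
qed

end

section \<open>A curve of zeros of the kernel\<close>

text \<open>
  The curve on which the kernel vanishes has its points in \<open>\<rat>((\<lambda>))[[z]]\<close>, where \<open>\<lambda>\<close> is \<open>fls_X\<close> and \<open>z\<close> is \<open>fps_X\<close>.
  The length variable is sent to \<open>z^2\<close>, and \<open>u\<close> and \<open>v\<close> are sent to \<open>u_pt\<close> and \<open>v_pt\<close>.
\<close>
definition emb :: "rat fps \<Rightarrow> rat fls fps" where
  "emb f = Abs_fps (\<lambda>n. fls_const (f $ n)) oo fps_X ^ 2"

lemma emb_nth: "emb f $ n = (if even n then fls_const (f $ (n div 2)) else 0)"
  by (auto simp: emb_def fps_nth_compose_X_power)

lemma emb_add: "emb (f + g) = emb f + emb g"
  by (rule fps_ext) (simp add: emb_nth fls_plus_const)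

lemma emb_1: "emb 1 = 1"
  by (rule fps_ext) (auto simp: emb_nth)

lemma fls_const_sum: "fls_const (sum f I) = (\<Sum>i\<in>I. fls_const (f i))"
  by (induction I rule: infinite_finite_induct) (simp_all flip: fls_plus_const)

lemma emb_mult: "emb (f * g) = emb f * emb g"
proof -
  have "Abs_fps (\<lambda>n. fls_const ((f * g) $ n)) = Abs_fps (\<lambda>n. fls_const (f $ n)) * Abs_fps (\<lambda>n. fls_const (g $ n))"
    by (rule fps_ext) (simp add: fps_mult_nth fls_const_sum)
  then show ?thesis unfolding emb_def by (simp add: fps_compose_mult_distrib)
qed

lemma emb_power: "emb (f ^ m) = emb f ^ m"
  by (induction m) (auto simp: emb_1 emb_mult)

lemma emb_X: "emb fps_X = fps_X ^ 2"
  by (rule fps_ext) (auto simp: emb_nth fps_X_nth fps_X_power_nth elim!: evenE)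

definition u_pt :: "rat fls fps" where "u_pt = fps_const fls_X * fps_X"

text \<open>
  With \<open>v = z g\<close> the vanishing of the kernel is the fixed point equation
  \<open>g = 1/\<lambda> + z (g + \<lambda>^2 z^2 g + \<lambda>^2 z^3 g^2) / \<lambda>\<close>.
\<close>
lemma kernel_point_exists:
  "\<exists>v :: rat fls fps. v $ 0 = 0 \<and> v $ 1 = fls_X_inv \<and>
     fps_X ^ 2 * ((1 + v) * (u_pt ^ 2 * v + 1)) = u_pt * v"
proof -
  let ?X = "fps_X :: rat fls fps" and ?l = "fps_const fls_X :: rat fls fps" and ?k = "fps_const fls_X_inv :: rat fls fps"
  interpret subring_set "UNIV :: rat fls set" by standard auto
  obtain g where g: "g = fps_const fls_X_inv + ?X * (?k * (g + ?l ^ 2 * ?X ^ 2 * g + ?l ^ 2 * ?X ^ 3 * g ^ 2))"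
    using fps_fixpoint[of "\<lambda>g. ?k * (g + ?l ^ 2 * ?X ^ 2 * g + ?l ^ 2 * ?X ^ 3 * g ^ 2)" UNIV "fls_X_inv :: rat fls"]
    by (auto intro!: fps_agree_intros coeffs_in_intros)
  have lk: "?l * ?k = 1" using right_inverse[of "fls_X :: rat fls"] by (simp add: fls_inverse_X)
  define v where "v = ?X * g"
  have "v $ 0 = 0" by (simp add: v_def)
  moreover have "v $ 1 = fls_X_inv" by (simp add: v_def, subst g, simp)
  moreover have "?X ^ 2 * ((1 + v) * (u_pt ^ 2 * v + 1)) = u_pt * v"
  proof -
    have "?l * g = (?l * ?k) * (1 + ?X * g + ?l ^ 2 * ?X ^ 3 * g + ?l ^ 2 * ?X ^ 4 * g ^ 2)"
      by (subst g) algebra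
    then have "?l * g = (1 + ?X * g) * (?l ^ 2 * ?X ^ 3 * g + 1)"
      unfolding lk by algebra
    then show ?thesis unfolding v_def u_pt_def by algebra
  qed
  ultimately show ?thesis by blast
qed

definition v_pt :: "rat fls fps" where
  "v_pt = (SOME v. v $ 0 = 0 \<and> v $ 1 = fls_X_inv \<and> fps_X ^ 2 * ((1 + v) * (u_pt ^ 2 * v + 1)) = u_pt * v)"

lemma v_pt: "v_pt $ 0 = 0" "v_pt $ 1 = fls_X_inv"
    "fps_X ^ 2 * ((1 + v_pt) * (u_pt ^ 2 * v_pt + 1)) = u_pt * v_pt"
  using someI_ex[OF kernel_point_exists] unfolding v_pt_def[symmetric] by auto

lemma u_pt: "u_pt $ 0 = 0" "u_pt $ 1 = fls_X" by (simp_all add: u_pt_def)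

interpretation evu: fps_eval emb u_pt
  by standard (auto simp: emb_add emb_mult emb_1 u_pt)
interpretation evv: fps_eval emb v_pt
  by standard (auto simp: emb_add emb_mult emb_1 v_pt)

text \<open>
  The two unknown series cannot compensate each other: in the lowest order in \<open>z\<close>, the coefficients of
  \<open>e\<close> occur with the powers \<open>\<lambda>^a\<close>, where \<open>a \<ge> 1\<close> as \<open>e\<close> has no constant term, and those of \<open>d\<close> occur with \<open>\<lambda>^(-b)\<close>, where
  \<open>b \<ge> 0\<close>. The unit \<open>c\<close> only contributes its constant term \<open>-1/2\<close>. The induction is on the order
  \<open>m\<close>, where a coefficient at \<open>u^a t^i\<close> has order \<open>a + 2 i\<close>.
\<close>
lemma kernel_uniqueness:
  assumes e0: "e $ 0 = 0" and c0: "c $ 0 = fls_const (-1/2)"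
    and eq: "evu.ev e = c * evv.ev d"
  shows "e = 0 \<and> d = 0"
proof -
  have "(\<forall>a\<le>m. emb (e $ a) $ (m - a) = 0) \<and> (\<forall>b\<le>m. emb (d $ b) $ (m - b) = 0)" for m
  proof (induction m rule: less_induct)
    case (less m)
    have le: "evu.ev e $ i = (\<Sum>a\<le>i. emb (e $ a) $ (i - a) * fls_X ^ a)" if "i \<le> m" for i
      by (subst evu.ev_lowest) (use that less in \<open>auto simp: u_pt[unfolded One_nat_def]\<close>)
    have ld: "evv.ev d $ i = (\<Sum>b\<le>i. emb (d $ b) $ (i - b) * fls_X_inv ^ b)" if "i \<le> m" for i
      by (subst evv.ev_lowest) (use that less in \<open>auto simp: v_pt[unfolded One_nat_def]\<close>)
    have d0: "evv.ev d $ i = 0" if "i < m" for i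
      using that less by (simp add: ld)
    define E where "E a = (if even (m - a) then e $ a $ ((m - a) div 2) else 0)" for a
    define D where "D b = (if even (m - b) then d $ b $ ((m - b) div 2) else 0)" for b
    have E: "emb (e $ a) $ (m - a) = fls_const (E a)" and D: "emb (d $ a) $ (m - a) = fls_const (D a)" for a
      by (auto simp: emb_nth E_def D_def)
    have "(c * evv.ev d) $ m = (\<Sum>k\<in>{0}. c $ k * evv.ev d $ (m - k))"
      unfolding fps_mult_nth by (rule sum.mono_neutral_right) (auto simp: d0)
    then have main: "(\<Sum>a\<le>m. fls_const (E a) * fls_X ^ a) = fls_const (-1/2) * (\<Sum>b\<le>m. fls_const (D b) * fls_X_inv ^ b)"
      using eq le[of m] ld[of m] c0 by (simp add: E D)
    (* Positive powers of lambda see only E, nonpositive ones only D. *)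
    have n1: "fls_nth (\<Sum>a\<le>m. fls_const (E a) * fls_X ^ a) k = (\<Sum>a\<le>m. if k = int a then E a else 0)" for k
      by (auto simp: fls_nth_sum fls_X_power_times_conv_shift intro!: sum.cong)
    have n2: "fls_nth (fls_const (-1/2) * (\<Sum>b\<le>m. fls_const (D b) * fls_X_inv ^ b)) k = -1/2 * (\<Sum>b\<le>m. if k = - int b then D b else 0)" for k
      by (auto simp: fls_nth_sum fls_X_inv_power_times_conv_shift sum_distrib_left intro!: sum.cong)
    have E0: "E 0 = 0" by (simp add: E_def e0)
    have "E a = 0" if "a \<le> m" for a
    proof (cases "a = 0")
      case False
      have "(\<Sum>a'\<le>m. if int a = int a' then E a' else 0) = E a" using that by (simp add: sum.delta)
      moreover have "(\<Sum>b\<le>m. if int a = - int b then D b else 0) = 0" using False by (auto intro!: sum.neutral)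
      ultimately show ?thesis using arg_cong[OF main, of "\<lambda>f. fls_nth f (int a)"] unfolding n1 n2 by simp
    qed (simp add: E0)
    moreover have "D b = 0" if "b \<le> m" for b
    proof -
      have "(\<Sum>b'\<le>m. if - int b = - int b' then D b' else 0) = D b" using that by (simp add: sum.delta)
      moreover have "(\<Sum>a\<le>m. if - int b = int a then E a else 0) = 0" using E0 by (auto intro!: sum.neutral)
      ultimately show ?thesis using arg_cong[OF main, of "\<lambda>f. fls_nth f (- int b)"] unfolding n1 n2 by simp
    qed
    ultimately show ?case by (simp add: E D)
  qed
  note * = this
  have "e $ a $ n = 0" "d $ a $ n = 0" for a n
    using *[of "a + 2 * n"] by (auto simp: emb_nth dest!: spec[of _ a])
  then show ?thesis by (auto intro!: fps_ext)
qed

section \<open>The parametrized solution as an identity in a field\<close>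

text \<open>
  The cubic equation of \<open>q\<close> over the field of \<open>g (K - g)\<close>, first in the parametrization by \<open>x\<close> and then in
  the one by \<open>w\<close>. Both lemmas only remove the denominators; what remains is a polynomial identity. The factors stay
  abstract here, which keeps the degrees small.
\<close>
lemma u_cubic_clear_denominators:
  fixes q x a b n g G K b1 Cn d1 :: "'a::field_char_0"
  assumes q: "q * (x * b) = n * a^2" and g: "g * (x * a * b) = G"
    and poly: "-(n^2*a^6) + b1*n*a^4*b*x - Cn*a^2*b^2*x^2 + d1*b^3*x^3 - G*(K*x*a*b - G) = 0"
    and nz: "x \<noteq> 0" "b \<noteq> 0"
  shows "b1*q^2 + n*d1 = q^3 + Cn*q + g*(K - g)*q"
proof -
  have "(b1*q^2 + n*d1 - (q^3 + Cn*q + g*(K - g)*q)) * (x*b)^3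
     = b1*(q*(x*b))^2*(x*b) + n*d1*(x*b)^3 - (q*(x*b))^3 - Cn*(q*(x*b))*(x*b)^2 - g*(K-g)*(q*(x*b))*(x*b)^2"
    by algebra
  also have "\<dots> = n * (-(n^2*a^6) + b1*n*a^4*b*x - Cn*a^2*b^2*x^2 + d1*b^3*x^3 - (g * (x * a * b))*(K*x*a*b - g * (x * a * b)))"
    unfolding q by algebra
  also have "\<dots> = 0" unfolding g poly by simp
  finally show ?thesis using nz by simp
qed

lemma v_cubic_clear_denominators:
  fixes q w c s P m1 m2 m3 m4 n K k b1 Cn d1 J1 J2 :: "'a::field_char_0"
  assumes q: "q * P = d1*w*c^2" and P: "P = m1*m2*m3*m4"
    and J1: "J1 * (w * m1^2 * m2^2) = n*(m2^2-k^3*w*m1^2)^2" and J2: "J2*(c* s)^2 = K^2*k^3*w*m1^2*m2^2"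
    and poly: "b1*d1*w^2*c^4*P* s^2 + n*P^3* s^2 =
    d1^2*w^3*c^6* s^2 + Cn*w*c^2*P^2* s^2+ n*(m2^2-k^3*w*m1^2)^2*c^2*m3^2*m4^2* s^2+K^2*k^3*w^2*m1^4*m2^4*m3^2*m4^2"
    and nz: "P \<noteq> 0" "s \<noteq> 0"
  shows "b1*q^2 + n*d1 = q^3 + Cn*q + (J1 + J2)*q"
proof -
  have "(b1*q^2 + n*d1 - (q^3 + Cn*q + (J1 + J2)*q)) * (P^3 * s^2)
     = b1*(q*P)^2*P* s^2 + n*d1*P^3* s^2 - (q*P)^3* s^2 - Cn*(q*P)*P^2* s^2 - J1*(q*P)*P^2* s^2 - J2*(q*P)*P^2* s^2"
    by algebra
  also have "\<dots> = d1 * (b1*d1*w^2*c^4*P* s^2 + n*P^3* s^2 - d1^2*w^3*c^6* s^2 - Cn*w*c^2*P^2* s^2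
      - (J1*(w*m1^2*m2^2))*c^2* s^2*m3^2*m4^2 - (J2*(c* s)^2)*w*P^2)"
    unfolding q unfolding P by algebra
  also have "\<dots> = d1 * (b1*d1*w^2*c^4*P* s^2 + n*P^3* s^2 - (d1^2*w^3*c^6* s^2 + Cn*w*c^2*P^2* s^2
      + n*(m2^2-k^3*w*m1^2)^2*c^2*m3^2*m4^2* s^2+K^2*k^3*w^2*m1^4*m2^4*m3^2*m4^2))"
    unfolding J1 J2 unfolding P by algebra
  also have "\<dots> = 0" unfolding poly by simp
  finally show ?thesis using nz by simp
qed

text \<open>
  On the kernel, \<open>t (u + 1/u) (1 - t (u + 1/u))\<close> is a rational function of \<open>v\<close> alone: the pair is an invariant of the
  model in the sense of Tutte. It links the parametrization by \<open>x\<close>, which belongs to \<open>u\<close>, to the one by \<open>w\<close>, which belongs to \<open>v\<close>.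
\<close>
lemma kernel_invariant:
  fixes t u v K n k :: "'a::field_char_0"
  assumes th: "K^2*t^2 = n*k^3" and kern: "t * ((1 + v)*(u^2* v + 1)) = u* v"
    and nz: "u \<noteq> 0" "v \<noteq> 0" "1 + v \<noteq> 0" "t \<noteq> 0" "u^2* v+1 \<noteq> 0"
  shows "K*t*(u+1/u)*(K - K*t*(u+1/u)) = n*k^3*(1-v)^2/v + K^2* v/(1+v)^2"
proof -
  have t: "t = u* v/((1 + v)*(u^2* v + 1))" using kern nz by (subst eq_divide_eq) simp
  have "t*(u+1/u)*(1 - t*(u+1/u)) = t^2*(1-v)^2/v + v/(1+v)^2"
  proof -
    have "u*(u+1/u) = u^2+1" using nz by (simp add: distrib_left power2_eq_square)
    moreover have "t*(u+1/u) = v *(u*(u+1/u))/((1 + v)*(u^2* v + 1))" by (simp add: t mult_ac)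
    ultimately have "t*(u+1/u) = v *(u^2+1)/((1 + v)*(u^2* v + 1))" by (simp only:)
    moreover have "1 - v *(u^2+1)/((1 + v)*(u^2* v + 1)) = (1 + u^2* v^2)/((1 + v)*(u^2* v + 1))"
      using nz by (simp add: divide_simps) algebra
    ultimately have "t*(u+1/u)*(1 - t*(u+1/u)) = v *(u^2+1)*(1 + u^2* v^2)/((1 + v)*(u^2* v + 1))^2"
      by (simp add: power2_eq_square)
    also have "\<dots> = t^2*(1-v)^2/v + v/(1+v)^2"
    proof -
      have "t^2*(1-v)^2/v = u^2* v *(1-v)^2/((1 + v)*(u^2* v + 1))^2"
        using nz by (simp add: t power_divide power2_eq_square mult_ac)
      moreover have "v/(1+v)^2 = v *(u^2* v+1)^2/((1 + v)*(u^2* v + 1))^2"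
        using nz by (simp add: power_mult_distrib)
      moreover have "v *(u^2+1)*(1 + u^2* v^2) = u^2* v *(1-v)^2 + v *(u^2* v+1)^2" by algebra
      ultimately show ?thesis by (simp add: add_divide_distrib[symmetric])
    qed
    finally show ?thesis .
  qed
  then have "K^2*(t*(u+1/u)*(1 - t*(u+1/u))) = K^2*(t^2*(1-v)^2/v + v/(1+v)^2)" by simp
  also have "\<dots> = (K^2*t^2)*(1-v)^2/v + K^2* v/(1+v)^2" by (simp add: distrib_left)
  finally show ?thesis unfolding th by (simp add: power2_eq_square algebra_simps)
qed

text \<open>
  As an equation for \<open>u\<close> the kernel is quadratic with discriminant \<open>v (v - 4 t^2 (1 + v)^2)\<close>. Its square root is
  \<open>v (1 - 2 t u (1 + v))\<close>, and this is also, up to the factor \<open>- u / 2\<close>, the coefficient of \<open>D\<close> in the functional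
  equation.
\<close>
lemma kernel_discriminant:
  fixes t u v :: "'a::field_char_0"
  assumes kern: "t * ((1 + v)*(u^2* v + 1)) = u* v"
    and nz: "u \<noteq> 0" "v \<noteq> 0" "1 + v \<noteq> 0" "t \<noteq> 0" "u^2* v+1 \<noteq> 0"
  shows "v * (1 - 2*t*u*(1+v))^2 = v - 4*t^2*(1+v)^2" and "u* v/2 - t*(1+v) = - (u* v *(1 - 2*t*u*(1+v))/2)"
    and "t - t^2*(u+1/u) = t^2*u* v *(1+u^2) + u* v *(1 - 2*t*u*(1+v))/(1+v)^2"
proof -
  show "v * (1 - 2*t*u*(1+v))^2 = v - 4*t^2*(1+v)^2"
  proof -
    have "v * (1 - 2*t*u*(1+v))^2 - (v - 4*t^2*(1+v)^2) = 4*t*(1+v)*(t * ((1 + v)*(u^2* v + 1)) - u* v)" by algebra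
    then show ?thesis using kern by simp
  qed
  show 2: "u* v/2 - t*(1+v) = - (u* v *(1 - 2*t*u*(1+v))/2)"
  proof -
    have "2*(u* v/2 - t*(1+v) - (- (u* v *(1 - 2*t*u*(1+v))/2))) = 2*(u* v - t * ((1 + v)*(u^2* v + 1)))"
      by (simp add: field_simps power2_eq_square)
    then show ?thesis unfolding kern by (simp only: diff_self mult_zero_right mult_eq_0_iff) (simp add: eq_neg_iff_add_eq_0)
  qed
  have t: "t = u* v/((1 + v)*(u^2* v + 1))" using kern nz by (subst eq_divide_eq) simp
  define p where "p = u^2* v"
  define M where "M = (1+v)*(1+p)"
  have M: "M \<noteq> 0" using nz by (simp add: M_def p_def add.commute)
  have tM: "t * M = u* v" using kern by (simp add: M_def p_def add.commute mult_ac)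
  have d: "(1 - 2*t*u*(1+v)) * (1 + p) = 1 - p"
  proof -
    have "(1 - 2*t*u*(1+v)) * (1 + p) = 1 + p - 2*u*(t*M)" by (simp add: M_def algebra_simps)
    then show ?thesis unfolding tM by (simp add: p_def power2_eq_square)
  qed
  have "(t - t^2*(u+1/u)) * M^2 = (t*M)*M - (t*M)^2*(u+1/u)" by (simp add: algebra_simps power2_eq_square)
  also have "\<dots> = u* v *(1 + p* v)"
    unfolding tM unfolding M_def p_def using nz by (simp add: field_simps power2_eq_square)
  also have "\<dots> = (t*M)^2*u* v *(1+u^2) + u* v *((1 - 2*t*u*(1+v))*(1+p))*(1+p)"
    unfolding tM d unfolding p_def by (simp add: algebra_simps power2_eq_square)
  also have "\<dots> = (t^2*u* v *(1+u^2) + u* v *(1 - 2*t*u*(1+v))/(1+v)^2) * M^2"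
  proof -
    have "u* v *(1 - 2*t*u*(1+v))/(1+v)^2 * M^2 = u* v *(1 - 2*t*u*(1+v))*(1+p)^2"
      using nz by (simp add: M_def power_mult_distrib)
    moreover have "(t*M)^2*u* v *(1+u^2) = (t^2*u* v *(1+u^2)) * M^2" by (simp add: power_mult_distrib mult_ac)
    moreover have "u* v *((1 - 2*t*u*(1+v))*(1+p))*(1+p) = u* v *(1 - 2*t*u*(1+v))*(1+p)^2"
      by (simp only: power2_eq_square mult_ac)
    ultimately show ?thesis by (simp only: distrib_right)
  qed
  finally show "t - t^2*(u+1/u) = t^2*u* v *(1+u^2) + u* v *(1 - 2*t*u*(1+v))/(1+v)^2"
    using M by simp
qed

text \<open>
  The identities below hold in \<open>\<rat>[n, x]\<close> and \<open>\<rat>[n, w]\<close>. The polynomials \<open>N1\<close>, ..., \<open>Ng\<close> and \<open>m1\<close>, ..., \<open>m5\<close>,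
  \<open>c\<close>, \<open>s\<close> are the factors of the numerators and denominators in the parametrizations.
\<close>
lemma u_cubic_identity:
  fixes n x k K b1 d1 Cn N1 N2 N3 N4 :: "'a::field_char_0"
  assumes "k = 1-n+n^2" and "K = (1-n)*(1+n)^3"
    and "b1 = 1+4*n-6*n^2+4*n^3+n^4" and "d1 = (1+n^2)^4*(1-n)^2"
    and "Cn = 3*n-8*n^2+13*n^3-12*n^4+13*n^5-8*n^6+3*n^7"
    and "N1 = 1+n^2*x" and "N2 = 1+n^3*x" and "N3 = 1+k*x" and "N4 = 1+n*k*x"
  shows "-(n^2*(N2*N3)^6)+b1*n*(N2*N3)^4*(N1*N4)*x-Cn*(N2*N3)^2*(N1*N4)^2*x^2+d1*(N1*N4)^3*x^3
    -(k^3*x^2*N1^2*N2^2+n*N3^2*N4^2)*(K*x*(N2*N3)*(N1*N4)-(k^3*x^2*N1^2*N2^2+n*N3^2*N4^2))=0"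
  unfolding assms by algebra
lemma v_cubic_identity:
  fixes n w k K b1 d1 Cn m1 m2 m3 m4 c s :: "'a::field_char_0"
  assumes "k = 1-n+n^2" and "K = (1-n)*(1+n)^3"
    and "b1 = 1+4*n-6*n^2+4*n^3+n^4" and "d1 = (1+n^2)^4*(1-n)^2"
    and "Cn = 3*n-8*n^2+13*n^3-12*n^4+13*n^5-8*n^6+3*n^7"
    and "m1 = 1+n^3*w" and "m2 = 1+k^2*n*w" and "m3 = 1+n^4*k*w" and "m4 = 1+k*w" and "c = 1+k*n^2*w"
    and "s = 1+(k^3+2*k^2*n-k*n^2)*w+n^4*k^2*w^2"
  shows "b1*d1*w^2*c^4*(m1*m2*m3*m4)* s^2 + n*(m1*m2*m3*m4)^3* s^2 =
    d1^2*w^3*c^6* s^2 + Cn*w*c^2*(m1*m2*m3*m4)^2* s^2+ n*(m2^2-k^3*w*m1^2)^2*c^2*m3^2*m4^2* s^2+K^2*k^3*w^2*m1^4*m2^4*m3^2*m4^2"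
  unfolding assms by algebra

text \<open>
  The discriminant of the kernel, expressed by \<open>w\<close>, agrees with \<open>q (q - 4 n (1-n)^2)\<close> up to squares
  and a factor \<open>w\<close>.
\<close>
lemma v_discriminant_identity:
  fixes n w k K m1 m2 m3 m4 m5 c s :: "'a::field_char_0"
  assumes "k = 1-n+n^2" and "K = (1-n)*(1+n)^3"
    and "m1 = 1+n^3*w" and "m2 = 1+k^2*n*w" and "m3 = 1+n^4*k*w" and "m4 = 1+k*w" and "c = 1+k*n^2*w"
    and "s = 1+(k^3+2*k^2*n-k*n^2)*w+n^4*k^2*w^2" and "m5 = 1-n*(k^2-3*n^2)*w+n^4*k^2*w^2"
  shows "(1-k*n^2*w)^2*(K^2*w*m1^2*m2^2-4*n*c^2* s^2)=((1+n^2)^4*w*c^2-4*n*(m1*m2*m3*m4))*m5^2"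
  unfolding assms by algebra

lemma one_plus_v_factorization:
  fixes n w k m1 m2 c s :: "'a::field_char_0"
  assumes "k = 1-n+n^2" and "m1 = 1+n^3*w" and "m2 = 1+k^2*n*w" and "c = 1+k*n^2*w"
    and "s = 1+(k^3+2*k^2*n-k*n^2)*w+n^4*k^2*w^2"
  shows "m2^2 + k^3*w*m1^2 = c* s"
  unfolding assms by algebra

lemma r_square_identity:
  fixes n x k N1 N2 N3 N4 Ng :: "'a::field_char_0"
  assumes "k = 1-n+n^2" and "N1 = 1+n^2*x" and "N2 = 1+n^3*x" and "N3 = 1+k*x" and "N4 = 1+n*k*x"
    and "Ng = 1+(n^3-n^2+3*n-1)*x+n^3*k*x^2"
  shows "Ng^2 = (N3*N2)^2 - 4*(1-n)^2*x*N1*N4"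
  unfolding assms by algebra

text \<open>
  The heart of the proof. Both \<open>qu\<close> (a function of \<open>x\<close>) and \<open>q\<close> (a function of \<open>w\<close>) are roots of one cubic equation, so
  they agree unless the other factor of the difference of the two equations vanishes; \<open>neq1\<close> excludes this. Likewise \<open>r\<close> and
  \<open>K v (1 - 2 t u (1 + v)) h\<close> are square roots of \<open>q (q - 4 n (1-n)^2)\<close>, and \<open>neq2\<close> excludes opposite
  signs. With these two equalities \<open>e\<close> and \<open>d\<close>, which are functions of \<open>x\<close> and \<open>w\<close> alone, become expressions in \<open>u\<close>, \<open>v\<close>, \<open>q\<close>
  and the common square root, and the required relation is \<open>kernel_discriminant\<close>.
\<close>
lemma explicit_solution_at_kernel_point:
  fixes n t u v x w q h j d e k K b1 d1 Cn e1 N1 N2 N3 N4 Ng m1 m2 m3 m4 m5 c s :: "'a::field_char_0"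
  assumes k: "k = 1-n+n^2" and K: "K = (1-n)*(1+n)^3"
    and b1: "b1 = 1+4*n-6*n^2+4*n^3+n^4" and d1: "d1 = (1+n^2)^4*(1-n)^2"
    and Cn: "Cn = 3*n-8*n^2+13*n^3-12*n^4+13*n^5-8*n^6+3*n^7"
    and N: "N1 = 1+n^2*x" "N2 = 1+n^3*x" "N3 = 1+k*x" "N4 = 1+n*k*x" "Ng = 1+(n^3-n^2+3*n-1)*x+n^3*k*x^2"
    and m: "m1 = 1+n^3*w" "m2 = 1+k^2*n*w" "m3 = 1+n^4*k*w" "m4 = 1+k*w" "m5 = 1-n*(k^2-3*n^2)*w+n^4*k^2*w^2"
    and c: "c = 1+k*n^2*w" and s: "s = 1+(k^3+2*k^2*n-k*n^2)*w+n^4*k^2*w^2"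
    and theta: "K^2*t^2 = n*k^3" and kern: "t * ((1 + v)*(u^2* v + 1)) = u* v"
    and x: "K*t*u*(N3*N4) = k^3*x*(N1*N2)" and w: "v *m2^2 = k^3*w*m1^2"
    and q: "q*(m1*m2*m3*m4) = d1*w*c^2"
    and h: "h*(k^3*m1^2*m3*m4*m5) = (1+n^2)^2*(1-n)^2*(1-k^2*n^4*w^2)*m2^2"
    and j: "j*(1+v) = 1" and d: "d = 2*((e1-q)*h - K*j^2)"
    and e: "e*x*(N1*N2*N4^3) = x*(K - K*t*u)*(N1*N2*N4^3) - e1*N2^2*Ng*N1*N2*N4*x + n*(N2^5*N3^2*Ng - N3*N4^4)"
    and nz: "K \<noteq> 0" "t \<noteq> 0" "u \<noteq> 0" "v \<noteq> 0" "1 + v \<noteq> 0" "u^2* v+1 \<noteq> 0" "n \<noteq> 0" "k \<noteq> 0" "x \<noteq> 0" "w \<noteq> 0"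
      "N1 \<noteq> 0" "N2 \<noteq> 0" "N3 \<noteq> 0" "N4 \<noteq> 0" "m1 \<noteq> 0" "m2 \<noteq> 0" "m3 \<noteq> 0" "m4 \<noteq> 0" "m5 \<noteq> 0"
    and qu: "qu = K*(t/u)*N3*N2^3/N4^2" and r: "r = K*(t/u)*N2^2*Ng/N4^2" and g: "g = K*t*(u+1/u)"
    and neq1: "b1*(qu+q) - (qu^2+qu*q+q^2) - Cn - g*(K-g) \<noteq> 0"
    and neq2: "r + K* v *(1 - 2*t*u*(1+v))*h \<noteq> 0"
  shows "t*e = K*t^2*(u* v *(1+u^2)) + (u* v/2 - t*(1+v))*d"
proof -
  have Ktu: "K*t*u = k^3*x*(N1*N2)/(N3*N4)" using x nz by (simp add: eq_divide_eq)
  (* The product of K t u and K t / u is K^2 t^2 = n k^3, so t / u is rational in x as well as t u. *)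
  have Kt_u: "K*(t/u) = n*(N3*N4)/(x*(N1*N2))"
  proof -
    have "(K*(t/u)) * (K*t*u) = K^2*t^2" using nz by (simp add: power2_eq_square)
    then have "(K*(t/u)) * (k^3*x*(N1*N2)/(N3*N4)) = n*k^3" unfolding Ktu theta .
    then show ?thesis using nz by (simp add: field_simps)
  qed
  have qu': "qu*(x*(N1*N4)) = n*(N2*N3)^2" unfolding qu Kt_u using nz by (simp add: field_simps power2_eq_square power3_eq_cube)
  have r': "r*(x*(N1*N4)) = n*N3*N2*Ng" unfolding r Kt_u using nz by (simp add: field_simps power2_eq_square)
  have g': "g*(x*(N2*N3)*(N1*N4)) = k^3*x^2*N1^2*N2^2+n*N3^2*N4^2"
  proof -
    have "g = K*t*u + K*(t/u)" unfolding g by (simp add: algebra_simps)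
    then show ?thesis unfolding Ktu Kt_u using nz by (simp add: field_simps power2_eq_square)
  qed
  have cubic_u: "b1*qu^2 + n*d1 = qu^3 + Cn*qu + g*(K - g)*qu"
    by (rule u_cubic_clear_denominators[OF qu' g' u_cubic_identity[OF k K b1 d1 Cn N(1-4)]]) (use nz in auto)
  have v: "v = k^3*w*m1^2/m2^2" using w nz by (simp add: eq_divide_eq)
  have v1: "1 + v = c* s/m2^2"
    unfolding one_plus_v_factorization[OF k m(1,2) c s, symmetric] v using nz by (simp add: add_divide_distrib)
  have v2: "1 - v = (m2^2 - k^3*w*m1^2)/m2^2"
    unfolding v using nz by (simp add: diff_divide_distrib)
  have cs: "c \<noteq> 0" "s \<noteq> 0" using v1 nz by auto
  have J1: "n*k^3*(1-v)^2/v * (w*m1^2*m2^2) = n*(m2^2-k^3*w*m1^2)^2"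
    unfolding v2 unfolding v using nz by (simp add: power_divide)
  have J2: "K^2* v/(1+v)^2*(c* s)^2 = K^2*k^3*w*m1^2*m2^2"
    unfolding v1 unfolding v using nz cs by (simp add: power_divide power2_eq_square)
  have "b1*q^2 + n*d1 = q^3 + Cn*q + (n*k^3*(1-v)^2/v + K^2* v/(1+v)^2)*q"
    by (rule v_cubic_clear_denominators[OF q refl J1 J2 v_cubic_identity[OF k K b1 d1 Cn m(1-4) c s]]) (use nz cs in auto)
  (* The invariant turns the right side of the cubic in w into the one in x. *)
  then have cubic_v: "b1*q^2 + n*d1 = q^3 + Cn*q + g*(K - g)*q"
    unfolding g kernel_invariant[OF theta kern nz(3-5,2,6)] .
  (* The difference of two values of one cubic polynomial, divided by the difference of the arguments. *)
  have "(qu - q) * (b1*(qu+q) - (qu^2+qu*q+q^2) - Cn - g*(K-g))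
    = (b1*qu^2 + n*d1 - (qu^3 + Cn*qu + g*(K - g)*qu)) - (b1*q^2 + n*d1 - (q^3 + Cn*q + g*(K - g)*q))"
    by algebra
  then have quq: "qu = q" using neq1 cubic_u cubic_v by simp
  have r2: "r^2 = q*(q - 4*n*(1-n)^2)"
  proof -
    have "(r^2 - qu*(qu - 4*n*(1-n)^2)) * (x*(N1*N4))^2
      = (r*(x*(N1*N4)))^2 - (qu*(x*(N1*N4)))*(qu*(x*(N1*N4)) - 4*n*(1-n)^2*(x*(N1*N4)))" by algebra
    also have "\<dots> = n^2*(N3*N2)^2*(Ng^2 - ((N3*N2)^2 - 4*(1-n)^2*x*N1*N4))" unfolding r' qu' by algebra
    also have "\<dots> = 0" unfolding r_square_identity[OF k N] by simp
    finally show ?thesis using nz quq by simp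
  qed
  define D where "D = 1 - 2*t*u*(1+v)"
  have D2: "K^2*(v *D^2) = (K^2*w*m1^2*m2^2 - 4*n*(c* s)^2)*k^3/m2^4"
  proof -
    have "K^2*(v *D^2) = K^2* v - 4*(K^2*t^2)*(1+v)^2"
      unfolding D_def kernel_discriminant(1)[OF kern nz(3-5,2,6)] by (simp add: algebra_simps)
    also have "\<dots> = K^2*(k^3*w*m1^2/m2^2) - 4*(n*k^3)*(c* s/m2^2)^2"
      unfolding theta v1 unfolding v ..
    also have "\<dots> = (K^2*w*m1^2*m2^2 - 4*n*(c* s)^2)*k^3/m2^4"
      using nz by (simp add: field_simps power_divide)
    finally show ?thesis .
  qed
  have h': "h = (1+n^2)^2*(1-n)^2*(1-k^2*n^4*w^2)*m2^2/(k^3*m1^2*m3*m4*m5)"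
    using h nz by (simp add: eq_divide_eq)
  have wc: "1-k^2*n^4*w^2 = (1-k*n^2*w)*c" unfolding c by algebra
  (* The factor h is chosen so that the square of K v D h has no denominator left except that of q. *)
  have s2: "(K* v *D*h)^2 = q*(q - 4*n*(1-n)^2)"
  proof -
    define G where "G = k^6*m1^4*m3^2*m4^2*m5^2*m2^6"
    define P where "P = m1*m2*m3*m4"
    have D2': "K^2*(v *D^2)*m2^4 = (K^2*w*m1^2*m2^2 - 4*n*c^2* s^2)*k^3"
      unfolding D2 using nz by (simp add: power_mult_distrib)
    have "(K* v *D*h)^2*G = (K^2*(v *D^2)*m2^4)*(v *m2^2)*(h*(k^3*m1^2*m3*m4*m5))^2"
      unfolding G_def by algebra
    also have "\<dots> = (k^6*w*m1^2*(1+n^2)^4*(1-n)^4*c^2*m2^4)*((1-k*n^2*w)^2*(K^2*w*m1^2*m2^2-4*n*c^2* s^2))"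
      unfolding D2' w h wc by algebra
    also have "\<dots> = (k^6*w*m1^2*(1+n^2)^4*(1-n)^4*c^2*m2^4)*(((1+n^2)^4*w*c^2-4*n*(m1*m2*m3*m4))*m5^2)"
      unfolding v_discriminant_identity[OF k K m(1-4) c s m(5)] ..
    also have "\<dots> = (k^6*m1^2*m2^4*m5^2)*((d1*w*c^2)*(d1*w*c^2 - 4*n*(1-n)^2*P))"
      unfolding d1 P_def by algebra
    also have "\<dots> = (k^6*m1^2*m2^4*m5^2)*((q*P)*(q*P - 4*n*(1-n)^2*P))"
      using q by (simp only: P_def)
    also have "\<dots> = q*(q - 4*n*(1-n)^2)*G"
      unfolding G_def P_def by algebra
    finally show ?thesis using nz by (simp add: G_def)
  qed
  have rs: "r = K* v *D*h"
  proof -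
    have "(r - K* v *D*h)*(r + K* v *D*h) = r^2 - (K* v *D*h)^2" by algebra
    also have "\<dots> = 0" unfolding r2 s2 by simp
    finally have "(r - K* v *D*h)*(r + K* v *D*h) = 0" .
    then show ?thesis using neq2 by (simp add: D_def)
  qed
  (* The definition of e through x is the expression K + u (q - e1) r / (K t) - K (t u + t / u),
     multiplied by its denominator. *)
  have e': "e = K + (u/(K*t))*((q - e1)*r) - K*(t/u) - K*t*u"
  proof -
    define a where "a = u/(K*t)"
    define b where "b = K*(t/u)"
    have b: "b*(x*(N1*N2)) = n*(N3*N4)" unfolding b_def Kt_u using nz by simp
    have "a*b = 1" unfolding a_def b_def using nz by simp
    then have "a*b*(x*(N1*N2)) = x*(N1*N2)" by simp
    then have a: "a*(n*(N3*N4)) = x*(N1*N2)" unfolding b[symmetric] by (simp only: mult.assoc)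
    have "(e - K + b + K*t*u)*(x*(N1*N2*N4^3)) = e*x*(N1*N2*N4^3) - x*(K-K*t*u)*(N1*N2*N4^3) + (b*(x*(N1*N2)))*N4^3"
      by algebra
    also have "\<dots> = N2^3*Ng*(n*N2^2*N3^2 - e1*N1*N4*x)" unfolding e b by algebra
    finally have 1: "(e - K + b + K*t*u)*(x*(N1*N2*N4^3)) = N2^3*Ng*(n*N2^2*N3^2 - e1*N1*N4*x)" .
    have "a*((q-e1)*r)*(n*x^2*N1^2*N3*N4^3) = (a*(n*(N3*N4)))*(q*(x*(N1*N4)) - e1*(x*(N1*N4)))*(r*(x*(N1*N4)))"
      by algebra
    also have "\<dots> = x*n*N1*N2^2*N3*Ng*(n*N2^2*N3^2 - e1*x*N1*N4)"
      unfolding a r' qu'[unfolded quq] by algebra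
    finally have 2: "a*((q-e1)*r)*(n*x^2*N1^2*N3*N4^3) = x*n*N1*N2^2*N3*Ng*(n*N2^2*N3^2 - e1*x*N1*N4)" .
    have "(e - K + b + K*t*u - a*((q-e1)*r))*(n*x^2*N1^2*N2*N3*N4^3)
      = ((e - K + b + K*t*u)*(x*(N1*N2*N4^3)))*(n*x*N1*N3) - (a*((q-e1)*r)*(n*x^2*N1^2*N3*N4^3))*N2"
      by algebra
    also have "\<dots> = 0" unfolding 1 2 by algebra
    finally have "e - K + b + K*t*u - a*((q-e1)*r) = 0" using nz by simp
    then show ?thesis unfolding a_def b_def by (simp add: algebra_simps)
  qed
  have j': "j = 1/(1+v)" using j nz by (simp add: eq_divide_eq)
  have "t*e = K*t + (u/K)*((q-e1)*r) - K*t^2*(u+1/u)"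
    unfolding e' using nz by (simp add: field_simps power2_eq_square)
  also have "(u/K)*((q-e1)*r) = u* v *D*((q-e1)*h)"
    unfolding rs using nz by simp
  also have "K*t + u* v *D*((q-e1)*h) - K*t^2*(u+1/u) = K*(t - t^2*(u+1/u)) - u* v *D*((e1-q)*h)"
    by (simp add: algebra_simps)
  also have "\<dots> = K*(t^2*u* v *(1+u^2) + u* v *D/(1+v)^2) - u* v *D*((e1-q)*h)"
    unfolding kernel_discriminant(3)[OF kern nz(3-5,2,6)] D_def ..
  also have "\<dots> = K*t^2*(u* v *(1+u^2)) + (u* v/2 - t*(1+v))*d"
    unfolding kernel_discriminant(2)[OF kern nz(3-5,2,6)] D_def[symmetric] d j'
    by (simp add: algebra_simps power_divide)
  finally show ?thesis .
qed

section \<open>The parametrized solution as power series\<close>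

text \<open>
  Here \<open>fps_X\<close> stands for \<open>K t u / k^3\<close>, and \<open>x\<close> is the branch of the parameter that vanishes with it. The defining equation of
  \<open>E\<close> contains a division by \<open>x\<close>. It is possible because the two products in the last term agree at \<open>x = 0\<close>; the coefficient
  \<open>C\<close> of \<open>x\<close> in their difference determines the constant term \<open>K - e1 + n C\<close> of \<open>E\<close>. It is 0, as it must be for a series without the corner entry.
\<close>
lemma u_series:
  fixes n :: "'a::idom"
  assumes B: "subring_set B" and n: "n \<in> B"
  defines "N \<equiv> fps_const n"
  defines "k \<equiv> 1 - N + N^2" and "K \<equiv> (1-N)*(1+N)^3" and "e1 \<equiv> 1+2*N-2*N^2+2*N^3+N^4"
  obtains x E g where "x = fps_X * g" "g $ 0 = 1" "coeffs_in B E" "E $ 0 = 0"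
    "fps_X * ((1+k*x)*(1+N*k*x)) = x * ((1+N^2*x)*(1+N^3*x))"
    "E * x * ((1+N^2*x)*(1+N^3*x)*(1+N*k*x)^3) = x*(K - k^3*fps_X)*((1+N^2*x)*(1+N^3*x)*(1+N*k*x)^3)
       - e1*(1+N^3*x)^2*(1+(N^3-N^2+3*N-1)*x+N^3*k*x^2)*(1+N^2*x)*(1+N^3*x)*(1+N*k*x)*x
       + N*((1+N^3*x)^5*(1+k*x)^2*(1+(N^3-N^2+3*N-1)*x+N^3*k*x^2) - (1+k*x)*(1+N*k*x)^4)"
proof -
  interpret subring_set B by (rule B)
  have NB: "coeffs_in B N" unfolding N_def by (intro coeffs_in_intros n)
  have kB: "coeffs_in B k" "coeffs_in B K" "coeffs_in B e1"
    unfolding k_def K_def e1_def by (intro coeffs_in_intros NB one_in)+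
  define \<Psi> where "\<Psi> g = (k+N*k)*g + fps_X*N*k^2*g^2 - (N^2+N^3)*g^2 - fps_X*N^5*g^3" for g
  obtain g where g: "g = fps_const 1 + fps_X * \<Psi> g" "coeffs_in B g"
  proof -
    have "\<exists>g. g = fps_const 1 + fps_X * \<Psi> g \<and> coeffs_in B g"
      unfolding \<Psi>_def
      by (rule fps_fixpoint) (intro fps_agree_intros coeffs_in_intros NB kB one_in zero_in | assumption)+
    then show thesis using that by blast
  qed
  define x where "x = fps_X * g"
  have xB: "coeffs_in B x" unfolding x_def by (intro coeffs_in_intros g)
  have x0: "x $ 0 = 0" by (simp add: x_def)
  have g0: "g $ 0 = 1" by (subst g(1)) simp
  define N1 N2 N3 N4 Ng where "N1 = 1+N^2*x" and "N2 = 1+N^3*x" and "N3 = 1+k*x" and "N4 = 1+N*k*x"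
    and "Ng = 1+(N^3-N^2+3*N-1)*x+N^3*k*x^2"
  have NiB: "coeffs_in B N1" "coeffs_in B N2" "coeffs_in B N3" "coeffs_in B N4" "coeffs_in B Ng"
    unfolding N1_def N2_def N3_def N4_def Ng_def by (intro coeffs_in_intros NB kB xB one_in)+
  have Ni0: "N1 $ 0 = 1" "N2 $ 0 = 1" "N3 $ 0 = 1" "N4 $ 0 = 1" "Ng $ 0 = 1"
    by (simp_all add: N1_def N2_def N3_def N4_def Ng_def x0 fps_nth_power_0)
  have rel: "fps_X * (N3 * N4) = x * (N1 * N2)"
  proof -
    have "N3 * N4 - g * (N1 * N2) = (1 + fps_X * \<Psi> g) - g"
      unfolding N1_def N2_def N3_def N4_def x_def \<Psi>_def by algebra
    also have "\<dots> = 0" using g(1) by simp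
    finally show ?thesis unfolding x_def by simp
  qed
  obtain I1 I2 I4 where I: "N1 * I1 = 1" "N2 * I2 = 1" "N4 * I4 = 1"
      "coeffs_in B I1" "coeffs_in B I2" "coeffs_in B I4" "I1 $ 0 = 1" "I2 $ 0 = 1" "I4 $ 0 = 1"
    using fps_unit[OF NiB(1) Ni0(1)] fps_unit[OF NiB(2) Ni0(2)] fps_unit[OF NiB(4) Ni0(4)] by blast
  (* First-order expansion of a unit in powers of x, with remainder in the same coefficient ring. *)
  define lin where "lin f c \<longleftrightarrow> (\<exists>q. coeffs_in B q \<and> coeffs_in B c \<and> f = 1 + c*x + x^2*q)" for f c
  have lin_mult: "lin (f * f') (c + c')" if "lin f c" "lin f' c'" for f f' c c'
  proof -
    from that obtain q q' where q: "coeffs_in B q" "coeffs_in B q'" "coeffs_in B c" "coeffs_in B c'"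
        "f = 1 + c*x + x^2*q" "f' = 1 + c'*x + x^2*q'" unfolding lin_def by blast
    have "f * f' = 1 + (c + c')*x + x^2*(q + q' + c*c' + c*x*q' + c'*x*q + x^2*q*q')"
      unfolding q by algebra
    moreover have "coeffs_in B (q + q' + c*c' + c*x*q' + c'*x*q + x^2*q*q')"
      by (intro coeffs_in_intros q xB)
    ultimately show ?thesis unfolding lin_def using q by (blast intro: coeffs_in_intros)
  qed
  have lin_1: "lin (1 + c*x) c" if "coeffs_in B c" for c
    unfolding lin_def using that by (intro exI[of _ 0]) (auto intro: coeffs_in_intros)
  have lin_power: "lin (f ^ m) (of_nat m * c)" if "lin f c" "m > 0" for f c m
    using that(2)
  proof (induction m rule: nat_induct_non_zero)
    case (Suc m)
    then show ?case using lin_mult[OF that(1) Suc(2)] by (simp add: algebra_simps)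
  qed (use that in auto)
  have linN: "lin N2 (N^3)" "lin N3 k" "lin N4 (N*k)"
    unfolding N2_def N3_def N4_def by (intro lin_1 coeffs_in_intros NB kB)+
  have linNg: "lin Ng (N^3-N^2+3*N-1)"
    unfolding lin_def Ng_def by (intro exI[of _ "N^3*k"]) (auto intro!: coeffs_in_intros NB kB simp: algebra_simps)
  have "lin (N2^5*N3^2*Ng) (of_nat 5*N^3 + of_nat 2*k + (N^3-N^2+3*N-1))" "lin (N3*N4^4) (k + of_nat 4*(N*k))"
    by (intro lin_mult lin_power linN linNg; simp)+
  then obtain q1 q2 where q: "coeffs_in B q1" "coeffs_in B q2"
      "N2^5*N3^2*Ng = 1 + (5*N^3 + 2*k + (N^3-N^2+3*N-1))*x + x^2*q1"
      "N3*N4^4 = 1 + (k + 4*(N*k))*x + x^2*q2"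
    unfolding lin_def by auto
  define C where "C = 5*N^3 + 2*k + (N^3-N^2+3*N-1) - (k + 4*(N*k))"
  define E where "E = (K - k^3*fps_X) - e1*N2^2*Ng*I4^2 + N*(C + x*(q1 - q2))*(I1*I2*I4^3)"
  have "coeffs_in B E" unfolding E_def C_def by (intro coeffs_in_intros NB kB xB NiB I q)
  moreover have "E $ 0 = 0"
  proof -
    have "E $ 0 = (K - e1 + N*C) $ 0"
      by (simp add: E_def I Ni0 x0 fps_nth_power_0)
    also have "K - e1 + N*C = 0" unfolding K_def e1_def C_def k_def by algebra
    finally show ?thesis by simp
  qed
  moreover have "E * x * (N1*N2*N4^3) = x*(K - k^3*fps_X)*(N1*N2*N4^3)
       - e1*N2^2*Ng*N1*N2*N4*x + N*(N2^5*N3^2*Ng - N3*N4^4)"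
  proof -
    have "E * x * (N1*N2*N4^3) = x*(K - k^3*fps_X)*(N1*N2*N4^3)
        - e1*N2^2*Ng*N1*N2*N4*x*(N4*I4)^2 + N*(C*x + x^2*(q1-q2))*((N1*I1)*(N2*I2)*(N4*I4)^3)"
      unfolding E_def by algebra
    also have "C*x + x^2*(q1-q2) = N2^5*N3^2*Ng - N3*N4^4"
      unfolding q C_def by algebra
    finally show ?thesis unfolding I by simp
  qed
  ultimately show thesis
    using that[of x g E] rel g0 unfolding N1_def N2_def N3_def N4_def Ng_def x_def by blast
qed

text \<open>
  Here \<open>fps_X\<close> stands for \<open>v\<close>. All factors in the denominators have constant term 1 or \<open>k^3\<close>, and \<open>ki\<close> is the inverse of \<open>k\<close> in the
  coefficient ring, so \<open>w\<close>, \<open>q\<close> and \<open>h\<close> are power series over that ring.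
\<close>
lemma v_series:
  fixes n ki :: "'a::idom"
  assumes B: "subring_set B" and n: "n \<in> B" and ki: "ki \<in> B" "(1 - n + n^2) * ki = 1"
  defines "N \<equiv> fps_const n"
  defines "k \<equiv> 1 - N + N^2" and "K \<equiv> (1-N)*(1+N)^3" and "e1 \<equiv> 1+2*N-2*N^2+2*N^3+N^4" and "d1 \<equiv> (1+N^2)^4*(1-N)^2"
  obtains w g q h j D where "w = fps_X * g" "g $ 0 = ki^3" "h $ 0 = (1+n^2)^2*(1-n)^2*ki^3" "coeffs_in B D"
    "fps_X*(1+k^2*N*w)^2 = k^3*w*(1+N^3*w)^2"
    "q*((1+N^3*w)*(1+k^2*N*w)*(1+N^4*k*w)*(1+k*w)) = d1*w*(1+k*N^2*w)^2"
    "h*(k^3*(1+N^3*w)^2*(1+N^4*k*w)*(1+k*w)*(1-N*(k^2-3*N^2)*w+N^4*k^2*w^2)) = (1+N^2)^2*(1-N)^2*(1-k^2*N^4*w^2)*(1+k^2*N*w)^2"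
    "j*(1+fps_X) = 1" "D = 2*((e1-q)*h - K*j^2)"
proof -
  interpret subring_set B by (rule B)
  define KI where "KI = fps_const ki"
  have "k * KI = (fps_const 1 - fps_const n + fps_const n ^ 2) * fps_const ki"
    by (simp add: k_def KI_def N_def)
  also have "\<dots> = fps_const ((1 - n + n^2) * ki)"
    by (simp only: fps_const_power fps_const_mult fps_const_sub fps_const_add)
  finally have kKI: "k * KI = 1" by (simp add: ki(2))
  have NB: "coeffs_in B N" "coeffs_in B KI" unfolding N_def KI_def by (intro coeffs_in_intros n ki)+
  have kB: "coeffs_in B k" "coeffs_in B K" "coeffs_in B e1" "coeffs_in B d1"
    unfolding k_def K_def e1_def d1_def by (intro coeffs_in_intros NB one_in)+
  define \<Psi> where "\<Psi> g = KI^3*(2*k^2*N*g + fps_X*k^4*N^2*g^2 - k^3*g*(2*N^3*g+fps_X*N^6*g^2))" for g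
  obtain g where g: "g = fps_const (ki^3) + fps_X * \<Psi> g" "coeffs_in B g"
  proof -
    have "\<exists>g. g = fps_const (ki^3) + fps_X * \<Psi> g \<and> coeffs_in B g"
      unfolding \<Psi>_def
      by (rule fps_fixpoint) (intro fps_agree_intros coeffs_in_intros NB kB one_in zero_in power_in ki | assumption)+
    then show thesis using that by blast
  qed
  define w where "w = fps_X * g"
  have wB: "coeffs_in B w" unfolding w_def by (intro coeffs_in_intros g)
  have w0: "w $ 0 = 0" by (simp add: w_def)
  have g0: "g $ 0 = ki^3" by (subst g(1)) simp
  define m1 m2 m3 m4 m5 c where "m1 = 1+N^3*w" and "m2 = 1+k^2*N*w" and "m3 = 1+N^4*k*w" and "m4 = 1+k*w"
    and "m5 = 1-N*(k^2-3*N^2)*w+N^4*k^2*w^2" and "c = 1+k*N^2*w"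
  have mB: "coeffs_in B m1" "coeffs_in B m2" "coeffs_in B m3" "coeffs_in B m4" "coeffs_in B m5" "coeffs_in B c"
    unfolding m1_def m2_def m3_def m4_def m5_def c_def by (intro coeffs_in_intros NB kB wB one_in)+
  have m0: "m1 $ 0 = 1" "m2 $ 0 = 1" "m3 $ 0 = 1" "m4 $ 0 = 1" "m5 $ 0 = 1"
    by (simp_all add: m1_def m2_def m3_def m4_def m5_def w0 fps_nth_power_0)
  have rel: "fps_X*m2^2 = k^3*w*m1^2"
  proof -
    have "g - KI^3*(m2^2 - k^3*g*(m1^2-1)) = g - (KI^3 + fps_X * \<Psi> g)"
      unfolding m1_def m2_def \<Psi>_def w_def by algebra
    also have "\<dots> = 0" using g(1) by (simp add: KI_def fps_const_power)
    finally have "g = KI^3*(m2^2 - k^3*g*(m1^2-1))" by simp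
    then have "k^3*g = (k*KI)^3*(m2^2 - k^3*g*(m1^2-1))" by (metis (no_types) mult.assoc power_mult_distrib)
    then have "k^3*g = m2^2 - k^3*g*(m1^2-1)" unfolding kKI by simp
    then have "k^3*g*m1^2 = m2^2" by (simp add: algebra_simps)
    then show ?thesis unfolding w_def by (metis mult.assoc mult.commute)
  qed
  obtain I1 I2 I3 I4 I5 j where I: "m1 * I1 = 1" "m2 * I2 = 1" "m3 * I3 = 1" "m4 * I4 = 1" "m5 * I5 = 1" "(1+fps_X)*j = 1"
      "coeffs_in B I1" "coeffs_in B I2" "coeffs_in B I3" "coeffs_in B I4" "coeffs_in B I5" "coeffs_in B j"
      "I1 $ 0 = 1" "I3 $ 0 = 1" "I4 $ 0 = 1" "I5 $ 0 = 1"
    using fps_unit[OF mB(1) m0(1)] fps_unit[OF mB(2) m0(2)] fps_unit[OF mB(3) m0(3)] fps_unit[OF mB(4) m0(4)]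
      fps_unit[OF mB(5) m0(5)] fps_unit[of "1 + fps_X"] coeffs_in_intros by (auto simp: one_in)
  define q where "q = d1*w*c^2*(I1*I2*I3*I4)"
  define h where "h = (1+N^2)^2*(1-N)^2*(1-k^2*N^4*w^2)*m2^2*KI^3*(I1^2*I3*I4*I5)"
  define D where "D = 2*((e1-q)*h - K*j^2)"
  have "coeffs_in B D" unfolding D_def q_def h_def by (intro coeffs_in_intros NB kB wB mB I one_in)
  moreover have "h $ 0 = (1+n^2)^2*(1-n)^2*ki^3"
    by (simp add: h_def N_def KI_def w0 m0 I fps_nth_power_0)
  moreover have "q*(m1*m2*m3*m4) = d1*w*c^2"
  proof -
    have "q*(m1*m2*m3*m4) = d1*w*c^2*((m1*I1)*(m2*I2)*(m3*I3)*(m4*I4))" unfolding q_def by algebra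
    then show ?thesis unfolding I by simp
  qed
  moreover have "h*(k^3*m1^2*m3*m4*m5) = (1+N^2)^2*(1-N)^2*(1-k^2*N^4*w^2)*m2^2"
  proof -
    have "h*(k^3*m1^2*m3*m4*m5) = (1+N^2)^2*(1-N)^2*(1-k^2*N^4*w^2)*m2^2*((k*KI)^3*((m1*I1)^2*(m3*I3)*(m4*I4)*(m5*I5)))"
      unfolding h_def by algebra
    then show ?thesis unfolding I kKI by simp
  qed
  moreover have "j*(1+fps_X) = 1" using I by (simp add: mult.commute)
  ultimately show thesis
    using that[of w g h D q j] rel g0 w_def D_def unfolding m1_def m2_def m3_def m4_def m5_def c_def by blast
qed

section \<open>Leading terms at the kernel point\<close>

text \<open>
  The inequalities needed at the kernel point are decided by the leading terms in \<open>z\<close>, which these predicates record.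
\<close>
definition unit1 :: "rat fls fls \<Rightarrow> bool" where
  "unit1 x \<longleftrightarrow> (\<exists>F. x = fps_to_fls F \<and> F $ 0 = 1)"
definition inf1 :: "rat fls \<Rightarrow> rat fls fls \<Rightarrow> bool" where
  "inf1 c x \<longleftrightarrow> (\<exists>F. x = fps_to_fls F \<and> F $ 0 = 0 \<and> F $ 1 = c)"
definition is_power_series :: "rat fls fls \<Rightarrow> bool" where
  "is_power_series x \<longleftrightarrow> (\<exists>F. x = fps_to_fls F)"

lemma unit1_nonzero: "unit1 x \<Longrightarrow> x \<noteq> 0"
  by (auto simp: unit1_def)
lemma inf1_nonzero: "inf1 c x \<Longrightarrow> c \<noteq> 0 \<Longrightarrow> x \<noteq> 0"
  by (auto simp: inf1_def)
lemma unit1_mult: "unit1 x \<Longrightarrow> unit1 y \<Longrightarrow> unit1 (x * y)"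
  unfolding unit1_def by (metis fls_times_fps_to_fls fps_mult_nth_0 mult_1)
lemma unit1_power: "unit1 x \<Longrightarrow> unit1 (x ^ n)"
  by (induction n) (auto intro: unit1_mult, auto simp: unit1_def intro: exI[of _ 1])
lemma unit1_inverse: assumes "unit1 x" shows "unit1 (inverse x)"
proof -
  from assms obtain F where F: "x = fps_to_fls F" "F $ 0 = 1" by (auto simp: unit1_def)
  have "inverse F * F = 1" using F by (intro inverse_mult_eq_1) auto
  then have "fps_to_fls (inverse F) * x = 1" unfolding F(1) by (metis fls_times_fps_to_fls fps_one_to_fls)
  then have "inverse x = fps_to_fls (inverse F)" by (metis inverse_unique mult.commute)
  then show ?thesis unfolding unit1_def using F(2) by (intro exI[of _ "inverse F"]) simp
qed
lemma inf1_times_unit: "inf1 c x \<Longrightarrow> unit1 y \<Longrightarrow> inf1 c (x * y)"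
  unfolding inf1_def unit1_def
  by (elim exE conjE, rule_tac x = "F * Fa" in exI) (auto simp: fls_times_fps_to_fls fps_mult_nth_1)
lemma inf1_divide_unit: "inf1 c x \<Longrightarrow> unit1 y \<Longrightarrow> inf1 c (x / y)"
  unfolding divide_inverse by (intro inf1_times_unit unit1_inverse)
lemma inf1_times_power_series: "inf1 0 x \<Longrightarrow> is_power_series y \<Longrightarrow> inf1 0 (x * y)"
  unfolding inf1_def is_power_series_def
  by (elim exE conjE, rule_tac x = "F * Fa" in exI) (auto simp: fls_times_fps_to_fls fps_mult_nth_1)
lemma inf1_times_inf1: "inf1 c x \<Longrightarrow> inf1 d y \<Longrightarrow> inf1 0 (x * y)"
  unfolding inf1_def
  by (elim exE conjE, rule_tac x = "F * Fa" in exI) (auto simp: fls_times_fps_to_fls fps_mult_nth_1)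
lemma inf1_add: "inf1 c x \<Longrightarrow> inf1 d y \<Longrightarrow> inf1 (c + d) (x + y)"
  unfolding inf1_def by (elim exE conjE, rule_tac x = "F + Fa" in exI) auto
lemma inf1_diff: "inf1 c x \<Longrightarrow> inf1 d y \<Longrightarrow> inf1 (c - d) (x - y)"
  unfolding inf1_def by (elim exE conjE, rule_tac x = "F - Fa" in exI) auto
lemma unit1_minus_inf1: "unit1 x \<Longrightarrow> inf1 c y \<Longrightarrow> unit1 (x - y)"
  unfolding inf1_def unit1_def by (elim exE conjE, rule_tac x = "F - Fa" in exI) auto

lemma unit1I: "F $ 0 = 1 \<Longrightarrow> unit1 (fps_to_fls F)" by (auto simp: unit1_def)
lemma inf1I: "F $ 0 = 0 \<Longrightarrow> F $ 1 = c \<Longrightarrow> inf1 c (fps_to_fls F)" by (auto simp: inf1_def)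
lemma is_power_seriesI: "is_power_series (fps_to_fls F)" by (auto simp: is_power_series_def)

section \<open>The parametrized solution satisfies the kernel equation\<close>

lemma fps_to_fls_hom:
  "fps_to_fls (F * G) = fps_to_fls F * fps_to_fls (G :: 'a::comm_ring_1 fps)"
  by (simp add: fls_times_fps_to_fls)

lemmas to_fls_simps = fps_to_fls_plus fps_to_fls_minus fps_to_fls_hom fps_to_fls_power
  fps_to_fls_numeral fps_one_to_fls

text \<open>
  Substitution of \<open>K t u / k^3\<close> and \<open>v\<close> into the two parametrized series turns their defining equations
  into the hypotheses of \<open>explicit_solution_at_kernel_point\<close>. The remaining inequalities are read off at order \<open>z\<close>,
  where \<open>q\<close>, \<open>qu\<close>, \<open>r\<close>, \<open>v\<close> and \<open>g\<close> all have the coefficient \<open>1/\<lambda>\<close>, while \<open>n\<close> is of higher order.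
\<close>
lemma explicit_solution:
  fixes n ki :: "rat fps"
  assumes B: "subring_set B" and n: "n \<in> B" and ki: "ki \<in> B" and kki: "(1 - n + n^2) * ki = 1"
    and n0: "n $ 0 = 0" and theta: "((1-n)*(1+n)^3)^2 * fps_X^2 = n * (1 - n + n^2)^3"
  defines "K \<equiv> (1-n)*(1+n)^3"
  obtains E D where "coeffs_in B E" "coeffs_in B D" "E $ 0 = 0"
    "2 * (fps_X^2 * fps_eval.ev emb (emb (K*ki^3) * fps_X^2 * u_pt) E)
     = 2 * (emb K * fps_X^4 * (u_pt* v_pt*(1+u_pt^2))) + (u_pt* v_pt - 2*(fps_X^2*(1+v_pt))) * evv.ev D"
proof -
  define y where "y = emb (K*ki^3) * fps_X^2 * u_pt"
  interpret evy: fps_eval emb y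
    by standard (auto simp: emb_add emb_mult emb_1 y_def u_pt)
  define N where "N = emb n"
  have emb_minus: "emb (f - g) = emb f - emb g" for f g
    using emb_add[of "f - g" g] by simp
  define k where "k = 1 - N + N^2"
  define KK where "KK = (1-N)*(1+N)^3"
  have embK: "emb K = KK" unfolding K_def KK_def N_def by (simp add: emb_mult emb_add emb_minus emb_power emb_1)
  have kemb: "k * emb ki = 1" using arg_cong[OF kki, of emb] unfolding k_def N_def
    by (simp add: emb_mult emb_add emb_minus emb_power emb_1)
  define tR :: "rat fls fps" where "tR = fps_X^2"
  have thR: "KK^2 * tR^2 = N * k^3" using arg_cong[OF theta, of emb] unfolding KK_def k_def N_def
    by (simp add: emb_mult emb_add emb_minus emb_power emb_1 emb_X tR_def)
  have N0: "N $ 0 = 0" "N $ 1 = 0" by (simp_all add: N_def emb_nth n0)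
  have k0: "k $ 0 = 1" by (simp add: k_def N0 fps_nth_power_0)
  have KK0: "KK $ 0 = 1" by (simp add: KK_def N0 fps_nth_power_0)
  have ki0: "emb ki $ 0 = 1" using arg_cong[OF kemb, of "\<lambda>f. f $ 0"] by (simp add: k0)
  have yk: "k^3 * y = KK * tR * u_pt"
  proof -
    have "k^3 * y = (k * emb ki)^3 * KK * tR * u_pt"
      unfolding y_def tR_def emb_mult emb_power embK by (simp only: power_mult_distrib mult_ac)
    then show ?thesis by (simp add: kemb)
  qed
  obtain x' E g' where x': "x' = fps_X * g'" "g' $ 0 = 1" and E: "coeffs_in B E" "E $ 0 = 0"
    and xrel: "fps_X * ((1+(1 - fps_const n + fps_const n^2)*x')*(1+fps_const n*(1 - fps_const n + fps_const n^2)*x'))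
      = x' * ((1+fps_const n^2*x')*(1+fps_const n^3*x'))"
    and Erel: "E * x' * ((1+fps_const n^2*x')*(1+fps_const n^3*x')*(1+fps_const n*(1 - fps_const n + fps_const n^2)*x')^3)
       = x'*((1-fps_const n)*(1+fps_const n)^3 - (1 - fps_const n + fps_const n^2)^3*fps_X)*((1+fps_const n^2*x')*(1+fps_const n^3*x')*(1+fps_const n*(1 - fps_const n + fps_const n^2)*x')^3)
       - (1+2*fps_const n-2*fps_const n^2+2*fps_const n^3+fps_const n^4)*(1+fps_const n^3*x')^2*(1+(fps_const n^3-fps_const n^2+3*fps_const n-1)*x'+fps_const n^3*(1 - fps_const n + fps_const n^2)*x'^2)*(1+fps_const n^2*x')*(1+fps_const n^3*x')*(1+fps_const n*(1 - fps_const n + fps_const n^2)*x')*x'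
       + fps_const n*((1+fps_const n^3*x')^5*(1+(1 - fps_const n + fps_const n^2)*x')^2*(1+(fps_const n^3-fps_const n^2+3*fps_const n-1)*x'+fps_const n^3*(1 - fps_const n + fps_const n^2)*x'^2) - (1+(1 - fps_const n + fps_const n^2)*x')*(1+fps_const n*(1 - fps_const n + fps_const n^2)*x')^4)"
    by (rule u_series[OF B n])
  obtain w' g q' h' j' D where w': "w' = fps_X * g" "g $ 0 = ki^3" and h'0: "h' $ 0 = (1+n^2)^2*(1-n)^2*ki^3" and D: "coeffs_in B D"
    and wrel: "fps_X*(1+(1 - fps_const n + fps_const n^2)^2*fps_const n*w')^2 = (1 - fps_const n + fps_const n^2)^3*w'*(1+fps_const n^3*w')^2"
    and qrel: "q'*((1+fps_const n^3*w')*(1+(1 - fps_const n + fps_const n^2)^2*fps_const n*w')*(1+fps_const n^4*(1 - fps_const n + fps_const n^2)*w')*(1+(1 - fps_const n + fps_const n^2)*w')) = (1+fps_const n^2)^4*(1-fps_const n)^2*w'*(1+(1 - fps_const n + fps_const n^2)*fps_const n^2*w')^2"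
    and hrel: "h'*((1 - fps_const n + fps_const n^2)^3*(1+fps_const n^3*w')^2*(1+fps_const n^4*(1 - fps_const n + fps_const n^2)*w')*(1+(1 - fps_const n + fps_const n^2)*w')*(1-fps_const n*((1 - fps_const n + fps_const n^2)^2-3*fps_const n^2)*w'+fps_const n^4*(1 - fps_const n + fps_const n^2)^2*w'^2))
      = (1+fps_const n^2)^2*(1-fps_const n)^2*(1-(1 - fps_const n + fps_const n^2)^2*fps_const n^4*w'^2)*(1+(1 - fps_const n + fps_const n^2)^2*fps_const n*w')^2"
    and jrel: "j'*(1+fps_X) = 1" and Drel: "D = 2*(((1+2*fps_const n-2*fps_const n^2+2*fps_const n^3+fps_const n^4)-q')*h' - (1-fps_const n)*(1+fps_const n)^3*j'^2)"
    by (rule v_series[OF B n ki kki])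
  define x e w q h j d where "x = evy.ev x'" and "e = evy.ev E" and "w = evv.ev w'" and "q = evv.ev q'"
    and "h = evv.ev h'" and "j = evv.ev j'" and "d = evv.ev D"
  note xR = arg_cong[OF xrel, of evy.ev, unfolded evy.ev_simps, folded N_def x_def, folded k_def]
  note ER = arg_cong[OF Erel, of evy.ev, unfolded evy.ev_simps, folded N_def x_def e_def, folded k_def KK_def, unfolded yk]
  note wR = arg_cong[OF wrel, of evv.ev, unfolded evv.ev_simps, folded N_def w_def, folded k_def]
  note qR = arg_cong[OF qrel, of evv.ev, unfolded evv.ev_simps, folded N_def w_def q_def, folded k_def]
  note hR = arg_cong[OF hrel, of evv.ev, unfolded evv.ev_simps, folded N_def w_def h_def, folded k_def]
  note jR = arg_cong[OF jrel, of evv.ev, unfolded evv.ev_simps, folded j_def]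
  note dR = arg_cong[OF Drel, of evv.ev, unfolded evv.ev_simps, folded N_def q_def h_def j_def d_def, folded KK_def]
  have xR': "KK * tR * u_pt * ((1+k*x)*(1+N*k*x)) = k^3*x*((1+N^2*x)*(1+N^3*x))"
    unfolding yk[symmetric] using xR by (simp only: mult.assoc)

  have u1: "inf1 fls_X (fps_to_fls u_pt)" by (rule inf1I) (rule u_pt)+
  have v1: "inf1 fls_X_inv (fps_to_fls v_pt)" by (rule inf1I) (rule v_pt)+
  have X_inv: "(fls_X_inv :: rat fls) \<noteq> 0" by simp
  have x_eq: "x = y * evy.ev g'" unfolding x_def x' by (simp add: evy.ev_simps)
  have y0: "y $ 0 = 0" by (simp add: y_def u_pt)
  have x0: "x $ 0 = 0" by (simp add: x_eq y0)
  have w0: "w $ 0 = 0" unfolding w_def w' by (simp add: evv.ev_simps v_pt)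
  have w_eq: "w = v_pt * evv.ev g" unfolding w_def w' by (simp add: evv.ev_simps)
  have g0: "evv.ev g $ 0 = 1" by (simp add: evv.ev_nth_0 w' emb_power fps_nth_power_0 ki0)
  have w1: "inf1 fls_X_inv (fps_to_fls w)" unfolding w_eq fps_to_fls_hom
    by (intro inf1_times_unit v1 unit1I g0)
  have h0: "h $ 0 = 1" unfolding h_def evv.ev_nth_0 h'0
    by (simp add: emb_mult emb_power emb_add emb_minus emb_1 N_def[symmetric] N0 fps_nth_power_0 ki0)
  let ?f = "fps_to_fls :: rat fls fps \<Rightarrow> rat fls fls"
  let ?N = "?f N" and ?k = "?f k" and ?x = "?f x" and ?w = "?f w" and ?K = "?f KK" and ?t = "?f tR" and ?u = "?f u_pt" and ?v = "?f v_pt"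
  have units:
    "unit1 ?K" "unit1 ?k" "unit1 (1 + ?v)" "unit1 (?u^2*?v+1)"
    "unit1 (1+?N^2*?x)" "unit1 (1+?N^3*?x)" "unit1 (1+?k*?x)" "unit1 (1+?N*?k*?x)" "unit1 (1+(?N^3-?N^2+3*?N-1)*?x+?N^3*?k*?x^2)"
    "unit1 (1+?N^3*?w)" "unit1 (1+?k^2*?N*?w)" "unit1 (1+?N^4*?k*?w)" "unit1 (1+?k*?w)" "unit1 (1-?N*(?k^2-3*?N^2)*?w+?N^4*?k^2*?w^2)"
    "unit1 (1+?k*?N^2*?w)" "unit1 (1+4*?N-6*?N^2+4*?N^3+?N^4)" "unit1 ((1+?N^2)^4*(1-?N)^2)" "unit1 (?f h)"
    "unit1 (1 - 2*?t*?u*(1+?v))"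
    unfolding to_fls_simps[symmetric]
    by (rule unit1I, simp add: KK0 k0 N0 x0 w0 h0 u_pt v_pt tR_def fps_nth_power_0)+
  have unz: "?u \<noteq> 0" "?v \<noteq> 0" "?t \<noteq> 0"
    using inf1_nonzero[OF u1] inf1_nonzero[OF v1] by (auto simp: tR_def)
  have Nnz: "?N \<noteq> 0"
  proof
    assume "?N = 0"
    then have "KK^2 * tR^2 = 0" using thR by simp
    moreover have "KK \<noteq> 0" using KK0 by auto
    ultimately show False by (simp add: tR_def)
  qed
  have xnz: "?x \<noteq> 0"
  proof -
    have "evy.ev g' $ 0 = 1" by (simp add: evy.ev_nth_0 x' emb_1)
    then have "evy.ev g' \<noteq> 0" by auto
    moreover have "y \<noteq> 0"
    proof
      assume "y = 0"
      then have "KK * tR * u_pt = 0" using yk by simp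
      moreover have "KK \<noteq> 0" "u_pt \<noteq> 0" using KK0 unz by auto
      ultimately show False by (simp add: tR_def)
    qed
    ultimately show ?thesis by (simp add: x_eq)
  qed
  have wnz: "?w \<noteq> 0" using inf1_nonzero[OF w1 X_inv] .
  have kern: "?t * ((1 + ?v) * (?u^2 * ?v + 1)) = ?u * ?v"
    unfolding to_fls_simps[symmetric] using v_pt(3) by (simp add: tR_def)
  have thK: "?K^2 * ?t^2 = ?N * ?k^3" unfolding to_fls_simps[symmetric] using thR by simp
  have t_u: "?t / ?u = ?f (fps_const fls_X_inv * fps_X)"
  proof -
    have "fps_const fls_X_inv * fps_X * u_pt = fps_const (fls_X_inv * fls_X) * tR"
      by (simp add: tR_def u_pt_def power2_eq_square fps_const_mult[symmetric] mult_ac del: fps_const_mult)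
    also have "fls_X_inv * fls_X = (1 :: rat fls)"
      using left_inverse[of "fls_X :: rat fls"] by (simp add: fls_inverse_X)
    finally have "?f (fps_const fls_X_inv * fps_X) * ?u = ?t" unfolding fps_to_fls_hom[symmetric] by simp
    then show ?thesis using unz by (simp add: divide_eq_eq)
  qed
  have tu1: "inf1 fls_X_inv (?t / ?u)" unfolding t_u by (rule inf1I) simp_all
  have q1: "inf1 fls_X_inv (?f q)"
  proof -
    have "?f q * ((1+?N^3*?w)*(1+?k^2*?N*?w)*(1+?N^4*?k*?w)*(1+?k*?w)) = (1+?N^2)^4*(1-?N)^2*?w*(1+?k*?N^2*?w)^2"
      using arg_cong[OF qR, of ?f] unfolding to_fls_simps .
    then have "?f q = ?w*((1+?N^2)^4*(1-?N)^2)*(1+?k*?N^2*?w)^2 / ((1+?N^3*?w)*(1+?k^2*?N*?w)*(1+?N^4*?k*?w)*(1+?k*?w))"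
      using unit1_nonzero[OF units(10)] unit1_nonzero[OF units(11)] unit1_nonzero[OF units(12)] unit1_nonzero[OF units(13)]
      by (simp only: eq_divide_eq mult_ac mult_eq_0_iff simp_thms if_False if_True)
    then show ?thesis
      by (simp only:) (intro inf1_divide_unit inf1_times_unit unit1_mult unit1_power units w1)
  qed
  define qu where "qu = ?K*(?t/?u)*(1+?k*?x)*(1+?N^3*?x)^3/(1+?N*?k*?x)^2"
  define r where "r = ?K*(?t/?u)*(1+?N^3*?x)^2*(1+(?N^3-?N^2+3*?N-1)*?x+?N^3*?k*?x^2)/(1+?N*?k*?x)^2"
  have qu1: "inf1 fls_X_inv qu" unfolding qu_def mult.commute[of ?K]
    by (intro inf1_divide_unit inf1_times_unit unit1_power units tu1)
  have r1: "inf1 fls_X_inv r" unfolding r_def mult.commute[of ?K]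
    by (intro inf1_divide_unit inf1_times_unit unit1_power units tu1)
  have N1: "inf1 0 ?N" by (rule inf1I) (rule N0)+
  have Cn1: "inf1 0 (3*?N-8*?N^2+13*?N^3-12*?N^4+13*?N^5-8*?N^6+3*?N^7)"
  proof -
    have "3*?N-8*?N^2+13*?N^3-12*?N^4+13*?N^5-8*?N^6+3*?N^7 = ?N*?f(3-8*N+13*N^2-12*N^3+13*N^4-8*N^5+3*N^6)"
      unfolding to_fls_simps by algebra
    then show ?thesis by (simp only:) (intro inf1_times_power_series N1 is_power_seriesI)
  qed
  have g1: "inf1 fls_X_inv (?K*?t*(?u+1/?u))"
  proof -
    have tu: "inf1 0 (?t*?u)" unfolding fps_to_fls_hom[symmetric]
      by (rule inf1I) (simp_all add: tR_def fps_mult_nth_1 u_pt fps_X_power_nth)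
    have "?K*?t*(?u+1/?u) = (?t*?u + ?t/?u)*?K" by (simp add: algebra_simps)
    then show ?thesis using inf1_times_unit[OF inf1_add[OF tu tu1] units(1)] by (simp only: add_0_left)
  qed
  (* At order z the sum qu + q contributes 2 / lambda and g (K - g) contributes 1 / lambda; the rest is of higher order. *)
  have neq1: "(1+4*?N-6*?N^2+4*?N^3+?N^4)*(qu+?f q) - (qu^2+qu*?f q+(?f q)^2)
      - (3*?N-8*?N^2+13*?N^3-12*?N^4+13*?N^5-8*?N^6+3*?N^7) - ?K*?t*(?u+1/?u)*(?K-?K*?t*(?u+1/?u)) \<noteq> 0"
  proof (rule inf1_nonzero)
    show "inf1 ((fls_X_inv + fls_X_inv) - (0 + 0 + 0) - 0 - fls_X_inv) ((1+4*?N-6*?N^2+4*?N^3+?N^4)*(qu+?f q) - (qu^2+qu*?f q+(?f q)^2)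
      - (3*?N-8*?N^2+13*?N^3-12*?N^4+13*?N^5-8*?N^6+3*?N^7) - ?K*?t*(?u+1/?u)*(?K-?K*?t*(?u+1/?u)))"
      unfolding power2_eq_square[of qu] power2_eq_square[of "?f q"] mult.commute[of "1+4*?N-6*?N^2+4*?N^3+?N^4"]
      by (rule inf1_diff inf1_add inf1_times_unit qu1 q1 units(16) Cn1 g1 unit1_minus_inf1[OF units(1) g1]
            inf1_times_inf1[OF qu1 qu1] inf1_times_inf1[OF qu1 q1] inf1_times_inf1[OF q1 q1])+
    show "(fls_X_inv + fls_X_inv) - (0 + 0 + 0) - 0 - fls_X_inv \<noteq> (0 :: rat fls)" by simp
  qed
  (* Both summands start with z / lambda, so they cannot be opposite. *)
  have neq2: "r + ?K*?v *(1 - 2*?t*?u*(1+?v))*?f h \<noteq> 0"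
  proof (rule inf1_nonzero)
    show "inf1 (fls_X_inv + fls_X_inv) (r + ?K*?v *(1 - 2*?t*?u*(1+?v))*?f h)"
      unfolding mult.commute[of ?K] by (intro inf1_add r1 inf1_times_unit v1 units)
    show "fls_X_inv + fls_X_inv \<noteq> (0 :: rat fls)"
      using X_inv by (simp flip: mult_2)
  qed
  have kf: "?k = 1 - ?N + ?N^2" and Kf: "?K = (1 - ?N)*(1 + ?N)^3"
    unfolding k_def KK_def to_fls_simps by (rule refl)+
  have "?t*?f e = ?K*?t^2*(?u*?v *(1+?u^2)) + (?u*?v/2 - ?t*(1+?v))*?f d"
    by (rule explicit_solution_at_kernel_point[OF kf Kf refl refl refl refl refl refl refl refl refl refl refl refl refl refl refl
         thK kern
         arg_cong[OF xR', of ?f, unfolded to_fls_simps]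
         arg_cong[OF wR, of ?f, unfolded to_fls_simps]
         arg_cong[OF qR, of ?f, unfolded to_fls_simps]
         arg_cong[OF hR, of ?f, unfolded to_fls_simps]
         arg_cong[OF jR, of ?f, unfolded to_fls_simps]
         arg_cong[OF dR, of ?f, unfolded to_fls_simps]
         arg_cong[OF ER, of ?f, unfolded to_fls_simps]
         unit1_nonzero[OF units(1)] unz(3,1,2) unit1_nonzero[OF units(3)] unit1_nonzero[OF units(4)]
         Nnz unit1_nonzero[OF units(2)] xnz wnz
         unit1_nonzero[OF units(5)] unit1_nonzero[OF units(6)] unit1_nonzero[OF units(7)] unit1_nonzero[OF units(8)]
         unit1_nonzero[OF units(10)] unit1_nonzero[OF units(11)] unit1_nonzero[OF units(12)] unit1_nonzero[OF units(13)] unit1_nonzero[OF units(14)]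
         qu_def r_def refl neq1 neq2])
  then have "2*(?t*?f e) = 2*(?K*?t^2*(?u*?v *(1+?u^2))) + (?u*?v - 2*(?t*(1+?v)))*?f d"
    by (simp add: field_simps)
  then have "?f (2*(tR*e)) = ?f (2*(KK*tR^2*(u_pt* v_pt*(1+u_pt^2))) + (u_pt* v_pt - 2*(tR*(1+v_pt)))*d)"
    unfolding to_fls_simps .
  then have "2*(fps_X^2*e) = 2*(KK*fps_X^4*(u_pt* v_pt*(1+u_pt^2))) + (u_pt* v_pt - 2*(fps_X^2*(1+v_pt)))*d"
    unfolding fps_to_fls_eq_iff by (simp add: tR_def power_mult[symmetric])
  then show thesis using that[OF E(1) D E(2)] unfolding e_def d_def y_def embK by simp
qed

section \<open>The half-plane series are explicit\<close>

text \<open>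
  The bivariate series disappears at the kernel point, because it occurs only in products with the kernel.
\<close>
lemma half_kernel_equation:
  "6 * (fps_X^2 * evu.ev halfE) = 2 * (u_pt* v_pt*(1+u_pt^2))
     + 3 * (u_pt* v_pt - 2*(fps_X^2*(1+v_pt))) * evv.ev (Abs_fps (\<lambda>b. half 0 b))"
proof -
  interpret ev2: fps_eval evu.ev v_pt by (rule evu.eval_ev) (rule v_pt)
  have D: "ev2.ev halfD = evv.ev (Abs_fps (\<lambda>b. half 0 b))"
    unfolding ev2.ev_def evv.ev_def halfD_def fps_nth_Abs_fps evu.ev_const ..
  note eq = arg_cong[OF half_functional_equation, of ev2.ev, unfolded ev2.ev_simps evu.ev_simps emb_X D]
  have "u_pt * v_pt * ev2.ev halfH - fps_X\<^sup>2 * ((1 + v_pt) * (u_pt\<^sup>2 * v_pt + 1)) * ev2.ev halfH = 0"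
    unfolding v_pt(3) by simp
  with eq have "0 = 2 * (u_pt * v_pt + u_pt ^ 3 * v_pt) + 3 * (u_pt * v_pt - 2 * (fps_X\<^sup>2 * (1 + v_pt))) * evv.ev (Abs_fps (\<lambda>b. half 0 b)) - 6 * (fps_X\<^sup>2 * evu.ev halfE)"
    by simp
  then show ?thesis by (simp add: algebra_simps power2_eq_square power3_eq_cube)
qed

lemma ev_rescale: "fps_eval.ev emb (emb s * u_pt) E = evu.ev (Abs_fps (\<lambda>a. E $ a * s ^ a))"
proof -
  interpret evs: fps_eval emb "emb s * u_pt"
    by standard (auto simp: emb_add emb_mult emb_1 u_pt)
  show ?thesis
    unfolding evs.ev_def evu.ev_def fps_nth_Abs_fps
    by (simp add: emb_mult emb_power power_mult_distrib mult_ac)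
qed

text \<open>
  The actual boundary series and the explicit pair solve the same linear equation, and both
  bottom rows have no constant term, so \<open>kernel_uniqueness\<close> applies to the differences. The factor
  \<open>3 t^2 K\<close> normalizes the explicit solution, and the powers of \<open>K t / k^3\<close> undo the rescaling of \<open>u\<close>.
\<close>
lemma half_explicit:
  fixes n ki :: "rat fps"
  assumes B: "subring_set B" and n: "n \<in> B" and ki: "ki \<in> B" and kki: "(1 - n + n^2) * ki = 1"
    and n0: "n $ 0 = 0" and theta: "((1-n)*(1+n)^3)^2 * fps_X^2 = n * (1 - n + n^2)^3"
  defines "K \<equiv> (1-n)*(1+n)^3"
  obtains E D where "coeffs_in B E" "coeffs_in B D"
    "\<And>a. a \<ge> 1 \<Longrightarrow> 3*fps_X^2*K * half a 0 = E $ a * (K*ki^3*fps_X)^a"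
    "\<And>b. 3*fps_X^2*K * half 0 b = D $ b"
proof -
  obtain E D where E: "coeffs_in B E" and D: "coeffs_in B D" and E0: "E $ 0 = 0"
    and explicit: "2 * (fps_X^2 * fps_eval.ev emb (emb (K*ki^3) * fps_X^2 * u_pt) E)
     = 2 * (emb K * fps_X^4 * (u_pt* v_pt*(1+u_pt^2))) + (u_pt* v_pt - 2*(fps_X^2*(1+v_pt))) * evv.ev D"
    by (rule explicit_solution[OF B n ki kki n0 theta, folded K_def])
  define s where "s = K*ki^3*fps_X"
  define E' where "E' = Abs_fps (\<lambda>a. E $ a * s ^ a)"
  have evE: "fps_eval.ev emb (emb (K*ki^3) * fps_X^2 * u_pt) E = evu.ev E'"
    unfolding E'_def ev_rescale[symmetric] s_def by (simp add: emb_mult emb_X mult_ac)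
  define e where "e = fps_const (3*fps_X^2*K) * halfE - E'"
  define d where "d = fps_const (3*fps_X^2*K) * Abs_fps (\<lambda>b. half 0 b) - D"
  (* This is the coefficient of D divided by 2 t; by the kernel equation u v may be replaced by t (1 + v) (u^2 v + 1). *)
  define c where "c = fps_const (fls_const (1/2)) * ((1+v_pt)*(u_pt^2* v_pt - 1))"
  have c0: "c $ 0 = fls_const (-1/2)" by (simp add: c_def u_pt v_pt fps_nth_power_0)
  have c2: "u_pt* v_pt - 2*(fps_X^2*(1+v_pt)) = 2*fps_X^2*c"
  proof -
    have "2 * fps_const (fls_const (1/2)) = (1 :: rat fls fps)"
      unfolding fps_numeral_fps_const fls_const_numeral[symmetric] by (simp del: fls_const_numeral)
    moreover have "2*fps_X^2*c = (2 * fps_const (fls_const (1/2))) * (fps_X^2*((1+v_pt)*(u_pt^2* v_pt - 1)))"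
      unfolding c_def by (simp only: mult_ac)
    ultimately have "2*fps_X^2*c = fps_X^2*((1+v_pt)*(u_pt^2* v_pt - 1))" by simp
    also have "\<dots> = fps_X^2*((1+v_pt)*(u_pt^2* v_pt + 1)) - 2*(fps_X^2*(1+v_pt))" by algebra
    finally show ?thesis unfolding v_pt(3) by simp
  qed
  have emb3: "emb 3 = 3"
  proof -
    have "emb (1 + 1 + 1) = 1 + 1 + 1" unfolding emb_add emb_1 ..
    then show ?thesis by simp
  qed
  have "2*fps_X^2 * evu.ev e = 2*fps_X^2*(c * evv.ev d)"
  proof -
    have "2*fps_X^2 * evu.ev e = emb K * fps_X^4 * (6*(fps_X^2*evu.ev halfE)) - 2*(fps_X^2*evu.ev E')"
      unfolding e_def evu.ev_simps emb_mult emb_power emb_X emb3 by (simp add: algebra_simps flip: power_mult power_add)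
    also have "\<dots> = (2*fps_X^2*c) * (3*emb K*fps_X^4*evv.ev (Abs_fps (\<lambda>b. half 0 b)) - evv.ev D)"
      unfolding half_kernel_equation explicit[unfolded evE] c2 by algebra
    also have "3*emb K*fps_X^4*evv.ev (Abs_fps (\<lambda>b. half 0 b)) - evv.ev D = evv.ev d"
      unfolding d_def evv.ev_simps emb_mult emb_power emb_X emb3 by (simp add: mult_ac flip: power_mult power_add)
    finally show ?thesis by (simp only: mult.assoc)
  qed
  moreover have "2*fps_X^2 \<noteq> (0 :: rat fls fps)" by simp
  ultimately have "evu.ev e = c * evv.ev d" by (metis mult_left_cancel)
  moreover have "e $ 0 = 0" by (simp add: e_def halfE_def E'_def E0)
  ultimately have ed: "e = 0" "d = 0" using kernel_uniqueness[OF _ c0] by auto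
  have "3*fps_X^2*K * half a 0 = E $ a * (K*ki^3*fps_X)^a" if "a \<ge> 1" for a
    using arg_cong[OF ed(1), of "\<lambda>f. f $ a"] that by (simp add: e_def halfE_def E'_def s_def)
  moreover have "3*fps_X^2*K * half 0 b = D $ b" for b
    using arg_cong[OF ed(2), of "\<lambda>f. f $ b"] by (simp add: d_def)
  ultimately show thesis using that E D by blast
qed

section \<open>The field generated by Z\<close>

definition peval :: "'a::field_char_0 \<Rightarrow> rat poly \<Rightarrow> 'a" where
  "peval z p = poly (map_poly of_rat p) z"

lemma peval_0: "peval z 0 = 0" by (simp add: peval_def)
lemma peval_pCons: "peval z (pCons a p) = of_rat a + z * peval z p"
  by (simp add: peval_def map_poly_pCons)
lemma peval_1: "peval z 1 = 1" using peval_pCons[of z 1 0] by (simp add: peval_0 one_pCons)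
lemma peval_X: "peval z [:0, 1:] = z" by (simp add: peval_pCons peval_0)
lemma peval_add: "peval z (p + q) = peval z p + peval z q"
  by (induction p q rule: poly_induct2) (simp_all add: peval_0 peval_pCons of_rat_add algebra_simps)
lemma peval_smult: "peval z (smult a p) = of_rat a * peval z p"
  by (induction p) (simp_all add: peval_0 peval_pCons of_rat_mult algebra_simps)
lemma peval_diff: "peval z (p - q) = peval z p - peval z q"
  using peval_add[of z "p - q" q] by simp
lemma peval_mult: "peval z (p * q) = peval z p * peval z q"
  by (induction p) (simp_all add: peval_0 peval_pCons peval_add peval_smult algebra_simps)

lemma rat_funs_iff: "x \<in> rat_funs z \<longleftrightarrow> (\<exists>p q. peval z q \<noteq> 0 \<and> x = peval z p / peval z q)"
  by (auto simp: rat_funs_def peval_def)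

definition subfield_set :: "'a::field set \<Rightarrow> bool" where
  "subfield_set K \<longleftrightarrow> 1 \<in> K \<and> (\<forall>a\<in>K. \<forall>b\<in>K. a - b \<in> K \<and> a * b \<in> K) \<and> (\<forall>a\<in>K. inverse a \<in> K)"

lemma subfield_imp_subring: "subfield_set K \<Longrightarrow> subring_set K"
  by standard (auto simp: subfield_set_def)

lemma subfield_inverse: "subfield_set K \<Longrightarrow> a \<in> K \<Longrightarrow> inverse a \<in> K"
  by (auto simp: subfield_set_def)

lemma subfield_divide: "subfield_set K \<Longrightarrow> a \<in> K \<Longrightarrow> b \<in> K \<Longrightarrow> a / b \<in> K"
  by (auto simp: subfield_set_def divide_inverse)

lemma rat_funs_subfield: "subfield_set (rat_funs z)"
  unfolding subfield_set_def
proof (intro conjI ballI)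
  show "1 \<in> rat_funs z" unfolding rat_funs_iff by (intro exI[of _ 1]) (simp add: peval_1)
next
  fix a b assume "a \<in> rat_funs z" "b \<in> rat_funs z"
  then obtain p q p' q' where *: "peval z q \<noteq> 0" "a = peval z p / peval z q" "peval z q' \<noteq> 0" "b = peval z p' / peval z q'"
    unfolding rat_funs_iff by blast
  have "a - b = peval z (p * q' - p' * q) / peval z (q * q')"
    unfolding *(2,4) using *(1,3) by (simp add: peval_diff peval_mult diff_frac_eq)
  then show "a - b \<in> rat_funs z" unfolding rat_funs_iff using * by (metis peval_mult mult_eq_0_iff)
  have "a * b = peval z (p * p') / peval z (q * q')" using * by (simp add: peval_mult)
  then show "a * b \<in> rat_funs z" unfolding rat_funs_iff using * by (metis peval_mult mult_eq_0_iff)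
next
  fix a assume "a \<in> rat_funs z"
  then obtain p q where *: "peval z q \<noteq> 0" "a = peval z p / peval z q" unfolding rat_funs_iff by blast
  show "inverse a \<in> rat_funs z"
  proof (cases "peval z p = 0")
    case True
    then show ?thesis unfolding rat_funs_iff using * by (intro exI[of _ 0] exI[of _ q]) (simp add: peval_0)
  next
    case False
    then show ?thesis unfolding rat_funs_iff using * by (intro exI[of _ q] exI[of _ p]) simp
  qed
qed

lemma rat_funs_gen: "z \<in> rat_funs z"
  unfolding rat_funs_iff by (intro exI[of _ "[:0, 1:]"] exI[of _ 1]) (simp add: peval_X peval_1)

lemma fps_to_fls_inverse_unit:
  fixes f :: "rat fps"
  assumes "f $ 0 \<noteq> 0"
  shows "fps_to_fls (inverse f) = inverse (fps_to_fls f)"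
proof -
  have "fps_to_fls (inverse f) * fps_to_fls f = 1"
    using inverse_mult_eq_1[OF assms] by (metis fls_times_fps_to_fls fps_one_to_fls)
  then show ?thesis by (metis inverse_unique mult.commute)
qed

abbreviation Zfld :: "rat fls set" where "Zfld \<equiv> rat_funs (fps_to_fls Z_series)"

lemma fls_of_rat: "(of_rat q :: rat fls) = fls_const q"
proof -
  obtain a b where "quotient_of q = (a, b)" by fastforce
  then have q: "q = of_int a / of_int b" by (rule quotient_of_div)
  show ?thesis unfolding q of_rat_divide of_rat_of_int_eq fls_of_int fls_const_divide_const ..
qed

lemma rat_funs_of_rat: "of_rat q \<in> rat_funs z"
  unfolding rat_funs_iff by (intro exI[of _ "[:q:]"] exI[of _ 1]) (simp add: peval_pCons peval_0 peval_1)

lemma Zfld_const: "fls_const q \<in> Zfld"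
  using rat_funs_of_rat[of q "fps_to_fls Z_series"] by (simp add: fls_of_rat)

text \<open>
  Since \<open>t^2\<close> lies in \<open>\<rat>(Z)\<close>, only the parity of \<open>a\<close> matters.
\<close>
definition tpow :: "nat \<Rightarrow> rat fls set" where
  "tpow a = {fls_X ^ a * g | g. g \<in> Zfld}"

lemma tpowI: "x = fls_X ^ a * g \<Longrightarrow> g \<in> Zfld \<Longrightarrow> x \<in> tpow a"
  by (auto simp: tpow_def)

lemma Zfld_subring: "subring_set Zfld"
  by (rule subfield_imp_subring[OF rat_funs_subfield])

lemma Z_series_equation: "Z_series $ 0 = 1" "(Z_series^2 - 1) * (Z_series^2 + 3)^3 = 256 * fps_X^2 * Z_series^6"
proof -
  show "Z_series $ 0 = 1" using Z_series_sqrt by simp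
  have T: "(T_series - 1) * (T_series + 3)^3 = 256 * fps_X^2 * T_series^3"
    using T_eqn_T_series unfolding T_eqn_iff by simp
  have TZ: "T_series = Z_series^2" using Z_series_sqrt by simp
  show "(Z_series^2 - 1) * (Z_series^2 + 3)^3 = 256 * fps_X^2 * Z_series^6"
    using T unfolding TZ power_mult[symmetric] by simp
qed

text \<open>
  In terms of \<open>n = (Z - 1) / (Z + 1)\<close> the equation of \<open>Z\<close> becomes \<open>K^2 t^2 = n k^3\<close>, which is the hypothesis of
  the explicit solution, for the ring \<open>B\<close> of power series that lie in \<open>\<rat>(Z)\<close>. The same equation expresses \<open>t^2\<close> by \<open>n\<close>.
\<close>
lemma half_boundary_in_tpow:
  "a \<ge> 1 \<Longrightarrow> fps_to_fls (half a 0) \<in> tpow a" "fps_to_fls (half 0 b) \<in> tpow 0" "fls_X ^ 2 \<in> Zfld"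
proof -
  interpret G: subring_set Zfld by (rule Zfld_subring)
  define B where "B = {f :: rat fps. fps_to_fls f \<in> Zfld}"
  have B: "subring_set B"
    by standard (auto simp: B_def fls_times_fps_to_fls G.one_in intro: G.diff_in G.mult_in)
  interpret B: subring_set B by (rule B)
  have inv_B: "inverse f \<in> B" if "f \<in> B" "f $ 0 \<noteq> 0" for f
    using that subfield_inverse[OF rat_funs_subfield] by (auto simp: B_def fps_to_fls_inverse_unit)
  have ZB: "Z_series \<in> B" by (simp add: B_def rat_funs_gen)
  define i where "i = inverse (Z_series + 1)"
  have Z10: "(Z_series + 1) $ 0 \<noteq> 0" using Z_series_equation by simp
  have i1: "(Z_series + 1) * i = 1" unfolding i_def using inverse_mult_eq_1'[OF Z10] .
  have iB: "i \<in> B" unfolding i_def by (intro inv_B B.add_in ZB B.one_in Z10)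
  define n where "n = (Z_series - 1) * i"
  have nB: "n \<in> B" unfolding n_def by (intro B.mult_in B.diff_in ZB B.one_in iB)
  have n0: "n $ 0 = 0" by (simp add: n_def Z_series_equation)
  define ki where "ki = inverse (1 - n + n^2)"
  have k0: "(1 - n + n^2) $ 0 = 1" by (simp add: n0 fps_nth_power_0)
  have kki: "(1 - n + n^2) * ki = 1" unfolding ki_def by (rule inverse_mult_eq_1') (simp add: k0[simplified])
  have kiB: "ki \<in> B" unfolding ki_def
    by (intro inv_B B.add_in B.diff_in B.power_in nB B.one_in) (simp add: k0[simplified])
  (* The four factors of the equation for Z, up to powers of 2 and of i. *)
  have n1: "1 - n = 2 * i" "1 + n = 2 * Z_series * i" "1 - n + n^2 = (Z_series^2 + 3) * i^2" "n = (Z_series^2 - 1) * i^2"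
    unfolding n_def using i1 by algebra+
  have theta: "((1-n)*(1+n)^3)^2 * fps_X^2 = n * (1 - n + n^2)^3"
  proof -
    have "((1-n)*(1+n)^3)^2 * fps_X^2 = (256 * fps_X^2 * Z_series^6) * i^8"
      unfolding n1(1,2) by algebra
    also have "\<dots> = ((Z_series^2 - 1) * i^2) * ((Z_series^2 + 3) * i^2)^3"
      unfolding Z_series_equation(2)[symmetric] by algebra
    finally show ?thesis unfolding n1(3) n1(4)[symmetric] .
  qed
  define K where "K = (1-n)*(1+n)^3"
  have KB: "K \<in> B" unfolding K_def by (intro B.mult_in B.diff_in B.add_in B.power_in nB B.one_in)
  have K0: "K $ 0 = 1" by (simp add: K_def n0 fps_nth_power_0)
  have K_nz: "fps_to_fls K \<noteq> 0" using K0 by auto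
  show XG: "fls_X ^ 2 \<in> Zfld"
  proof -
    have "fps_to_fls K^2 * fls_X^2 = fps_to_fls (n * (1 - n + n^2)^3)"
      unfolding theta[symmetric] by (simp add: K_def fls_times_fps_to_fls fps_to_fls_power)
    then have "fls_X^2 = fps_to_fls (n * (1 - n + n^2)^3) / fps_to_fls K^2"
      using K_nz by (simp add: eq_divide_eq mult.commute)
    moreover have "n * (1 - n + n^2)^3 \<in> B" by (intro B.mult_in B.diff_in B.add_in B.power_in nB B.one_in)
    ultimately show ?thesis using KB
      by (simp add: B_def subfield_divide[OF rat_funs_subfield] G.power_in)
  qed
  obtain E D where E: "coeffs_in B E" and D: "coeffs_in B D"
    and half_E: "\<And>a. a \<ge> 1 \<Longrightarrow> 3*fps_X^2*K * half a 0 = E $ a * (K*ki^3*fps_X)^a"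
    and half_D: "\<And>b. 3*fps_X^2*K * half 0 b = D $ b"
    by (rule half_explicit[OF B nB kiB kki n0 theta, folded K_def]) blast
  define M where "M = 3 * fls_X^2 * fps_to_fls K"
  have MG: "M \<in> Zfld" unfolding M_def using KB by (intro G.mult_in G.numeral_in XG) (simp add: B_def)
  have M: "M * fps_to_fls F = fps_to_fls (3*fps_X^2*K*F)" "M \<noteq> 0" for F
    unfolding M_def using K_nz by (simp_all add: fls_times_fps_to_fls fps_to_fls_power)
  show "fps_to_fls (half a 0) \<in> tpow a" if "a \<ge> 1"
  proof -
    have "M * fps_to_fls (half a 0) = fls_X^a * fps_to_fls (E $ a * (K*ki^3)^a)"
      unfolding M half_E[OF that] by (simp add: fls_times_fps_to_fls fps_to_fls_power power_mult_distrib)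
    then have eq: "fps_to_fls (half a 0) = fls_X^a * (fps_to_fls (E $ a * (K*ki^3)^a) / M)"
      using M(2) by (simp add: eq_divide_eq mult.commute)
    have "E $ a * (K*ki^3)^a \<in> B" using E by (intro B.mult_in B.power_in KB kiB) (simp add: coeffs_in_def)
    then show ?thesis using MG
      by (intro tpowI[OF eq]) (auto simp: B_def intro: subfield_divide[OF rat_funs_subfield])
  qed
  show "fps_to_fls (half 0 b) \<in> tpow 0" for b
  proof -
    have "M * fps_to_fls (half 0 b) = fps_to_fls (D $ b)" unfolding M half_D ..
    then have eq: "fps_to_fls (half 0 b) = fls_X^0 * (fps_to_fls (D $ b) / M)"
      using M(2) by (simp add: eq_divide_eq mult.commute)
    have "D $ b \<in> B" using D by (simp add: coeffs_in_def)
    then show ?thesis using MG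
      by (intro tpowI[OF eq]) (auto simp: B_def intro: subfield_divide[OF rat_funs_subfield])
  qed
qed

lemma tpow_diff: "x \<in> tpow a \<Longrightarrow> y \<in> tpow a \<Longrightarrow> x - y \<in> tpow a"
  unfolding tpow_def using subring_set.diff_in[OF Zfld_subring]
  by (auto simp flip: right_diff_distrib)

lemma tpow_scale: "x \<in> tpow a \<Longrightarrow> c \<in> Zfld \<Longrightarrow> c * x \<in> tpow a"
  unfolding tpow_def using subring_set.mult_in[OF Zfld_subring] by (auto simp: mult.left_commute)

lemma tpow_even: "x \<in> tpow a \<Longrightarrow> x \<in> tpow (a + 2 * m)"
proof -
  assume "x \<in> tpow a"
  then obtain g where g: "x = fls_X^a * g" "g \<in> Zfld" by (auto simp: tpow_def)
  have "x = fls_X^(a + 2*m) * (g / (fls_X^2)^m)" by (simp add: g power_add power_mult)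
  then show ?thesis
    by (rule tpowI) (intro subfield_divide[OF rat_funs_subfield] subring_set.power_in[OF Zfld_subring] g(2) half_boundary_in_tpow(3))
qed

lemma tpow_divide_X: "x \<in> tpow a \<Longrightarrow> x / fls_X \<in> tpow (a + 1)"
proof -
  assume "x \<in> tpow a"
  then obtain g where g: "x = fls_X^a * g" "g \<in> Zfld" by (auto simp: tpow_def)
  have "x / fls_X = fls_X^(a + 1) * (g / fls_X^2)" by (simp add: g power2_eq_square)
  then show ?thesis
    by (rule tpowI) (intro subfield_divide[OF rat_funs_subfield] g(2) half_boundary_in_tpow(3))
qed

lemma solve_diagonal_step:
  fixes X :: "'a::field_char_0"
  assumes "h = c + X * (2 * (p + q))" "X \<noteq> 0"
  shows "q = (1/2) * ((h - c) / X) - p"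
proof -
  have "(h - c) / X = 2 * (p + q)"
    unfolding assms(1) add_diff_cancel_left' by (rule nonzero_mult_div_cancel_left[OF assms(2)])
  moreover have "(1/2) * (2 * (p + q)) = p + q"
    by (simp only: mult.assoc[symmetric]) simp
  ultimately show ?thesis by (simp only: add_diff_cancel_left')
qed

lemma solve_step:
  fixes X :: "'a::field_char_0"
  assumes "h = c + X * (p + q + r + s)" "X \<noteq> 0"
  shows "r = (h - c) / X - p - q - s"
proof -
  have "(h - c) / X = p + q + r + s"
    unfolding assms(1) add_diff_cancel_left' by (rule nonzero_mult_div_cancel_left[OF assms(2)])
  moreover have "p + q + r + s - p - q - s = r" by (simp add: algebra_simps)
  ultimately show ?thesis by (simp only:)
qed

text \<open>
  Induction on the rows: the recurrence at \<open>(a - 1, b)\<close> can be solved for the entry \<open>(a, b + 1)\<close>, because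
  the step \<open>(-1, -1)\<close> is available. Division by \<open>t\<close> and the change of column by one have the same effect on the exponent
  modulo 2. The first column is the diagonal series, which is known.
\<close>
lemma half_in_tpow: "fps_to_fls (half a b) \<in> tpow a"
proof (induction b arbitrary: a rule: less_induct)
  case (less b0)
  show ?case
  proof (cases b0)
    case 0
    then show ?thesis using half_boundary_in_tpow(1,2) by (cases "a = 0") auto
  next
    case b0: (Suc b)
    have Suc: "fps_to_fls (half a b) \<in> tpow a" for a using less b0 by simp
    have Suc': "fps_to_fls (half a (b - 1)) \<in> tpow a" for a using less b0 by simp
    interpret G: subring_set Zfld by (rule Zfld_subring)
    let ?h = "\<lambda>a b. fps_to_fls (half a b)"
    note cG = Zfld_const
    consider "a = 0" | "a = 1" | a' where "a = a' + 1" "a' \<ge> 1"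
      by (cases a; cases "a - 1") auto
    then show ?thesis
    proof cases
      case 1
      then show ?thesis using half_boundary_in_tpow(2) by simp
    next
      case 2
      define c where "c = (if b = 0 then 2/3 else 0 :: rat)"
      have "?h 0 b = fls_const c + fls_X * (2 * (?h 1 b + ?h 1 (Suc b)))"
        by (subst half_rec_diagonal) (simp add: c_def fls_times_fps_to_fls)
      from solve_diagonal_step[OF this]
      have "?h 1 (Suc b) = (1/2) * ((?h 0 b - fls_const c) / fls_X) - ?h 1 b" by simp
      moreover have "(1/2 :: rat fls) \<in> Zfld"
        by (intro subfield_divide[OF rat_funs_subfield] G.one_in G.numeral_in)
      moreover have "fls_const c \<in> tpow 0" by (rule tpowI[of _ _ "fls_const c"]) (simp_all add: cG)
      moreover have "(?h 0 b - fls_const c) / fls_X \<in> tpow 1" if "fls_const c \<in> tpow 0"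
        using tpow_divide_X[OF tpow_diff[OF Suc[of 0] that]] by simp
      ultimately show ?thesis
        unfolding 2 b0 using tpow_diff[OF tpow_scale Suc[of 1]] by metis
    next
      case 3
      define c where "c = (if a' = 2 \<and> b = 0 then fls_const (1/3) else 0 :: rat fls)"
      define d where "d = (if b = 0 then 0 else ?h (a' - 1) (b - 1))"
      have "?h a' b = c + fls_X * (?h (a' - 1) b + ?h (a' + 1) b + ?h (a' + 1) (b + 1) + d)"
        by (subst half_rec[OF 3(2)]) (simp add: c_def d_def fls_times_fps_to_fls)
      from solve_step[OF this]
      have "?h a (Suc b) = (?h a' b - c) / fls_X - ?h (a' - 1) b - ?h (a' + 1) b - d"
        using 3(1) by simp
      moreover have "c \<in> tpow a'"
      proof (cases "a' = 2 \<and> b = 0")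
        case True
        have "fls_const (1/3) \<in> tpow 0" by (rule tpowI[of _ _ "fls_const (1/3)"]) (simp_all add: cG)
        then show ?thesis using tpow_even[of _ 0 1] True by (simp add: c_def numeral_2_eq_2)
      next
        case False
        then show ?thesis by (intro tpowI[of _ _ 0]) (auto simp: c_def G.zero_in)
      qed
      moreover have down: "x \<in> tpow (a' + 1)" if "x \<in> tpow (a' - 1)" for x
        using tpow_even[OF that, of 1] 3(2) by simp
      moreover have "d \<in> tpow (a' + 1)"
      proof (cases "b = 0")
        case False
        then show ?thesis using down[OF Suc'[of "a' - 1"]] by (simp add: d_def)
      next
        case True
        then show ?thesis by (intro tpowI[of _ _ 0]) (auto simp: d_def G.zero_in)
      qed
      moreover have "(?h a' b - c) / fls_X \<in> tpow (a' + 1)" if "c \<in> tpow a'"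
        by (rule tpow_divide_X[OF tpow_diff[OF Suc that]])
      moreover have "?h (a' - 1) b \<in> tpow (a' + 1)" by (rule down[OF Suc])
      ultimately show ?thesis unfolding b0 using Suc[of "a' + 1"] 3(1) by (simp add: tpow_diff)
  qed
qed
qed

text \<open>
  For \<open>i \<le> j\<close> the exponent \<open>j - i\<close> given by the half has the parity of \<open>i + j\<close>; symmetry covers the other case.
\<close>
lemma A_in_tpow:
  "fps_to_fls (A_gf (int i) (int j)) \<in> tpow (i + j)" "fps_to_fls (A_gf (- int i) (int j)) \<in> tpow (i + j)"
proof -
  have 1: "fps_to_fls (A_gf (int i) (int j)) \<in> tpow (i + j)" if "i \<le> j" for i j
    using tpow_even[OF half_in_tpow[of "j - i" j], of i] that by (simp add: half_def of_nat_diff)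
  show "fps_to_fls (A_gf (int i) (int j)) \<in> tpow (i + j)"
    using 1[of i j] 1[of j i] A_sym[of "int i" "int j"] by (cases "i \<le> j") (auto simp: add.commute)
  show "fps_to_fls (A_gf (- int i) (int j)) \<in> tpow (i + j)"
    using half_in_tpow[of "i + j" j] by (simp add: half_def)
qed

section \<open>Finite-dimensional differential fields of Laurent series\<close>

text \<open>
  Gaussian elimination: more unknowns than equations give a nontrivial solution in the field of the coefficients.
\<close>
lemma homogeneous_system:
  fixes K :: "'a::field set"
  assumes K: "subfield_set K" and J: "finite J" and I: "finite I" "card J < card I"
    and c: "\<And>i j. i \<in> I \<Longrightarrow> j \<in> J \<Longrightarrow> c i j \<in> K"
  shows "\<exists>d. (\<forall>i\<in>I. d i \<in> K) \<and> (\<exists>i\<in>I. d i \<noteq> 0) \<and> (\<forall>j\<in>J. (\<Sum>i\<in>I. d i * c i j) = 0)"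
  using J I c
proof (induction J arbitrary: I c rule: finite_induct)
  case empty
  then obtain i where "i \<in> I" by fastforce
  then show ?case using subring_set.one_in[OF subfield_imp_subring[OF K]]
    by (intro exI[of _ "\<lambda>_. 1"]) auto
next
  case (insert m J)
  interpret K: subring_set K by (rule subfield_imp_subring[OF K])
  show ?case
  proof (cases "\<forall>i\<in>I. c i m = 0")
    case True
    obtain d where d: "\<forall>i\<in>I. d i \<in> K" "\<exists>i\<in>I. d i \<noteq> 0" "\<forall>j\<in>J. (\<Sum>i\<in>I. d i * c i j) = 0"
      using insert.IH[of I c] insert.prems insert.hyps by auto
    then show ?thesis using True by (intro exI[of _ d]) auto
  next
    case False
    then obtain p where p: "p \<in> I" "c p m \<noteq> 0" by blast
    define I' where "I' = I - {p}"
    (* Elimination of the unknown p by means of equation m. *)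
    define e where "e i j = c i j - c i m / c p m * c p j" for i j
    have I': "finite I'" "card J < card I'" "p \<notin> I'" "I = insert p I'"
      using insert p by (auto simp: I'_def)
    have "\<exists>d. (\<forall>i\<in>I'. d i \<in> K) \<and> (\<exists>i\<in>I'. d i \<noteq> 0) \<and> (\<forall>j\<in>J. (\<Sum>i\<in>I'. d i * e i j) = 0)"
      using I' insert.prems p
      by (intro insert.IH) (auto simp: e_def intro!: K.diff_in K.mult_in subfield_divide[OF K])
    then obtain d where d: "\<forall>i\<in>I'. d i \<in> K" "\<exists>i\<in>I'. d i \<noteq> 0" "\<forall>j\<in>J. (\<Sum>i\<in>I'. d i * e i j) = 0"
      by blast
    define x where "x = - (\<Sum>i\<in>I'. d i * (c i m / c p m))"
    define d' where "d' = d(p := x)"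
    have sum: "(\<Sum>i\<in>I. d' i * c i j) = (\<Sum>i\<in>I'. d i * e i j)" for j
    proof -
      have "(\<Sum>i\<in>I'. d' i * c i j) = (\<Sum>i\<in>I'. d i * c i j)"
        using I'(3) by (intro sum.cong) (auto simp: d'_def)
      then have "(\<Sum>i\<in>I. d' i * c i j) = x * c p j + (\<Sum>i\<in>I'. d i * c i j)"
        using I' by (simp add: d'_def)
      also have "\<dots> = (\<Sum>i\<in>I'. d i * e i j)"
        by (simp add: x_def e_def sum_distrib_right sum_distrib_left sum_subtractf right_diff_distrib mult_ac)
      finally show ?thesis .
    qed
    have "(\<Sum>i\<in>I. d' i * c i j) = 0" if "j \<in> insert m J" for j
    proof (cases "j = m")
      case True
      then show ?thesis unfolding sum using p by (simp add: e_def)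
    next
      case False
      then show ?thesis unfolding sum using d(3) that by auto
    qed
    moreover have "x \<in> K" unfolding x_def using d(1) insert.prems I' p
      by (intro K.uminus_in K.sum_in K.mult_in subfield_divide[OF K]) auto
    then have "\<forall>i\<in>I. d' i \<in> K" using d(1) I' by (auto simp: d'_def)
    moreover have "\<exists>i\<in>I. d' i \<noteq> 0" using d(2) I' by (auto simp: d'_def)
    ultimately show ?thesis by blast
  qed
qed

text \<open>
  The span over a subfield that is given as a set. The inductive form allows spanning sets to
  be combined without bookkeeping of coefficients.
\<close>
inductive_set kspan :: "'a::field set \<Rightarrow> 'a set \<Rightarrow> 'a set" for K B where
  kspan_0: "0 \<in> kspan K B"
| kspan_step: "x \<in> kspan K B \<Longrightarrow> k \<in> K \<Longrightarrow> b \<in> B \<Longrightarrow> x + k * b \<in> kspan K B"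

lemma kspan_base: "subfield_set K \<Longrightarrow> b \<in> B \<Longrightarrow> b \<in> kspan K B"
  using kspan_step[OF kspan_0, of 1 K b B] by (auto simp: subfield_set_def)

lemma kspan_add:
  assumes "x \<in> kspan K B" and "y \<in> kspan K B"
  shows "x + y \<in> kspan K B"
  using assms(2)
proof (induction y rule: kspan.induct)
  case (kspan_step y k b)
  then show ?case using kspan.kspan_step[of "x + y" K B k b] by (simp add: add.assoc)
qed (use assms(1) in simp)

lemma kspan_scale:
  assumes K: "subfield_set K" and "x \<in> kspan K B" and "k \<in> K"
  shows "k * x \<in> kspan K B"
  using assms(2)
proof (induction x rule: kspan.induct)
  case (kspan_step x k' b)
  then show ?case using kspan.kspan_step[of "k * x" K B "k * k'" b]
    using assms(3) by (simp add: distrib_left mult.assoc subring_set.mult_in[OF subfield_imp_subring[OF K]])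
qed (simp add: kspan.kspan_0)

lemma kspan_sum: "(\<And>i. i \<in> I \<Longrightarrow> f i \<in> kspan K B) \<Longrightarrow> sum f I \<in> kspan K B"
  by (induction I rule: infinite_finite_induct) (auto intro: kspan_0 kspan_add)

lemma kspan_mult:
  assumes K: "subfield_set K" and "x \<in> kspan K B" "y \<in> kspan K B'"
  shows "x * y \<in> kspan K {b * b' | b b'. b \<in> B \<and> b' \<in> B'}"
  using assms(2)
proof (induction x rule: kspan.induct)
  case (kspan_step x k b)
  have "b * y \<in> kspan K {b * b' | b b'. b \<in> B \<and> b' \<in> B'}" using assms(3)
  proof (induction y rule: kspan.induct)
    case (kspan_step y k' b')
    have "b * b' \<in> {b * b' | b b'. b \<in> B \<and> b' \<in> B'}" using \<open>b \<in> B\<close> \<open>b' \<in> B'\<close> by blast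
    from kspan.kspan_step[OF kspan_step.IH \<open>k' \<in> K\<close> this]
    show ?case by (simp only: distrib_left mult.left_commute[of b k' b'])
  qed (simp add: kspan.kspan_0)
  then show ?case using kspan_add[OF kspan_step.IH kspan_scale[OF K]] \<open>k \<in> K\<close>
    by (simp add: distrib_right mult.assoc)
qed (simp add: kspan.kspan_0)

lemma kspan_combination:
  assumes K: "subfield_set K" and "finite B" "x \<in> kspan K B"
  shows "\<exists>c. (\<forall>b\<in>B. c b \<in> K) \<and> x = (\<Sum>b\<in>B. c b * b)"
  using assms(3)
proof (induction x rule: kspan.induct)
  case kspan_0
  then show ?case using subring_set.zero_in[OF subfield_imp_subring[OF K]] by (intro exI[of _ "\<lambda>_. 0"]) auto
next
  case (kspan_step x k b)
  then obtain c where c: "\<forall>b\<in>B. c b \<in> K" "x = (\<Sum>b\<in>B. c b * b)" by blast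
  have "(\<Sum>b'\<in>B. (c(b := c b + k)) b' * b') = (\<Sum>b'\<in>B. c b' * b' + (if b' = b then k * b else 0))"
    by (intro sum.cong) (auto simp: distrib_right)
  also have "\<dots> = x + k * b" using kspan_step \<open>finite B\<close> by (simp add: sum.distrib c)
  finally show ?case using c(1) kspan_step subring_set.add_in[OF subfield_imp_subring[OF K]]
    by (intro exI[of _ "c(b := c b + k)"]) auto
qed

definition findim :: "'a::field set \<Rightarrow> 'a set \<Rightarrow> bool" where
  "findim K V \<longleftrightarrow> (\<exists>B. finite B \<and> V \<subseteq> kspan K B)"

lemma findim_dependent:
  fixes y :: "nat \<Rightarrow> 'a::field"
  assumes K: "subfield_set K" and V: "findim K V" and y: "\<And>k. y k \<in> V"
  shows "\<exists>n d. (\<forall>k\<le>n. d k \<in> K) \<and> (\<exists>k\<le>n. d k \<noteq> 0) \<and> (\<Sum>k\<le>n. d k * y k) = 0"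
proof -
  obtain B where B: "finite B" "V \<subseteq> kspan K B" using V by (auto simp: findim_def)
  have "\<forall>k. \<exists>c. (\<forall>b\<in>B. c b \<in> K) \<and> y k = (\<Sum>b\<in>B. c b * b)"
    using kspan_combination[OF K B(1)] B(2) y by blast
  then obtain c where c: "\<And>k b. b \<in> B \<Longrightarrow> c k b \<in> K" "\<And>k. y k = (\<Sum>b\<in>B. c k b * b)" by metis
  obtain d where d: "\<forall>i\<in>{..card B}. d i \<in> K" "\<exists>i\<in>{..card B}. d i \<noteq> 0"
      "\<forall>b\<in>B. (\<Sum>i\<in>{..card B}. d i * c i b) = 0"
    using homogeneous_system[OF K B(1), of "{..card B}" c] c(1) by auto
  have "(\<Sum>k\<le>card B. d k * y k) = (\<Sum>b\<in>B. (\<Sum>k\<le>card B. d k * c k b) * b)"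
    unfolding c(2) sum_distrib_left sum_distrib_right by (subst sum.swap) (simp add: mult.assoc)
  also have "\<dots> = 0" using d(3) by simp
  finally show ?thesis using d(1,2) by (intro exI[of _ "card B"] exI[of _ d]) auto
qed

text \<open>
  The powers of \<open>x\<close> are linearly dependent over \<open>K\<close>. Divided by its lowest term, a dependence expresses
  the inverse of \<open>x\<close> as a polynomial in \<open>x\<close>.
\<close>
lemma findim_subring_inverse:
  assumes K: "subfield_set K" and V: "findim K V" and sub: "subring_set V" "K \<subseteq> V" and x: "x \<in> V"
  shows "inverse x \<in> V"
proof (cases "x = 0")
  case False
  interpret V: subring_set V by (rule sub)
  obtain n d where d: "\<forall>k\<le>n. d k \<in> K" "\<exists>k\<le>n. d k \<noteq> 0" "(\<Sum>k\<le>n. d k * x ^ k) = 0"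
    using findim_dependent[OF K V, of "\<lambda>k. x ^ k"] V.power_in[OF x] by blast
  define l where "l = (LEAST k. k \<le> n \<and> d k \<noteq> 0)"
  have l: "l \<le> n" "d l \<noteq> 0" using LeastI_ex[of "\<lambda>k. k \<le> n \<and> d k \<noteq> 0"] d(2) unfolding l_def by auto
  have low: "d k = 0" if "k < l" for k
    using not_less_Least[of k "\<lambda>k. k \<le> n \<and> d k \<noteq> 0"] that l(1) unfolding l_def[symmetric] by auto
  define s where "s = (\<Sum>k\<in>{l<..n}. d k * x ^ (k - l - 1))"
  have "0 = (\<Sum>k\<in>{l..n}. d k * x ^ k)"
    unfolding d(3)[symmetric] by (rule sum.mono_neutral_right) (auto simp: low)
  also have "\<dots> = d l * x ^ l + (\<Sum>k\<in>{l<..n}. d k * x ^ k)"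
    using l(1) by (simp add: sum.head)
  also have "(\<Sum>k\<in>{l<..n}. d k * x ^ k) = x ^ l * (x * s)"
    unfolding s_def sum_distrib_left
  proof (rule sum.cong[OF refl])
    fix k assume "k \<in> {l<..n}"
    then have "k = l + (1 + (k - l - 1))" by simp
    then have "x ^ k = x ^ l * (x * x ^ (k - l - 1))" by (metis power_add power_one_right)
    then show "d k * x ^ k = x ^ l * (x * (d k * x ^ (k - l - 1)))" by (simp add: mult_ac)
  qed
  finally have "x ^ l * (d l + x * s) = 0" by (simp add: algebra_simps)
  then have "x * s = - d l" using False by (simp add: add_eq_0_iff)
  then have "x * (- (s / d l)) = 1" using l(2) by simp
  then have "inverse x = - (s / d l)" by (rule inverse_unique)
  also have "s / d l = s * inverse (d l)" by (simp add: divide_inverse)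
  also have "- (s * inverse (d l)) \<in> V"
    unfolding s_def using d(1) l sub(2) x subfield_inverse[OF K, of "d l"]
    by (intro V.uminus_in V.mult_in V.sum_in V.power_in) auto
  finally show ?thesis .
qed (use subring_set.zero_in[OF sub(1)] in simp)

abbreviation Kt :: "rat fls set" where "Kt \<equiv> rat_funs fls_X"

text \<open>
  Exactly the algebraic series lie in such fields, and this
  turns algebraicity and D-finiteness into statements about dimension.
\<close>
definition dfield :: "rat fls set \<Rightarrow> bool" where
  "dfield S \<longleftrightarrow> subfield_set S \<and> Kt \<subseteq> S \<and> findim Kt S \<and> (\<forall>x\<in>S. fls_deriv x \<in> S)"

lemma fls_deriv_peval: "fls_deriv (peval (fls_X :: rat fls) p) = peval fls_X (pderiv p)"
  by (induction p) (simp_all add: peval_0 peval_pCons pderiv_pCons peval_add fls_of_rat algebra_simps)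

lemma peval_in: "subring_set S \<Longrightarrow> (\<And>q. of_rat q \<in> S) \<Longrightarrow> z \<in> S \<Longrightarrow> peval z p \<in> S"
  by (induction p) (auto simp: peval_0 peval_pCons subring_set.zero_in subring_set.add_in subring_set.mult_in)

lemma rat_funs_subset:
  assumes "subfield_set S" "\<And>q. of_rat q \<in> S" "z \<in> S"
  shows "rat_funs z \<subseteq> S"
  using peval_in[OF subfield_imp_subring[OF assms(1)] assms(2,3)] subfield_divide[OF assms(1)]
  by (auto simp: rat_funs_iff)

lemma dfield_Kt: "dfield Kt"
proof -
  interpret K: subring_set Kt by (rule subfield_imp_subring[OF rat_funs_subfield])
  have "Kt \<subseteq> kspan Kt {1}"
    using kspan_step[OF kspan_0, of _ Kt 1 "{1}"] by auto
  then have "findim Kt Kt" unfolding findim_def by blast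
  moreover have "fls_deriv x \<in> Kt" if x: "x \<in> Kt" for x
  proof -
    obtain q p where pq: "peval (fls_X :: rat fls) q \<noteq> 0" "x = peval fls_X p / peval fls_X q"
      using x unfolding rat_funs_iff by blast
    have "x * peval fls_X q = peval (fls_X :: rat fls) p" using pq by simp
    then have "fls_deriv (x * peval fls_X q) = peval fls_X (pderiv p)" by (simp add: fls_deriv_peval)
    then have "fls_deriv x * peval fls_X q = peval fls_X (pderiv p) - x * peval fls_X (pderiv q)"
      by (simp add: fls_deriv_peval algebra_simps)
    then have "fls_deriv x = (peval fls_X (pderiv p) - x * peval fls_X (pderiv q)) / peval fls_X q"
      using pq(1) by (simp add: eq_divide_eq)
    moreover have "peval (fls_X :: rat fls) r \<in> Kt" for r
      by (rule peval_in[OF K.subring_set_axioms rat_funs_of_rat rat_funs_gen])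
    ultimately show ?thesis using x
      by (auto intro!: subfield_divide[OF rat_funs_subfield] K.diff_in K.mult_in)
  qed
  ultimately show ?thesis unfolding dfield_def using rat_funs_subfield by blast
qed

definition poly_in :: "'a::comm_ring_1 set \<Rightarrow> 'a poly \<Rightarrow> bool" where
  "poly_in S p \<longleftrightarrow> (\<forall>i. coeff p i \<in> S)"

lemma poly_in_subring: "subring_set S \<Longrightarrow> subring_set (Collect (poly_in S))"
  by standard
     (auto simp: poly_in_def coeff_mult subring_set.zero_in subring_set.one_in coeff_1 coeff_pCons
        intro!: subring_set.diff_in subring_set.sum_in subring_set.mult_in split: nat.splits)

lemma fls_deriv_poly:
  "fls_deriv (poly p f) = poly (map_poly fls_deriv p) f + poly (pderiv p) f * fls_deriv (f :: rat fls)"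
  by (induction p) (simp_all add: pderiv_pCons map_poly_pCons algebra_simps)

text \<open>
  The elements of \<open>S(f)\<close> are polynomials in \<open>f\<close> over \<open>S\<close>, spanned by finitely many powers of \<open>f\<close>; finite
  dimension gives the inverses. If \<open>m\<close> is an annihilating polynomial of minimal degree, then \<open>m'(f)\<close> is not zero, and differentiation of \<open>m(f) = 0\<close> gives
  the derivative of \<open>f\<close>.
\<close>
lemma dfield_adjoin:
  assumes S: "dfield S" and p: "poly_in S p" "p \<noteq> 0" "poly p f = 0"
  shows "\<exists>S'. dfield S' \<and> S \<subseteq> S' \<and> f \<in> S'"
proof -
  have SF: "subfield_set S" and KS: "Kt \<subseteq> S" and fin: "findim Kt S" and dS: "\<And>x. x \<in> S \<Longrightarrow> fls_deriv x \<in> S"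
    using S by (auto simp: dfield_def)
  interpret S: subring_set S by (rule subfield_imp_subring[OF SF])
  interpret P: subring_set "Collect (poly_in S)" by (rule poly_in_subring[OF S.subring_set_axioms])
  have KF: "subfield_set Kt" by (rule rat_funs_subfield)
  define ann where "ann p \<longleftrightarrow> poly_in S p \<and> p \<noteq> 0 \<and> poly p f = 0" for p
  define m where "m = arg_min degree ann"
  have m: "ann m" and min: "degree m \<le> degree r" if "ann r" for r
    unfolding m_def using arg_min_natI[of ann p degree] arg_min_nat_le[of ann r degree] p that by (auto simp: ann_def)
  have m: "poly_in S m" "m \<noteq> 0" "poly m f = 0" using m[of p] p by (auto simp: ann_def)
  define d where "d = degree m"
  have d: "d > 0"
  proof (rule ccontr)
    assume "\<not> d > 0"
    then obtain c where "m = [:c:]" unfolding d_def by (metis degree_eq_zeroE not_gr0)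
    then show False using m by simp
  qed
  define S' where "S' = {poly r f | r. poly_in S r}"
  have S'I: "poly r f \<in> S'" if "poly_in S r" for r using that by (auto simp: S'_def)
  have sub: "subring_set S'"
  proof
    show "1 \<in> S'" using S'I[of 1] P.one_in by simp
    fix a b assume "a \<in> S'" "b \<in> S'"
    then obtain r s where rs: "poly_in S r" "a = poly r f" "poly_in S s" "b = poly s f" by (auto simp: S'_def)
    then show "a - b \<in> S'" "a * b \<in> S'"
      using S'I[of "r - s"] S'I[of "r * s"] P.diff_in P.mult_in by auto
  qed
  interpret S': subring_set S' by (rule sub)
  have SS': "S \<subseteq> S'"
  proof
    fix a assume "a \<in> S"
    then have "poly_in S [:a:]" by (auto simp: poly_in_def coeff_pCons S.zero_in split: nat.splits)
    then show "a \<in> S'" using S'I[of "[:a:]"] by simp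
  qed
  have fS': "f \<in> S'"
  proof -
    have "poly_in S [:0, 1:]" by (auto simp: poly_in_def coeff_pCons S.zero_in S.one_in split: nat.splits)
    then show ?thesis using S'I[of "[:0, 1:]"] by simp
  qed
  define F where "F = (\<lambda>i. f ^ i) ` {..<d}"
  have fd: "f ^ d \<in> kspan S F"
  proof -
    have "0 = (\<Sum>i\<le>d. coeff m i * f ^ i)" using m(3) by (simp add: poly_altdef d_def)
    also have "\<dots> = (\<Sum>i<d. coeff m i * f ^ i) + coeff m d * f ^ d"
      by (simp add: lessThan_Suc_atMost[symmetric])
    finally have "f ^ d = (- inverse (coeff m d)) * (\<Sum>i<d. coeff m i * f ^ i)"
      using m(2) by (simp add: d_def field_simps add_eq_0_iff eq_commute[of 0])
    moreover have "(\<Sum>i<d. coeff m i * f ^ i) \<in> kspan S F"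
      using m(1) by (intro kspan_sum kspan_scale[OF SF] kspan_base[OF SF]) (auto simp: F_def poly_in_def)
    moreover have "- inverse (coeff m d) \<in> S"
      using m(1) by (intro S.uminus_in subfield_inverse[OF SF]) (auto simp: poly_in_def)
    ultimately show ?thesis by (simp only: kspan_scale[OF SF])
  qed
  have fx: "f * x \<in> kspan S F" if "x \<in> kspan S F" for x
    using that
  proof (induction x rule: kspan.induct)
    case (kspan_step x k b)
    then obtain i where i: "i < d" "b = f ^ i" by (auto simp: F_def)
    have "f * b \<in> kspan S F"
    proof (cases "Suc i = d")
      case True
      then show ?thesis using fd i by auto
    next
      case False
      then have "f ^ Suc i \<in> F" unfolding F_def using i by (intro imageI) auto
      then show ?thesis using i kspan_base[OF SF] by auto
    qed
    then have "f * x + k * (f * b) \<in> kspan S F"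
      using kspan_add[OF kspan_step.IH kspan_scale[OF SF]] kspan_step.hyps by blast
    then show ?case by (simp add: algebra_simps)
  qed (simp add: kspan_0)
  have fk: "f ^ k \<in> kspan S F" for k
  proof (induction k)
    case 0
    have "f ^ 0 \<in> F" unfolding F_def using d by (intro imageI) auto
    then show ?case by (rule kspan_base[OF SF])
  qed (use fx in simp)
  obtain B where B: "finite B" "S \<subseteq> kspan Kt B" using fin by (auto simp: findim_def)
  have "S' \<subseteq> kspan Kt {b * b' | b b'. b \<in> B \<and> b' \<in> F}"
  proof
    fix x assume "x \<in> S'"
    then obtain r where r: "poly_in S r" "x = poly r f" by (auto simp: S'_def)
    have "x \<in> kspan S F" unfolding r(2) poly_altdef
      using r(1) fk by (intro kspan_sum kspan_scale[OF SF]) (auto simp: poly_in_def)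
    then show "x \<in> kspan Kt {b * b' | b b'. b \<in> B \<and> b' \<in> F}"
    proof (induction x rule: kspan.induct)
      case (kspan_step x k b)
      then have "k * b \<in> kspan Kt {b * b' | b b'. b \<in> B \<and> b' \<in> F}"
        using kspan_mult[OF KF _ kspan_base[OF KF \<open>b \<in> F\<close>]] B(2) by blast
      then show ?case using kspan_step by (intro kspan_add)
    qed (simp add: kspan_0)
  qed
  moreover have "finite {b * b' | b b'. b \<in> B \<and> b' \<in> F}"
    using finite_image_set2[of "\<lambda>b. b \<in> B" "\<lambda>b. b \<in> F" "(*)"] B(1) by (simp add: F_def)
  ultimately have finS': "findim Kt S'" unfolding findim_def by blast
  have KS': "Kt \<subseteq> S'" using KS SS' by blast
  have SF': "subfield_set S'"
    unfolding subfield_set_def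
    using S'.one_in S'.diff_in S'.mult_in findim_subring_inverse[OF KF finS' sub KS'] by blast
  have map_in: "poly_in S (map_poly fls_deriv r)" if "poly_in S r" for r
    using that dS by (simp add: poly_in_def coeff_map_poly)
  have pd_in: "poly_in S (pderiv r)" if "poly_in S r" for r
    using that by (auto simp: poly_in_def coeff_pderiv intro!: S.mult_in S.add_in S.one_in S.of_nat_in)
  have f': "fls_deriv f \<in> S'"
  proof -
    have nz: "poly (pderiv m) f \<noteq> 0"
    proof
      assume "poly (pderiv m) f = 0"
      moreover have "pderiv m \<noteq> 0" using d by (simp add: d_def pderiv_eq_0_iff)
      ultimately have "ann (pderiv m)" using pd_in[OF m(1)] by (simp add: ann_def)
      then have "degree m \<le> degree (pderiv m)" by (rule min)
      then show False using d by (simp add: degree_pderiv d_def)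
    qed
    have "poly (map_poly fls_deriv m) f + poly (pderiv m) f * fls_deriv f = 0"
      using fls_deriv_poly[of m f] m(3) by simp
    then have "fls_deriv f = - poly (map_poly fls_deriv m) f / poly (pderiv m) f"
      using nz by (subst eq_divide_eq) (simp add: eq_neg_iff_add_eq_0 mult.commute add.commute)
    then show ?thesis
      using S'I[OF map_in[OF m(1)]] S'I[OF pd_in[OF m(1)]]
      by (auto intro!: subfield_divide[OF SF'] S'.uminus_in)
  qed
  have "fls_deriv x \<in> S'" if x: "x \<in> S'" for x
  proof -
    obtain r where r: "poly_in S r" "x = poly r f" using x by (auto simp: S'_def)
    show ?thesis unfolding r(2) fls_deriv_poly
      by (intro S'.add_in S'.mult_in S'I map_in pd_in r f')
  qed
  then show ?thesis using SF' KS' finS' SS' fS' unfolding dfield_def by blast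
qed

text \<open>
  In a space of finite dimension the powers of \<open>F\<close> are linearly dependent.
\<close>
lemma dfield_imp_algebraic:
  assumes "dfield S" "fps_to_fls F \<in> S"
  shows "algebraic_series F"
proof -
  have SF: "subfield_set S" and fin: "findim Kt S" using assms by (auto simp: dfield_def)
  obtain n d where d: "\<forall>k\<le>n. d k \<in> Kt" "\<exists>k\<le>n. d k \<noteq> 0" "(\<Sum>k\<le>n. d k * fps_to_fls F ^ k) = 0"
    using findim_dependent[OF rat_funs_subfield fin, of "\<lambda>k. fps_to_fls F ^ k"]
      subring_set.power_in[OF subfield_imp_subring[OF SF] assms(2)] by blast
  define p where "p = (\<Sum>k\<le>n. monom (d k) k)"
  have c: "coeff p i = (if i \<le> n then d i else 0)" for i
    by (auto simp: p_def coeff_sum)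
  have "\<forall>i. coeff p i \<in> Kt"
    using d(1) subring_set.zero_in[OF subfield_imp_subring[OF rat_funs_subfield, of "fls_X :: rat fls"]] by (simp add: c)
  moreover have "p \<noteq> 0" using d(2) c by (metis coeff_0)
  moreover have "poly p (fps_to_fls F) = 0" using d(3) by (simp add: p_def poly_sum poly_monom)
  ultimately show ?thesis unfolding algebraic_series_def by blast
qed

text \<open>
  The derivatives of \<open>F\<close> stay in a space of finite dimension, so they are linearly dependent.
\<close>
lemma findim_deriv_imp_D_finite:
  assumes "findim Kt V" "fps_to_fls F \<in> V" "\<And>x. x \<in> V \<Longrightarrow> fls_deriv x \<in> V"
  shows "D_finite F"
proof -
  have "fps_to_fls ((fps_deriv ^^ k) F) \<in> V" for k
    by (induction k) (use assms in \<open>auto simp flip: fls_deriv_fps_to_fls\<close>)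
  then show ?thesis unfolding D_finite_def
    using findim_dependent[OF rat_funs_subfield assms(1), of "\<lambda>k. fps_to_fls ((fps_deriv ^^ k) F)"] by blast
qed

lemma Z_dfield: "\<exists>S. dfield S \<and> Zfld \<subseteq> S"
proof -
  define z where "z = fps_to_fls Z_series"
  interpret K: subring_set Kt by (rule subfield_imp_subring[OF rat_funs_subfield])
  interpret P: subring_set "Collect (poly_in Kt)" by (rule poly_in_subring[OF K.subring_set_axioms])
  define p :: "rat fls poly" where
    "p = ([:0, 1:]^2 - 1) * ([:0, 1:]^2 + 3)^3 - 256 * [:fls_X:]^2 * [:0, 1:]^6"
  have "[:0, 1:] \<in> Collect (poly_in Kt)" "[:fls_X:] \<in> Collect (poly_in Kt)"
    by (auto simp: poly_in_def coeff_pCons K.zero_in K.one_in rat_funs_gen split: nat.splits)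
  then have "p \<in> Collect (poly_in Kt)" unfolding p_def
    by (intro P.diff_in P.mult_in P.power_in P.add_in P.one_in P.numeral_in)
  moreover have "poly p 0 \<noteq> 0" by (simp add: p_def)
  then have "p \<noteq> 0" by auto
  moreover have "poly p z = 0"
  proof -
    have "poly p z = (z^2 - 1) * (z^2 + 3)^3 - 256 * fls_X^2 * z^6" by (simp add: p_def)
    also have "\<dots> = fps_to_fls ((Z_series^2 - 1) * (Z_series^2 + 3)^3 - 256 * fps_X^2 * Z_series^6)"
      unfolding z_def to_fls_simps by simp
    finally show ?thesis unfolding Z_series_equation(2) by simp
  qed
  ultimately obtain S where S: "dfield S" "z \<in> S" using dfield_adjoin[OF dfield_Kt] by blast
  then have "rat_funs z \<subseteq> S"
    using rat_funs_of_rat[of _ "fls_X :: rat fls"] by (intro rat_funs_subset) (auto simp: dfield_def)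
  then show ?thesis using S z_def by blast
qed

section \<open>The quadrant series is D-finite\<close>

text \<open>
  The quotient of two consecutive values of the closed form is rational in \<open>n\<close>. The factors \<open>(N + 2)^2 - s^2\<close> and
  \<open>(N + 2)^2 - (r + 2)^2\<close> are those of \<open>16 (m + 1) (m + i + j + 3) (m + i + 2) (m + j + 2)\<close> with \<open>N = i + j + 2 m + 2\<close>.
\<close>
lemma q_num_rec:
  fixes i j n :: nat
  defines "N \<equiv> of_nat n :: rat" and "s \<equiv> of_nat i - of_nat j :: rat" and "r \<equiv> of_nat i + of_nat j :: rat"
  shows "((N + 2)^2 - s^2) * ((N + 2)^2 - (r + 2)^2) * q_num n i j
    = (if n < 2 then 0 else 16 * ((N - 1) * N * (N + 1) * (N + 2)) * q_num (n - 2) i j)"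
proof (cases "n < i + j \<or> odd (n + i + j)")
  case True
  then have "q_num n i j = 0" by (rule q_num_eq_0)
  moreover have "q_num (n - 2) i j = 0" if "\<not> n < 2" using True that by (intro q_num_eq_0) auto
  ultimately show ?thesis by auto
next
  case False
  then obtain m where n: "n = i + j + 2 * m"
    by (metis add.assoc even_diff_nat evenE le_add_diff_inverse not_less odd_add odd_even_add)
  show ?thesis
  proof (cases m)
    case 0
    have "N = r" using n 0 by (simp add: N_def r_def)
    moreover have "q_num (n - 2) i j = 0" if "\<not> n < 2" using n 0 that by (intro q_num_eq_0) auto
    ultimately show ?thesis by auto
  next
    case (Suc m')
    define k where "k = i + j + 2 * m'"
    have nk: "n = k + 2" using n Suc by (simp add: k_def)
    define M where "M = (of_nat m' :: rat)"
    define W where "W = fact m' * fact (m' + i + j + 2) * fact (m' + i + 1) * (fact (m' + j + 1) :: rat)"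
    define c where "c = (of_nat ((i + 1) * (j + 1)) :: rat)"
    have W: "W \<noteq> 0" by (simp add: W_def)
    have 1: "q_num k i j * W = c * fact k * fact (k + 2)"
      using q_num_fact[of i j m'] by (simp only: W_def k_def c_def)
    have 2: "q_num n i j * (fact m * fact (m + i + j + 2) * fact (m + i + 1) * fact (m + j + 1)) = c * fact n * fact (n + 2)"
      using q_num_fact[of i j m] by (simp only: n c_def)
    have f1: "fact m = (M + 1) * fact m'"
      by (subst fact_pred[of _ m']) (simp_all add: Suc M_def del: fact_Suc)
    have f2: "fact (m + i + j + 2) = (M + r + 3) * fact (m' + i + j + 2)"
      by (subst fact_pred[of _ "m' + i + j + 2"]) (simp_all add: Suc M_def r_def add_ac del: fact_Suc)
    have f3: "fact (m + i + 1) = (M + of_nat i + 2) * fact (m' + i + 1)"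
      by (subst fact_pred[of _ "m' + i + 1"]) (simp_all add: Suc M_def add_ac del: fact_Suc)
    have f4: "fact (m + j + 1) = (M + of_nat j + 2) * fact (m' + j + 1)"
      by (subst fact_pred[of _ "m' + j + 1"]) (simp_all add: Suc M_def add_ac del: fact_Suc)
    have NK: "N = of_nat k + 2" by (simp add: N_def nk)
    have f5: "fact n * fact (n + 2) = ((N - 1) * N * (N + 1) * (N + 2)) * (fact k * (fact (k + 2) :: rat))"
    proof -
      have "fact n = N * (N - 1) * fact k"
        using fact_pred[of n "k + 1"] fact_pred[of "k + 1" k] by (simp add: nk NK del: fact_Suc)
      moreover have "fact (n + 2) = (N + 2) * (N + 1) * fact (k + 2)"
        using fact_pred[of "n + 2" "n + 1"] fact_pred[of "n + 1" "k + 2"] by (simp add: nk NK del: fact_Suc)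
      ultimately show ?thesis by (simp only: mult_ac)
    qed
    have "q_num n i j * ((M + 1) * (M + r + 3) * (M + of_nat i + 2) * (M + of_nat j + 2)) * W
       = ((N - 1) * N * (N + 1) * (N + 2)) * (c * fact k * fact (k + 2))"
      using 2 f5 unfolding f1 f2 f3 f4 W_def by (simp only: mult_ac)
    also have "\<dots> = ((N - 1) * N * (N + 1) * (N + 2)) * q_num k i j * W"
      unfolding 1[symmetric] by (simp only: mult_ac)
    finally have 3: "q_num n i j * ((M + 1) * (M + r + 3) * (M + of_nat i + 2) * (M + of_nat j + 2))
       = ((N - 1) * N * (N + 1) * (N + 2)) * q_num k i j" using W by simp
    have N: "N = r + 2 * M + 2" using n Suc by (simp add: N_def r_def M_def)
    have "((N + 2)^2 - s^2) * ((N + 2)^2 - (r + 2)^2) = 16 * ((M + 1) * (M + r + 3) * (M + of_nat i + 2) * (M + of_nat j + 2))"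
      unfolding N s_def r_def by algebra
    then have "((N + 2)^2 - s^2) * ((N + 2)^2 - (r + 2)^2) * q_num n i j = 16 * (q_num n i j * ((M + 1) * (M + r + 3) * (M + of_nat i + 2) * (M + of_nat j + 2)))"
      by (simp only: mult_ac)
    also have "\<dots> = 16 * ((N - 1) * N * (N + 1) * (N + 2)) * q_num k i j" unfolding 3 by (simp only: mult_ac)
    finally show ?thesis by (simp add: nk)
  qed
qed

text \<open>
  The series \<open>\<theta>^k Q\<close> with the Euler operator \<open>\<theta> = t d/dt\<close>, given by its coefficients.
\<close>
definition Q_euler :: "nat \<Rightarrow> nat \<Rightarrow> nat \<Rightarrow> rat fps" where
  "Q_euler i j k = Abs_fps (\<lambda>n. of_nat n ^ k * q_num n i j)"

lemma Q_euler_0: "Q_euler i j 0 = Q_gf (int i) (int j)"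
  by (rule fps_ext) (simp add: Q_euler_def q_num_def)

lemma Q_euler_Suc: "fps_X * fps_deriv (Q_euler i j k) = Q_euler i j (Suc k)"
proof (rule fps_ext)
  fix n show "(fps_X * fps_deriv (Q_euler i j k)) $ n = Q_euler i j (Suc k) $ n"
    by (cases n) (simp_all add: Q_euler_def)
qed

text \<open>
  The recurrence, with \<open>n\<close> replaced by the Euler operator and the shift by two replaced by \<open>t^2\<close>.
\<close>
lemma Q_euler_equation:
  fixes i j :: nat
  defines "s \<equiv> of_nat i - of_nat j :: rat" and "r \<equiv> of_nat i + of_nat j :: rat"
  defines "e \<equiv> s^2 + (r + 2)^2" and "g \<equiv> s^2 * (r + 2)^2"
  shows "Q_euler i j 4 + fps_const 8 * Q_euler i j 3 + fps_const (24 - e) * Q_euler i j 2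
      + fps_const (32 - 4 * e) * Q_euler i j 1 + fps_const (16 - 4 * e + g) * Q_euler i j 0
    = fps_const 16 * (fps_X ^ 2 * (Q_euler i j 4 + fps_const 10 * Q_euler i j 3 + fps_const 35 * Q_euler i j 2
      + fps_const 50 * Q_euler i j 1 + fps_const 24 * Q_euler i j 0))" (is "?L = ?R")
proof (rule fps_ext)
  fix n
  define N where "N = (of_nat n :: rat)"
  have "?L $ n = ((N + 2)^2 - s^2) * ((N + 2)^2 - (r + 2)^2) * q_num n i j"
    unfolding e_def g_def by (simp add: Q_euler_def N_def[symmetric]) algebra
  also have "\<dots> = ?R $ n"
  proof (cases "n < 2")
    case True
    then show ?thesis using q_num_rec[of n i j] by (simp add: N_def s_def r_def fps_X_power_mult_nth)
  next
    case False
    then have N2: "of_nat (n - 2) = N - 2" by (simp add: N_def of_nat_diff)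
    have "?R $ n = 16 * ((N - 2)^4 + 10 * (N - 2)^3 + 35 * (N - 2)^2 + 50 * (N - 2) + 24) * q_num (n - 2) i j"
      using False by (simp add: fps_X_power_mult_nth Q_euler_def N2) algebra
    also have "\<dots> = 16 * ((N - 1) * N * (N + 1) * (N + 2)) * q_num (n - 2) i j" by algebra
    finally show ?thesis using False q_num_rec[of n i j] by (simp add: N_def s_def r_def)
  qed
  finally show "?L $ n = ?R $ n" .
qed

definition Q_space :: "nat \<Rightarrow> nat \<Rightarrow> rat fls set" where
  "Q_space i j = kspan Kt ((\<lambda>k. fps_to_fls (Q_euler i j k)) ` {..<4})"

lemma Kt_const: "fls_const q \<in> Kt"
  using rat_funs_of_rat[of q "fls_X :: rat fls"] by (simp add: fls_of_rat)

lemma fps_to_fls_const: "fps_to_fls (fps_const q) = fls_const q"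
  by (rule fls_eqI) auto

text \<open>
  The leading coefficient of the differential equation is \<open>1 - 16 t^2\<close>, so \<open>\<theta>^4 Q\<close> is a combination of lower ones.
\<close>
lemma Q_euler_in: "k \<le> 4 \<Longrightarrow> fps_to_fls (Q_euler i j k) \<in> Q_space i j"
proof -
  interpret K: subring_set Kt by (rule subfield_imp_subring[OF rat_funs_subfield])
  define q where "q k = fps_to_fls (Q_euler i j k)" for k
  have low: "q k \<in> Q_space i j" if "k < 4" for k
    unfolding Q_space_def q_def using that by (intro kspan_base[OF rat_funs_subfield]) auto
  have scale: "c * x \<in> Q_space i j" if "x \<in> Q_space i j" "c \<in> Kt" for c x
    using that unfolding Q_space_def by (intro kspan_scale[OF rat_funs_subfield])
  have add: "x + y \<in> Q_space i j" if "x \<in> Q_space i j" "y \<in> Q_space i j" for x y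
    using that unfolding Q_space_def by (rule kspan_add)
  define s r where "s = (of_nat i - of_nat j :: rat)" and "r = (of_nat i + of_nat j :: rat)"
  define e g where "e = s^2 + (r + 2)^2" and "g = s^2 * (r + 2)^2"
  define Y where "Y = (16 * fls_X ^ 2 :: rat fls)"
  have Y: "Y \<in> Kt" unfolding Y_def by (intro K.mult_in K.numeral_in K.power_in rat_funs_gen)
  have c16: "fls_const (16 :: rat) = 16" by simp
  from arg_cong[OF Q_euler_equation[of i j], of fps_to_fls, folded s_def r_def, folded e_def g_def]
  have "q 4 + fls_const 8 * q 3 + fls_const (24 - e) * q 2 + fls_const (32 - 4 * e) * q 1 + fls_const (16 - 4 * e + g) * q 0
    = Y * (q 4 + fls_const 10 * q 3 + fls_const 35 * q 2 + fls_const 50 * q 1 + fls_const 24 * q 0)"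
    unfolding to_fls_simps fps_to_fls_const q_def Y_def c16 fps_X_to_fls by (simp only: mult.assoc)
  then have "(1 - Y) * q 4 = (fls_const 10 * Y - fls_const 8) * q 3 + (fls_const 35 * Y - fls_const (24 - e)) * q 2
     + (fls_const 50 * Y - fls_const (32 - 4 * e)) * q 1 + (fls_const 24 * Y - fls_const (16 - 4 * e + g)) * q 0"
    by algebra
  moreover have nz: "1 - Y \<noteq> 0"
  proof
    assume "1 - Y = 0"
    then have "fls_nth (1 - Y) 0 = 0" by simp
    then show False by (simp add: Y_def fls_X_power_times_conv_shift flip: fls_const_numeral)
  qed
  moreover have "q 4 = inverse (1 - Y) * ((1 - Y) * q 4)"
    unfolding mult.assoc[symmetric] left_inverse[OF nz] by simp
  ultimately have "q 4 = inverse (1 - Y) * ((fls_const 10 * Y - fls_const 8) * q 3 + (fls_const 35 * Y - fls_const (24 - e)) * q 2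
     + (fls_const 50 * Y - fls_const (32 - 4 * e)) * q 1 + (fls_const 24 * Y - fls_const (16 - 4 * e + g)) * q 0)"
    by (simp only:)
  moreover have "\<dots> \<in> Q_space i j"
    by (intro scale add low subfield_inverse[OF rat_funs_subfield] K.diff_in K.mult_in K.one_in Kt_const Y) simp_all
  ultimately have "q 4 \<in> Q_space i j" by (simp only:)
  then show "k \<le> 4 \<Longrightarrow> fps_to_fls (Q_euler i j k) \<in> Q_space i j"
    using low unfolding q_def by (cases "k = 4") auto
qed

lemma fls_deriv_Q_euler: "fls_deriv (fps_to_fls (Q_euler i j k)) = inverse fls_X * fps_to_fls (Q_euler i j (Suc k))"
proof -
  have "fls_X * fls_deriv (fps_to_fls (Q_euler i j k)) = fps_to_fls (Q_euler i j (Suc k))"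
    unfolding Q_euler_Suc[symmetric] fls_deriv_fps_to_fls by (simp add: fls_times_fps_to_fls)
  then have "inverse fls_X * (fls_X * fls_deriv (fps_to_fls (Q_euler i j k))) = inverse fls_X * fps_to_fls (Q_euler i j (Suc k))"
    by (simp only:)
  moreover have "inverse fls_X * (fls_X :: rat fls) = 1" by (rule left_inverse) simp
  ultimately show ?thesis by (simp only: mult.assoc[symmetric] mult_1_left)
qed

lemma Q_space_deriv:
  assumes "x \<in> Q_space i j"
  shows "fls_deriv x \<in> Q_space i j"
  using assms unfolding Q_space_def
proof (induction x rule: kspan.induct)
  case (kspan_step x k b)
  interpret K: subring_set Kt by (rule subfield_imp_subring[OF rat_funs_subfield])
  from \<open>b \<in> _\<close> obtain l where l: "l < 4" "b = fps_to_fls (Q_euler i j l)" by auto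
  have "fls_deriv k \<in> Kt" using dfield_Kt \<open>k \<in> Kt\<close> by (auto simp: dfield_def)
  moreover have "fls_deriv b \<in> Q_space i j"
    unfolding l fls_deriv_Q_euler Q_space_def
    using Q_euler_in[of "Suc l" i j] l(1) unfolding Q_space_def
    by (intro kspan_scale[OF rat_funs_subfield] subfield_inverse[OF rat_funs_subfield] rat_funs_gen) auto
  note d = this calculation
  have "fls_deriv x + (k * fls_deriv b + fls_deriv k * b) \<in> Q_space i j"
    using kspan_add[OF kspan_step.IH kspan_add[OF
        kspan_scale[OF rat_funs_subfield d(1)[unfolded Q_space_def] \<open>k \<in> Kt\<close>]
        kspan_scale[OF rat_funs_subfield kspan_base[OF rat_funs_subfield \<open>b \<in> _\<close>] d(2)]]]
    unfolding Q_space_def .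
  then show ?case unfolding Q_space_def by (simp add: add.commute)
qed (simp add: kspan_0)

text \<open>
  The sum of two spaces of finite dimension that are closed under differentiation is again such a space.
\<close>
lemma quadrant_plus_algebraic_D_finite:
  assumes F: "fps_to_fls F = c * fps_to_fls (Q_gf (int i) (int j)) + a" and c: "c \<in> Kt"
    and S: "dfield S" "a \<in> S"
  shows "D_finite F"
proof (rule findim_deriv_imp_D_finite)
  define V where "V = {x + y | x y. x \<in> Q_space i j \<and> y \<in> S}"
  obtain B where B: "finite B" "S \<subseteq> kspan Kt B" using S by (auto simp: dfield_def findim_def)
  let ?Q = "(\<lambda>k. fps_to_fls (Q_euler i j k)) ` {..<4}"
  have mono: "x \<in> kspan Kt (A \<union> A')" if "x \<in> kspan Kt A \<or> x \<in> kspan Kt A'" for x A A'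
  proof -
    have "x \<in> kspan Kt A \<Longrightarrow> x \<in> kspan Kt (A \<union> A')" for A A'
      by (induction x rule: kspan.induct) (auto intro: kspan.intros)
    then show ?thesis using that by (metis Un_commute)
  qed
  have "V \<subseteq> kspan Kt (?Q \<union> B)"
    using B(2) mono by (auto simp: V_def Q_space_def intro!: kspan_add)
  then show "findim Kt V" unfolding findim_def using B(1) by (intro exI[of _ "?Q \<union> B"]) simp
  have "fps_to_fls (Q_gf (int i) (int j)) \<in> Q_space i j"
    using Q_euler_in[of 0 i j] by (simp add: Q_euler_0)
  then have "c * fps_to_fls (Q_gf (int i) (int j)) \<in> Q_space i j"
    unfolding Q_space_def using c by (rule kspan_scale[OF rat_funs_subfield])
  then show "fps_to_fls F \<in> V" unfolding F V_def using S(2) by blast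
  show "fls_deriv x \<in> V" if "x \<in> V" for x
  proof -
    obtain y z where yz: "x = y + z" "y \<in> Q_space i j" "z \<in> S" using \<open>x \<in> V\<close> unfolding V_def by blast
    then have "fls_deriv x = fls_deriv y + fls_deriv z" by simp
    moreover have "fls_deriv z \<in> S" using S(1) yz(3) by (simp add: dfield_def)
    ultimately show ?thesis unfolding V_def using Q_space_deriv[OF yz(2)] by blast
  qed
qed

section \<open>Growth of the quadrant numbers\<close>

text \<open>
  Binomial coefficients grow along every path in Pascal's triangle that moves down.
\<close>
lemma binomial_shift_mono: "b \<le> a \<Longrightarrow> N choose k \<le> (N + a) choose (k + b)"
proof (induction a arbitrary: b)
  case (Suc a)
  show ?case
  proof (cases b)
    case 0
    have "N choose k \<le> (N + a) choose k" using Suc.IH[of 0] by simp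
    also have "\<dots> \<le> Suc (N + a) choose k" by (cases k) auto
    finally show ?thesis using 0 by simp
  next
    case (Suc b')
    have "N choose k \<le> (N + a) choose (k + b')" using Suc.IH[of b'] Suc.prems Suc by simp
    also have "\<dots> \<le> Suc (N + a) choose Suc (k + b')" by simp
    finally show ?thesis using Suc by simp
  qed
qed simp

lemma central_binomial_step:
  "(real m + 1) * real ((2 * Suc m) choose Suc m) = 2 * (2 * real m + 1) * real ((2 * m) choose m)"
proof -
  have 1: "real ((2 * m) choose m) = fact (2 * m) / (fact m * fact m)"
    using binomial_fact[of m "2 * m"] by simp
  have "real ((2 * Suc m) choose Suc m) = fact (2 * Suc m) / (fact (Suc m) * fact (Suc m))"
    using binomial_fact[of "Suc m" "2 * Suc m"] by simp
  also have "\<dots> = (2 * real m + 2) * (2 * real m + 1) * fact (2 * m) / ((real m + 1)^2 * (fact m * fact m))"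
    by (simp add: power2_eq_square algebra_simps)
  also have "\<dots> = (2 * real m + 2) * (2 * real m + 1) / (real m + 1)^2 * real ((2 * m) choose m)"
    unfolding 1 by simp
  also have "(2 * real m + 2) * (2 * real m + 1) / (real m + 1)^2 = 2 * (2 * real m + 1) / (real m + 1)"
    by (simp add: power2_eq_square divide_simps) (simp add: algebra_simps)
  finally show ?thesis by (simp add: field_simps)
qed

text \<open>
  Both quantities are monotone in \<open>m\<close> after division by \<open>16^m\<close>; the bounds say that \<open>binomial (2 m) m\<close> has the order
  \<open>4^m / sqrt m\<close>.
\<close>
lemma central_binomial_bounds:
  "real ((2 * m) choose m)^2 * (2 * real m + 1) \<le> 16 ^ m"
  "m \<ge> 1 \<Longrightarrow> 16 ^ m \<le> 4 * real m * real ((2 * m) choose m)^2"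
proof -
  have step: "real ((2 * Suc m) choose Suc m)^2 = 4 * (2 * real m + 1)^2 / (real m + 1)^2 * real ((2 * m) choose m)^2" for m
  proof -
    have "c'^2 = 4 * (2 * x + 1)^2 / (x + 1)^2 * c^2" if "(x + 1) * c' = 2 * (2 * x + 1) * c" "x + 1 \<noteq> 0" for x c c' :: real
    proof -
      have "c' = 2 * (2 * x + 1) * c / (x + 1)" using that by (subst eq_divide_eq) (simp add: mult.commute)
      then show ?thesis by (simp only: power_divide power_mult_distrib) simp
    qed
    from this[OF central_binomial_step[of m]] show ?thesis by simp
  qed
  show "real ((2 * m) choose m)^2 * (2 * real m + 1) \<le> 16 ^ m"
  proof (induction m)
    case (Suc m)
    have "real ((2 * Suc m) choose Suc m)^2 * (2 * real (Suc m) + 1)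
       = (4 * (2 * real m + 1) * (2 * real m + 3) / (real m + 1)^2) * (real ((2 * m) choose m)^2 * (2 * real m + 1))"
      unfolding step by (simp add: power2_eq_square algebra_simps)
    also have "\<dots> \<le> 16 * 16 ^ m"
    proof (rule mult_mono)
      show "4 * (2 * real m + 1) * (2 * real m + 3) / (real m + 1)^2 \<le> 16"
        by (simp add: divide_simps power2_eq_square algebra_simps not_less add_nonneg_nonneg)
    qed (use Suc in auto)
    finally show ?case by simp
  qed simp
  show "16 ^ m \<le> 4 * real m * real ((2 * m) choose m)^2" if "m \<ge> 1"
    using that
  proof (induction m rule: nat_induct_at_least)
    case base
    then show ?case by (simp add: numeral_2_eq_2)
  next
    case (Suc m)
    have "16 * 16 ^ m \<le> ((2 * real m + 1)^2 * 4 / ((real m + 1) * real m)) * (4 * real m * real ((2 * m) choose m)^2)"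
    proof (rule mult_mono)
      have "real m + real m * real m > 0" using Suc.hyps by (simp add: add_pos_nonneg)
      then show "16 \<le> (2 * real m + 1)^2 * 4 / ((real m + 1) * real m)"
        using Suc.hyps by (simp add: divide_simps power2_eq_square algebra_simps)
    qed (use Suc in auto)
    also have "\<dots> = 4 * real (Suc m) * real ((2 * Suc m) choose Suc m)^2"
    proof -
      have "(2 * x + 1)^2 * 4 / ((x + 1) * x) * (4 * x * B) = 4 * (x + 1) * (4 * (2 * x + 1)^2 / (x + 1)^2 * B)"
        if "x > 0" for x B :: real
      proof -
        have "(2 * x + 1)^2 * 4 / ((x + 1) * x) * (4 * x * B) = 16 * (2 * x + 1)^2 * B / (x + 1)"
          using that by simp
        also have "\<dots> = 4 * (x + 1) * (4 * (2 * x + 1)^2 / (x + 1)^2 * B)"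
        proof -
          have "16 * c * B / w = 4 * w * (4 * c / w^2 * B)" if "w \<noteq> 0" for w c :: real
            using that by (simp add: field_simps power2_eq_square)
          from this[of "x + 1" "(2 * x + 1)^2"] show ?thesis using \<open>x > 0\<close> by simp
        qed
        finally show ?thesis .
      qed
      from this[of "real m"] show ?thesis unfolding step using Suc.hyps by (simp add: add.commute)
    qed
    finally show ?case by simp
  qed
qed

lemma q_num_binomial:
  "q_num (i + j + 2 * m) i j * (of_nat (i + j + 2 * m + 1) * of_nat (i + j + 2 * m + 2))
    = of_nat ((i + 1) * (j + 1)) * of_nat ((i + j + 2 * m + 2) choose m) * of_nat ((i + j + 2 * m + 2) choose (m + i + 1))"
proof -
  define n where "n = i + j + 2 * m"
  define W where "W = fact m * fact (m + i + j + 2) * fact (m + i + 1) * (fact (m + j + 1) :: rat)"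
  have W: "W \<noteq> 0" by (simp add: W_def)
  have b1: "of_nat ((n + 2) choose m) * (fact m * fact (m + i + j + 2)) = (fact (n + 2) :: rat)"
  proof -
    have "n + 2 - m = m + i + j + 2" "m \<le> n + 2" by (simp_all add: n_def)
    then show ?thesis using binomial_fact[of m "n + 2", where 'a = rat] by (simp del: fact_Suc)
  qed
  have b2: "of_nat ((n + 2) choose (m + i + 1)) * (fact (m + i + 1) * fact (m + j + 1)) = (fact (n + 2) :: rat)"
  proof -
    have "n + 2 - (m + i + 1) = m + j + 1" "m + i + 1 \<le> n + 2" by (simp_all add: n_def)
    then show ?thesis using binomial_fact[of "m + i + 1" "n + 2", where 'a = rat] by (simp del: fact_Suc)
  qed
  have f: "fact (n + 2) = of_nat (n + 1) * of_nat (n + 2) * (fact n :: rat)"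
    using fact_pred[of "n + 2" "n + 1"] fact_pred[of "n + 1" n] by (simp only: mult_ac) simp
  have "q_num n i j * (of_nat (n + 1) * of_nat (n + 2)) * W
    = (of_nat ((i + 1) * (j + 1)) * fact n * fact (n + 2)) * (of_nat (n + 1) * of_nat (n + 2))"
  proof -
    have "q_num n i j * W = of_nat ((i + 1) * (j + 1)) * fact n * fact (n + 2)"
      using q_num_fact[of i j m] unfolding n_def[symmetric] W_def[symmetric] .
    then have "(q_num n i j * W) * (of_nat (n + 1) * of_nat (n + 2)) = (of_nat ((i + 1) * (j + 1)) * fact n * fact (n + 2)) * (of_nat (n + 1) * of_nat (n + 2))"
      by (simp only:)
    then show ?thesis by (simp only: mult_ac)
  qed
  also have "\<dots> = of_nat ((i + 1) * (j + 1)) * fact (n + 2) * (of_nat (n + 1) * of_nat (n + 2) * fact n)"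
    by (simp only: mult_ac)
  also have "\<dots> = of_nat ((i + 1) * (j + 1)) * (of_nat ((n + 2) choose m) * (fact m * fact (m + i + j + 2)))
     * (of_nat ((n + 2) choose (m + i + 1)) * (fact (m + i + 1) * fact (m + j + 1)))"
    unfolding b1 b2 f[symmetric] ..
  also have "\<dots> = of_nat ((i + 1) * (j + 1)) * of_nat ((n + 2) choose m) * of_nat ((n + 2) choose (m + i + 1)) * W"
    by (simp only: W_def mult_ac)
  finally show ?thesis using W unfolding n_def by simp
qed

text \<open>
  The coefficients of \<open>\<theta>^2 Q\<close>. Those of \<open>Q\<close> behave like \<open>4^n / n^3\<close>; two applications of the Euler operator bring
  them to the order \<open>4^n / n\<close>, which produces a logarithm.
\<close>
definition q_real :: "nat \<Rightarrow> nat \<Rightarrow> nat \<Rightarrow> real" where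
  "q_real i j n = real_of_rat (of_nat n ^ 2 * q_num n i j)"

text \<open>
  Both binomial coefficients in the closed form lie between the central ones with parameters \<open>m\<close> and
  \<open>m + i + j + 2\<close>, whose squares are of the order \<open>16^m / m\<close>.
\<close>
lemma q_real_bounds:
  fixes i j m :: nat
  defines "n \<equiv> i + j + 2 * m"
  shows "m \<ge> 1 \<Longrightarrow> 16 ^ m / real m / 24 \<le> q_real i j n"
    and "m \<ge> 1 \<Longrightarrow> q_real i j n \<le> real ((i + 1) * (j + 1)) * 16 ^ (i + j + 2) * (16 ^ m / real m)"
    and "q_real i j n \<ge> 0"
proof -
  define b where "b = real ((n + 2) choose m) * real ((n + 2) choose (m + i + 1))"
  define a where "a = real ((i + 1) * (j + 1))"
  define f where "f = real n ^ 2 / (real (n + 1) * real (n + 2))"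
  have q: "q_real i j n = f * a * b"
  proof -
    have "real_of_rat (q_num n i j) * (real (n + 1) * real (n + 2)) = a * b"
      using arg_cong[OF q_num_binomial[of i j m], of real_of_rat]
      unfolding n_def[symmetric] of_rat_mult of_rat_of_nat_eq a_def b_def by (simp only: mult.assoc)
    then have "real_of_rat (q_num n i j) = a * b / (real (n + 1) * real (n + 2))"
      by (subst eq_divide_eq) auto
    then show ?thesis by (simp add: q_real_def of_rat_mult of_rat_power f_def)
  qed
  have a1: "a \<ge> 1" by (simp add: a_def)
  have b0: "b \<ge> 0" by (simp add: b_def)
  have f0: "f \<ge> 0" by (simp add: f_def)
  show "q_real i j n \<ge> 0" unfolding q using a1 b0 f0 by simp
  have f1: "f \<le> 1" by (simp add: f_def divide_simps power2_eq_square algebra_simps not_less add_nonneg_nonneg)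
  define M where "M = m + (i + j + 2)"
  have up: "b \<le> real ((2 * M) choose M)^2"
  proof -
    have "(n + 2) choose m \<le> (2 * M) choose M"
      using binomial_shift_mono[of "i + j + 2" "i + j + 2" "n + 2" m] by (simp add: n_def M_def algebra_simps)
    moreover have "(n + 2) choose (m + i + 1) \<le> (2 * M) choose M"
      using binomial_shift_mono[of "j + 1" "i + j + 2" "n + 2" "m + i + 1"] by (simp add: n_def M_def algebra_simps)
    ultimately show ?thesis unfolding b_def power2_eq_square by (intro mult_mono) auto
  qed
  have lo: "real ((2 * m) choose m)^2 \<le> b"
  proof -
    have "(2 * m) choose m \<le> (n + 2) choose m"
      using binomial_shift_mono[of 0 "i + j + 2" "2 * m" m] by (simp add: n_def algebra_simps)
    moreover have "(2 * m) choose m \<le> (n + 2) choose (m + i + 1)"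
      using binomial_shift_mono[of "i + 1" "i + j + 2" "2 * m" m] by (simp add: n_def algebra_simps)
    ultimately show ?thesis unfolding b_def power2_eq_square by (intro mult_mono) auto
  qed
  show "16 ^ m / real m / 24 \<le> q_real i j n" if m: "m \<ge> 1"
  proof -
    have "n \<ge> 1" using m by (simp add: n_def)
    then have n1: "real n \<ge> 1" by simp
    have "1 / 6 \<le> f"
    proof -
      have "real n * 1 \<le> real n * real n" using n1 by (intro mult_left_mono) auto
      then have "real n \<le> real n * real n" by simp
      then have "2 + 3 * real n \<le> 5 * (real n * real n)" using n1 by linarith
      then show ?thesis by (simp add: f_def divide_simps power2_eq_square algebra_simps)
    qed
    moreover have "16 ^ m / (4 * real m) \<le> b"
    proof -
      have "16 ^ m / (4 * real m) \<le> real ((2 * m) choose m)^2"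
        using central_binomial_bounds(2)[OF m] m by (simp add: divide_simps mult_ac)
      then show ?thesis using lo by linarith
    qed
    ultimately have "(1 / 6) * (1 * (16 ^ m / (4 * real m))) \<le> f * (a * b)"
      using a1 f0 b0 by (intro mult_mono) auto
    then show ?thesis unfolding q by (simp add: mult.assoc)
  qed
  show "q_real i j n \<le> real ((i + 1) * (j + 1)) * 16 ^ (i + j + 2) * (16 ^ m / real m)" if m: "m \<ge> 1"
  proof -
    have "real ((2 * M) choose M)^2 \<le> 16 ^ M / (2 * real M + 1)"
      using central_binomial_bounds(1)[of M] by (simp add: divide_simps)
    also have "\<dots> \<le> 16 ^ M / real m"
      using m by (intro divide_left_mono) (auto simp: M_def)
    finally have "b \<le> 16 ^ M / real m" using up by linarith
    then have "f * (a * b) \<le> 1 * (a * (16 ^ M / real m))"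
      using f1 f0 a1 b0 by (intro mult_mono) auto
    then show ?thesis unfolding q a_def[symmetric] by (simp add: M_def power_add mult_ac)
  qed
qed

definition q_fps :: "nat \<Rightarrow> nat \<Rightarrow> real fps" where
  "q_fps i j = Abs_fps (q_real i j)"

text \<open>
  Summation of the bounds: the series of \<open>y^m / m\<close> with \<open>y = 16 x^2\<close> is \<open>- ln (1 - y)\<close>. The term with \<open>m = 0\<close>
  has no bound of this form and is kept separately.
\<close>
lemma q_fps_growth:
  fixes i j :: nat and x :: real
  assumes x: "0 < x" "x < 1 / 4"
  defines "L \<equiv> - ln (1 - 16 * x ^ 2)"
  defines "A \<equiv> real ((i + 1) * (j + 1)) * 16 ^ (i + j + 2)"
  shows "summable (\<lambda>n. q_real i j n * x ^ n)"
    and "x ^ (i + j) / 24 * L \<le> eval_fps (q_fps i j) x" and "eval_fps (q_fps i j) x \<le> q_real i j (i + j) + A * L"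
proof -
  define y where "y = 16 * x ^ 2"
  define r where "r = i + j"
  have y: "0 < y" "y < 1"
  proof -
    have "x ^ 2 < (1/4) ^ 2" using x by (intro power_strict_mono) auto
    then show "y < 1" by (simp add: y_def power2_eq_square)
    show "0 < y" using x by (simp add: y_def)
  qed
  have L: "(\<lambda>m. y ^ m / real m) sums L"
    using sums_minus[OF ln_series'[of "- y"]] y by (simp add: L_def y_def)
  define trm where "trm m = q_real i j (r + 2 * m) * x ^ (r + 2 * m)" for m
  have xy: "16 ^ m * x ^ (r + 2 * m) = x ^ r * y ^ m" for m
    by (simp add: y_def power_add power_mult power_mult_distrib)
  have trm0: "trm m \<ge> 0" for m
    using q_real_bounds(3)[of i j m] x by (simp add: trm_def r_def)
  have lo: "x ^ r / 24 * (y ^ m / real m) \<le> trm m" for m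
  proof (cases "m = 0")
    case False
    have "16 ^ m / real m / 24 * x ^ (r + 2 * m) \<le> trm m"
      unfolding trm_def using q_real_bounds(1)[of m i j] False x by (intro mult_right_mono) (auto simp: r_def)
    then show ?thesis using xy[of m] by (simp add: field_simps)
  qed (use trm0 in simp)
  have A0: "A \<ge> 0" by (simp add: A_def)
  have xr: "x ^ r \<le> 1" "0 \<le> x ^ r" using x by (auto simp: power_le_one)
  (* For m = 0 the summand y^m / m is 0 by the convention for division. *)
  have up: "trm m \<le> A * (y ^ m / real m) + (if m = 0 then q_real i j r else 0)" for m
  proof (cases "m = 0")
    case False
    have "trm m \<le> A * (16 ^ m / real m) * x ^ (r + 2 * m)"
      unfolding trm_def using q_real_bounds(2)[of m i j] False x by (intro mult_right_mono) (auto simp: r_def A_def)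
    also have "\<dots> = A * (y ^ m / real m) * x ^ r" using xy[of m] by (simp add: field_simps)
    also have "\<dots> \<le> A * (y ^ m / real m)" using xr A0 y by (intro mult_left_le) auto
    finally show ?thesis using False by simp
  next
    case True
    have "q_real i j r * x ^ r \<le> q_real i j r" using q_real_bounds(3)[of i j 0] xr by (intro mult_left_le) (auto simp: r_def)
    then show ?thesis using True by (simp add: trm_def)
  qed
  have up_sums: "(\<lambda>m. A * (y ^ m / real m) + (if m = 0 then q_real i j r else 0)) sums (A * L + q_real i j r)"
    by (intro sums_add sums_mult L sums_single[of 0 "\<lambda>_. q_real i j r", simplified])
  have trm_summable: "summable trm"
    by (rule summable_comparison_test'[OF sums_summable[OF up_sums], of 0]) (use up trm0 in auto)
  have zero: "q_real i j n * x ^ n = 0" if "n \<notin> range (\<lambda>m. r + 2 * m)" for n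
  proof -
    have "n < i + j \<or> odd (n + i + j)"
    proof (rule ccontr)
      assume "\<not> ?thesis"
      then have "r \<le> n" "even (n + r)" by (auto simp: r_def add.assoc)
      then have "even (n - r)" by simp
      then obtain m where "n - r = 2 * m" by (rule evenE)
      then have "n = r + 2 * m" using \<open>r \<le> n\<close> by simp
      then show False using that by blast
    qed
    then show ?thesis by (simp add: q_real_def q_num_eq_0)
  qed
  have mono: "strict_mono (\<lambda>m. r + 2 * m)" by (auto simp: strict_mono_def)
  have sums: "(\<lambda>n. q_real i j n * x ^ n) sums suminf trm"
    using sums_mono_reindex[OF mono, of "\<lambda>n. q_real i j n * x ^ n" "suminf trm", OF zero]
      summable_sums[OF trm_summable] unfolding trm_def by blast
  then show "summable (\<lambda>n. q_real i j n * x ^ n)" by (rule sums_summable)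
  have ev: "eval_fps (q_fps i j) x = suminf trm"
    using sums_unique[OF sums] by (simp add: eval_fps_def q_fps_def)
  have "x ^ r / 24 * L \<le> suminf trm"
    using sums_le[OF lo sums_mult[OF L] summable_sums[OF trm_summable]] .
  then show "x ^ (i + j) / 24 * L \<le> eval_fps (q_fps i j) x" by (simp add: ev r_def)
  have "suminf trm \<le> A * L + q_real i j r"
    using sums_le[OF up summable_sums[OF trm_summable] up_sums] .
  then show "eval_fps (q_fps i j) x \<le> q_real i j (i + j) + A * L" by (simp add: ev r_def)
qed

lemma q_fps_conv_radius:
  assumes "0 < x" "x < 1 / 4"
  shows "ereal x < fps_conv_radius (q_fps i j)"
proof -
  define x' where "x' = (x + 1/4) / 2"
  have x': "x < x'" "x' < 1/4" using assms by (auto simp: x'_def)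
  then have "summable (\<lambda>n. fps_nth (q_fps i j) n * x' ^ n)"
    using q_fps_growth(1)[of x' i j] assms by (simp add: q_fps_def)
  then have "ereal (norm x') \<le> fps_conv_radius (q_fps i j)"
    unfolding fps_conv_radius_def by (rule conv_radius_geI)
  then show ?thesis using x' assms by (simp add: less_le_trans[of "ereal x" "ereal x'"])
qed

text \<open>
  Logarithmic growth: the value becomes infinite, but every power of it is killed by a simple zero.
\<close>
lemma q_fps_limits:
  "filterlim (eval_fps (q_fps i j)) at_top (at_left (1/4))"
  "((\<lambda>x. (1/4 - x) * eval_fps (q_fps i j) x ^ k) \<longlongrightarrow> 0) (at_left (1/4))"
proof -
  define L where "L x = - ln (1 - 16 * x ^ 2)" for x :: real
  have z: "filterlim (\<lambda>x. 1 - 16 * x ^ 2) (at_right 0) (at_left (1/4 :: real))"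
    unfolding filterlim_at
  proof
    show "\<forall>\<^sub>F x in at_left (1/4 :: real). 1 - 16 * x\<^sup>2 \<in> {0<..} \<and> 1 - 16 * x\<^sup>2 \<noteq> 0"
    proof (rule eventually_at_leftI[of 0])
      fix x :: real assume x: "x \<in> {0<..<1/4}"
      then have "x ^ 2 < (1/4) ^ 2" by (intro power_strict_mono) auto
      then show "1 - 16 * x\<^sup>2 \<in> {0<..} \<and> 1 - 16 * x\<^sup>2 \<noteq> 0" by (simp add: power2_eq_square)
    qed simp
    have "((\<lambda>x. 1 - 16 * x ^ 2) \<longlongrightarrow> 1 - 16 * (1/4) ^ 2) (at_left (1/4 :: real))"
      by (intro tendsto_intros)
    then show "((\<lambda>x. 1 - 16 * x ^ 2) \<longlongrightarrow> 0) (at_left (1/4 :: real))" by (simp add: power2_eq_square)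
  qed
  have "filterlim (\<lambda>z. - ln z) at_top (at_right (0 :: real))" by real_asymp
  from filterlim_compose[OF this z] have Ltop: "filterlim L at_top (at_left (1/4))" unfolding L_def .
  have ev: "eventually (\<lambda>x. x \<in> {1/8<..<1/4}) (at_left (1/4 :: real))"
    by (rule eventually_at_leftI[of "1/8"]) auto
  have "filterlim (\<lambda>x. (1/8) ^ (i + j) / 24 * L x) at_top (at_left (1/4))"
    by (rule filterlim_tendsto_pos_mult_at_top[OF tendsto_const _ Ltop]) simp
  moreover have L0: "eventually (\<lambda>x. L x \<ge> 1) (at_left (1/4))"
    using Ltop by (simp add: filterlim_at_top)
  have "eventually (\<lambda>x. (1/8) ^ (i + j) / 24 * L x \<le> eval_fps (q_fps i j) x) (at_left (1/4))"
    using ev L0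
  proof eventually_elim
    case (elim x)
    have "(1/8) ^ (i + j) / 24 * L x \<le> x ^ (i + j) / 24 * L x"
      using elim by (intro mult_right_mono divide_right_mono power_mono) auto
    also have "\<dots> \<le> eval_fps (q_fps i j) x" using q_fps_growth(2)[of x i j] elim by (simp add: L_def)
    finally show ?case .
  qed
  ultimately show "filterlim (eval_fps (q_fps i j)) at_top (at_left (1/4))"
    by (rule filterlim_at_top_mono)
  define A where "A = real ((i + 1) * (j + 1)) * 16 ^ (i + j + 2)"
  define C where "C = q_real i j (i + j) + A"
  have q0: "q_real i j (i + j) \<ge> 0" using q_real_bounds(3)[of i j 0] by simp
  have "((\<lambda>x. (1/4 - x) * L x ^ k) \<longlongrightarrow> 0) (at_left (1/4))"
  proof -
    have "((\<lambda>z. z * (- ln z) ^ k) \<longlongrightarrow> 0) (at_right (0 :: real))" by real_asymp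
    from filterlim_compose[OF this z]
    have "((\<lambda>x. (1 - 16 * x ^ 2) * L x ^ k * (1 / (4 * (1 + 4 * x)))) \<longlongrightarrow> 0 * (1 / (4 * (1 + 4 * (1/4))))) (at_left (1/4))"
      unfolding L_def by (intro tendsto_intros) auto
    then have "((\<lambda>x. (1 - 16 * x ^ 2) * L x ^ k * (1 / (4 * (1 + 4 * x)))) \<longlongrightarrow> 0) (at_left (1/4))" by simp
    then show ?thesis
    proof (rule Lim_transform_eventually)
      show "\<forall>\<^sub>F x in at_left (1/4). (1 - 16 * x ^ 2) * L x ^ k * (1 / (4 * (1 + 4 * x))) = (1/4 - x) * L x ^ k"
        using ev
      proof eventually_elim
        case (elim x)
        have "1 - 16 * x ^ 2 = (1/4 - x) * (4 * (1 + 4 * x))" by (simp add: algebra_simps power2_eq_square)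
        then show ?case using elim by simp
      qed
    qed
  qed
  then have "((\<lambda>x. C ^ k * ((1/4 - x) * L x ^ k)) \<longlongrightarrow> C ^ k * 0) (at_left (1/4))"
    by (intro tendsto_intros)
  then have lim: "((\<lambda>x. C ^ k * ((1/4 - x) * L x ^ k)) \<longlongrightarrow> 0) (at_left (1/4))" by simp
  show "((\<lambda>x. (1/4 - x) * eval_fps (q_fps i j) x ^ k) \<longlongrightarrow> 0) (at_left (1/4))"
  proof (rule tendsto_sandwich[OF _ _ tendsto_const lim])
    have *: "eventually (\<lambda>x. 0 \<le> eval_fps (q_fps i j) x \<and> eval_fps (q_fps i j) x \<le> C * L x) (at_left (1/4))"
      using ev L0
    proof eventually_elim
      case (elim x)
      have "0 \<le> x ^ (i + j) / 24 * L x" using elim by simp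
      then have "0 \<le> eval_fps (q_fps i j) x" using q_fps_growth(2)[of x i j] elim by (simp add: L_def)
      moreover have "q_real i j (i + j) * 1 \<le> q_real i j (i + j) * L x" using elim q0 by (intro mult_left_mono) auto
      then have "q_real i j (i + j) + A * L x \<le> C * L x" by (simp add: C_def distrib_right)
      then have "eval_fps (q_fps i j) x \<le> C * L x"
        using q_fps_growth(3)[of x i j] elim by (simp add: L_def A_def)
      ultimately show ?case by simp
    qed
    from * ev show "eventually (\<lambda>x. 0 \<le> (1/4 - x) * eval_fps (q_fps i j) x ^ k) (at_left (1/4))"
      by eventually_elim auto
    from * ev show "eventually (\<lambda>x. (1/4 - x) * eval_fps (q_fps i j) x ^ k \<le> C ^ k * ((1/4 - x) * L x ^ k)) (at_left (1/4))"
    proof eventually_elim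
      case (elim x)
      have "eval_fps (q_fps i j) x ^ k \<le> (C * L x) ^ k" using elim by (intro power_mono) auto
      then have "(1/4 - x) * eval_fps (q_fps i j) x ^ k \<le> (1/4 - x) * (C * L x) ^ k"
        using elim by (intro mult_left_mono) auto
      then show ?case by (simp add: power_mult_distrib mult_ac)
    qed
  qed
qed

section \<open>Transcendence of the quadrant series\<close>

lemma tendsto_poly_at_left: "((\<lambda>x. poly p x) \<longlongrightarrow> poly p c) (at_left (c :: real))"
proof -
  have "isCont (\<lambda>x. poly p x) c" by simp
  then have "((\<lambda>x. poly p x) \<longlongrightarrow> poly p c) (at c)" by (simp add: isCont_def)
  then show ?thesis by (rule tendsto_mono[rotated]) (rule at_le, simp)
qed

text \<open>
  After division by the common power of \<open>x - c\<close> some coefficient does not vanish at \<open>c\<close>; let \<open>I\<close> be the largest such index.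
  In the relation divided by \<open>G^I\<close>, the lower terms tend to 0 since \<open>G\<close> tends to infinity, the higher terms tend to 0 since their
  coefficients have a zero at \<open>c\<close>, and the term with index \<open>I\<close> has a nonzero limit.
\<close>
lemma no_polynomial_relation_at_log_singularity:
  fixes G :: "real \<Rightarrow> real" and a :: "nat \<Rightarrow> real poly"
  assumes top: "filterlim G at_top (at_left c)"
    and small: "\<And>k. ((\<lambda>x. (c - x) * G x ^ k) \<longlongrightarrow> 0) (at_left c)"
    and nz: "k0 \<le> N" "a k0 \<noteq> 0"
    and rel: "eventually (\<lambda>x. (\<Sum>k\<le>N. poly (a k) x * G x ^ k) = 0) (at_left c)"
  shows False
proof -
  define e where "e = Min (order c ` a ` {k. k \<le> N \<and> a k \<noteq> 0})"
  have fin: "finite {k. k \<le> N \<and> a k \<noteq> 0}" by simp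
  have "e \<in> order c ` a ` {k. k \<le> N \<and> a k \<noteq> 0}"
    unfolding e_def using nz by (intro Min_in) auto
  then obtain k1 where k1: "k1 \<le> N" "a k1 \<noteq> 0" "order c (a k1) = e" by auto
  have "\<exists>b. a k = [:- c, 1:] ^ e * b" if "k \<le> N" for k
  proof (cases "a k = 0")
    case False
    then have "e \<le> order c (a k)" unfolding e_def using that by (intro Min_le) auto
    then have "[:- c, 1:] ^ e dvd a k" by (simp add: order_divides)
    then show ?thesis by (auto simp: dvd_def)
  qed (intro exI[of _ 0], simp)
  then obtain b where b: "\<And>k. k \<le> N \<Longrightarrow> a k = [:- c, 1:] ^ e * b k" by metis
  have bk1: "poly (b k1) c \<noteq> 0"
  proof
    assume "poly (b k1) c = 0"
    then have "[:- c, 1:] dvd b k1" by (simp add: poly_eq_0_iff_dvd)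
    then have "[:- c, 1:] ^ e * [:- c, 1:] dvd a k1" using b[OF k1(1)] by (metis mult_dvd_mono dvd_refl)
    then have "[:- c, 1:] ^ Suc e dvd a k1" by (simp only: power_Suc2)
    then show False using k1 by (simp only: order_divides) simp
  qed
  have left: "eventually (\<lambda>x. x < c) (at_left c)"
    by (rule eventually_at_leftI[of "c - 1"]) auto
  have pos: "eventually (\<lambda>x. G x > 0) (at_left c)"
    using top by (simp add: filterlim_at_top_dense)
  define I where "I = Max {k. k \<le> N \<and> poly (b k) c \<noteq> 0}"
  have "I \<in> {k. k \<le> N \<and> poly (b k) c \<noteq> 0}" unfolding I_def using k1 bk1 by (intro Max_in) auto
  then have I: "I \<le> N" "poly (b I) c \<noteq> 0" by auto
  have above: "poly (b k) c = 0" if "I < k" "k \<le> N" for k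
  proof (rule ccontr)
    assume "poly (b k) c \<noteq> 0"
    then have "k \<le> I" unfolding I_def using that by (intro Max_ge) auto
    then show False using that by simp
  qed
  have lim: "((\<lambda>x. poly (b k) x * G x ^ k / G x ^ I) \<longlongrightarrow> (if k = I then poly (b I) c else 0)) (at_left c)"
    if k: "k \<le> N" for k
  proof (cases k I rule: linorder_cases)
    case less
    have "((\<lambda>x. poly (b k) x * inverse (G x) ^ (I - k)) \<longlongrightarrow> poly (b k) c * 0 ^ (I - k)) (at_left c)"
      by (intro tendsto_mult tendsto_power tendsto_poly_at_left tendsto_inverse_0_at_top[OF top])
    then have "((\<lambda>x. poly (b k) x * inverse (G x) ^ (I - k)) \<longlongrightarrow> (if k = I then poly (b I) c else 0)) (at_left c)"
      using less by (simp add: power_0_left)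
    then show ?thesis
    proof (rule Lim_transform_eventually)
      show "eventually (\<lambda>x. poly (b k) x * inverse (G x) ^ (I - k) = poly (b k) x * G x ^ k / G x ^ I) (at_left c)"
        using pos
      proof eventually_elim
        case (elim x)
        then have "G x ^ I = G x ^ k * G x ^ (I - k)" using less by (simp flip: power_add)
        then show ?case using elim by (simp add: power_inverse field_simps)
      qed
    qed
  next
    case equal
    have "eventually (\<lambda>x. poly (b k) x = poly (b k) x * G x ^ k / G x ^ I) (at_left c)"
      using pos by eventually_elim (use equal in simp)
    with tendsto_poly_at_left[of "b k" c] show ?thesis
      using equal by (auto intro: Lim_transform_eventually)
  next
    case greater
    obtain r where r: "b k = [:- c, 1:] * r" using above[OF greater k] by (auto simp: poly_eq_0_iff_dvd)
    have "((\<lambda>x. - poly r x * ((c - x) * G x ^ (k - I))) \<longlongrightarrow> - poly r c * 0) (at_left c)"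
      by (intro tendsto_mult tendsto_minus tendsto_poly_at_left small)
    then have "((\<lambda>x. - poly r x * ((c - x) * G x ^ (k - I))) \<longlongrightarrow> (if k = I then poly (b I) c else 0)) (at_left c)"
      using greater by simp
    then show ?thesis
    proof (rule Lim_transform_eventually)
      show "eventually (\<lambda>x. - poly r x * ((c - x) * G x ^ (k - I)) = poly (b k) x * G x ^ k / G x ^ I) (at_left c)"
        using pos
      proof eventually_elim
        case (elim x)
        then have "G x ^ k = G x ^ I * G x ^ (k - I)" using greater by (simp flip: power_add)
        then have q: "G x ^ k / G x ^ I = G x ^ (k - I)" using elim by simp
        have "poly (b k) x * G x ^ k / G x ^ I = poly (b k) x * (G x ^ k / G x ^ I)" by simp
        also have "\<dots> = poly (b k) x * G x ^ (k - I)" unfolding q ..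
        finally show ?case by (simp add: r algebra_simps)
      qed
    qed
  qed
  have "((\<lambda>x. \<Sum>k\<le>N. poly (b k) x * G x ^ k / G x ^ I) \<longlongrightarrow> (\<Sum>k\<le>N. if k = I then poly (b I) c else 0)) (at_left c)"
    by (intro tendsto_sum lim) simp
  then have "((\<lambda>x. \<Sum>k\<le>N. poly (b k) x * G x ^ k / G x ^ I) \<longlongrightarrow> poly (b I) c) (at_left c)"
    using I(1) by simp
  moreover have "((\<lambda>x. \<Sum>k\<le>N. poly (b k) x * G x ^ k / G x ^ I) \<longlongrightarrow> 0) (at_left c)"
  proof (rule Lim_transform_eventually[OF tendsto_const])
    show "eventually (\<lambda>x. 0 = (\<Sum>k\<le>N. poly (b k) x * G x ^ k / G x ^ I)) (at_left c)"
      using left rel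
    proof eventually_elim
      case (elim x)
      have "0 = (\<Sum>k\<le>N. (x - c) ^ e * (poly (b k) x * G x ^ k))"
        unfolding elim(2)[symmetric] by (intro sum.cong) (auto simp: b)
      also have "\<dots> = (x - c) ^ e * (\<Sum>k\<le>N. poly (b k) x * G x ^ k)" by (rule sum_distrib_left[symmetric])
      finally have "(\<Sum>k\<le>N. poly (b k) x * G x ^ k) = 0" using elim(1) by auto
      then show ?case by (simp only: sum_divide_distrib[symmetric] div_0)
    qed
  qed
  ultimately have "poly (b I) c = 0" by (rule tendsto_unique[rotated]) simp
  then show False using I(2) by simp
qed

lemma peval_fls_X: "peval fls_X p = fps_to_fls (fps_of_poly p)"
proof (induction p)
  case (pCons a p)
  show ?case
    unfolding peval_pCons fps_of_poly_pCons fps_to_fls_plus fls_times_fps_to_fls fps_to_fls_const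
      fps_X_to_fls fls_of_rat pCons.IH by (rule arg_cong[OF mult.commute])
qed (simp add: peval_0)

lemma peval_prod: "peval z (prod f A) = (\<Prod>x\<in>A. peval z (f x))"
  by (induction A rule: infinite_finite_induct) (simp_all add: peval_1 peval_mult)

lemma fps_to_fls_sum: "fps_to_fls (sum f A) = (\<Sum>x\<in>A. fps_to_fls (f x))"
  by (induction A rule: infinite_finite_induct) simp_all

text \<open>
  The denominators of the coefficients are cleared, so that the equation can be evaluated at real numbers.
\<close>
lemma algebraic_series_polynomial_relation:
  assumes "algebraic_series F"
  obtains N a k where "k \<le> N" "a k \<noteq> 0" "(\<Sum>k\<le>N. fps_of_poly (a k) * F ^ k) = 0"
proof -
  obtain p where p: "\<And>k. coeff p k \<in> Kt" "p \<noteq> 0" "poly p (fps_to_fls F) = 0"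
    using assms by (auto simp: algebraic_series_def)
  have "\<forall>k. \<exists>u v. peval (fls_X :: rat fls) v \<noteq> 0 \<and> coeff p k = peval fls_X u / peval fls_X v"
    using p(1) unfolding rat_funs_iff by blast
  then obtain u v where uv: "\<And>k. peval (fls_X :: rat fls) (v k) \<noteq> 0" "\<And>k. coeff p k = peval fls_X (u k) / peval fls_X (v k)"
    by metis
  define N where "N = degree p"
  define P where "P = (\<Prod>l\<le>N. peval (fls_X :: rat fls) (v l))"
  define a where "a k = u k * (\<Prod>l\<in>{..N} - {k}. v l)" for k
  have P: "P \<noteq> 0" using uv(1) by (simp add: P_def)
  have a: "peval fls_X (a k) = coeff p k * P" if "k \<le> N" for k
  proof -
    have "P = peval fls_X (v k) * peval fls_X (\<Prod>l\<in>{..N} - {k}. v l)"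
      unfolding P_def peval_prod using that by (simp add: prod.remove[of _ k])
    then show ?thesis using uv by (simp add: a_def peval_mult)
  qed
  have "a N \<noteq> 0"
  proof
    assume "a N = 0"
    then show False using a[of N] P p(2) by (simp add: N_def peval_0)
  qed
  moreover have "(\<Sum>k\<le>N. fps_of_poly (a k) * F ^ k) = 0"
  proof -
    have "fps_to_fls (\<Sum>k\<le>N. fps_of_poly (a k) * F ^ k) = (\<Sum>k\<le>N. peval fls_X (a k) * fps_to_fls F ^ k)"
      by (simp add: fps_to_fls_sum peval_fls_X fls_times_fps_to_fls fps_to_fls_power)
    also have "\<dots> = (\<Sum>k\<le>N. P * (coeff p k * fps_to_fls F ^ k))" by (intro sum.cong) (simp_all add: a)
    also have "\<dots> = P * poly p (fps_to_fls F)" by (simp add: poly_altdef N_def sum_distrib_left)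
    finally show ?thesis using p(3) by simp
  qed
  ultimately show thesis using that[of N N a] by simp
qed

definition fps_real :: "rat fps \<Rightarrow> real fps" where
  "fps_real F = Abs_fps (\<lambda>n. real_of_rat (fps_nth F n))"

lemma fps_real_mult: "fps_real (F * G) = fps_real F * fps_real G"
  by (rule fps_ext) (simp add: fps_real_def fps_mult_nth of_rat_sum of_rat_mult)

lemma fps_real_power: "fps_real (F ^ k) = fps_real F ^ k"
proof (induction k)
  case 0
  show ?case by (rule fps_ext) (simp add: fps_real_def)
qed (simp add: fps_real_mult)

lemma fps_real_sum: "fps_real (sum f A) = (\<Sum>x\<in>A. fps_real (f x))"
  by (rule fps_ext) (simp add: fps_real_def fps_sum_nth of_rat_sum)

lemma fps_real_poly: "fps_real (fps_of_poly p) = fps_of_poly (map_poly real_of_rat p)"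
  by (rule fps_ext) (simp add: fps_real_def coeff_map_poly)

lemma eval_fps_of_poly:
  fixes p :: "real poly"
  shows "eval_fps (fps_of_poly p) x = poly p x" "fps_conv_radius (fps_of_poly p) = \<infinity>"
proof -
  have "fps_conv_radius (fps_of_poly p) = \<infinity> \<and> eval_fps (fps_of_poly p) x = poly p x"
  proof (induction p)
    case (pCons a p)
    have "fps_conv_radius (fps_of_poly p * fps_X) = \<infinity>"
      using fps_conv_radius_mult[of "fps_of_poly p" fps_X] pCons by simp
    moreover from this have "fps_conv_radius (fps_const a + fps_of_poly p * fps_X) = \<infinity>"
      using fps_conv_radius_add[of "fps_const a" "fps_of_poly p * fps_X"] by simp
    ultimately show ?case using pCons by (simp add: fps_of_poly_pCons eval_fps_add eval_fps_mult mult.commute)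
  qed simp
  then show "eval_fps (fps_of_poly p) x = poly p x" "fps_conv_radius (fps_of_poly p) = \<infinity>" by simp_all
qed

text \<open>
  Evaluation of a convergent series is a ring homomorphism.
\<close>
lemma eval_fps_polynomial:
  fixes x :: real
  assumes x: "norm x < fps_conv_radius G"
  shows "eval_fps (\<Sum>k\<le>(N :: nat). fps_of_poly (a k) * G ^ k) x = (\<Sum>k\<le>N. poly (a k) x * eval_fps G x ^ k)"
proof -
  have pow: "norm x < fps_conv_radius (G ^ k) \<and> eval_fps (G ^ k) x = eval_fps G x ^ k" for k
  proof (induction k)
    case (Suc k)
    have "ereal (norm x) < min (fps_conv_radius G) (fps_conv_radius (G ^ k))" using x Suc by simp
    also have "\<dots> \<le> fps_conv_radius (G * G ^ k)" by (rule fps_conv_radius_mult)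
    finally show ?case using x Suc by (simp add: eval_fps_mult)
  qed simp
  have trm: "norm x < fps_conv_radius (fps_of_poly (a k) * G ^ k)"
      "eval_fps (fps_of_poly (a k) * G ^ k) x = poly (a k) x * eval_fps G x ^ k" for k
  proof -
    have "ereal (norm x) < min (fps_conv_radius (fps_of_poly (a k))) (fps_conv_radius (G ^ k))"
      using pow[of k] by (simp add: eval_fps_of_poly)
    also have "\<dots> \<le> fps_conv_radius (fps_of_poly (a k) * G ^ k)" by (rule fps_conv_radius_mult)
    finally show "norm x < fps_conv_radius (fps_of_poly (a k) * G ^ k)" .
    show "eval_fps (fps_of_poly (a k) * G ^ k) x = poly (a k) x * eval_fps G x ^ k"
      using pow[of k] by (subst eval_fps_mult) (simp_all add: eval_fps_of_poly)
  qed
  have "norm x < fps_conv_radius (\<Sum>k\<le>N. fps_of_poly (a k) * G ^ k) \<and>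
      eval_fps (\<Sum>k\<le>N. fps_of_poly (a k) * G ^ k) x = (\<Sum>k\<le>N. poly (a k) x * eval_fps G x ^ k)"
  proof (induction N)
    case (Suc N)
    let ?S = "\<Sum>k\<le>N. fps_of_poly (a k) * G ^ k" and ?T = "fps_of_poly (a (Suc N)) * G ^ Suc N"
    have "ereal (norm x) < min (fps_conv_radius ?S) (fps_conv_radius ?T)" using Suc trm(1)[of "Suc N"] by simp
    also have "\<dots> \<le> fps_conv_radius (?S + ?T)" by (rule fps_conv_radius_add)
    finally have "norm x < fps_conv_radius (?S + ?T)" .
    moreover have "eval_fps (?S + ?T) x = eval_fps ?S x + eval_fps ?T x"
      using Suc trm(1)[of "Suc N"] by (intro eval_fps_add) simp_all
    ultimately show ?case using Suc trm(2)[of "Suc N"] unfolding sum.atMost_Suc by (simp only:)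
  qed (use trm[of 0] in simp)
  then show ?thesis ..
qed

lemma Q_euler_transcendental: "\<not> algebraic_series (Q_euler i j 2)"
proof
  assume "algebraic_series (Q_euler i j 2)"
  then obtain N a k where a: "k \<le> N" "a k \<noteq> 0" "(\<Sum>k\<le>N. fps_of_poly (a k) * Q_euler i j 2 ^ k) = 0"
    by (rule algebraic_series_polynomial_relation)
  define b where "b k = map_poly real_of_rat (a k)" for k
  have q: "fps_real (Q_euler i j 2) = q_fps i j"
    by (rule fps_ext) (simp add: fps_real_def Q_euler_def q_fps_def q_real_def)
  have "fps_real 0 = 0" by (rule fps_ext) (simp add: fps_real_def)
  then have rel: "(\<Sum>k\<le>N. fps_of_poly (b k) * q_fps i j ^ k) = 0"
    using arg_cong[OF a(3), of fps_real] by (simp add: fps_real_sum fps_real_mult fps_real_power fps_real_poly q b_def)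
  show False
  proof (rule no_polynomial_relation_at_log_singularity[OF q_fps_limits(1) q_fps_limits(2) a(1)])
    show "b k \<noteq> 0" using a(2) by (auto simp: b_def poly_eq_iff coeff_map_poly)
    show "eventually (\<lambda>x. (\<Sum>k\<le>N. poly (b k) x * eval_fps (q_fps i j) x ^ k) = 0) (at_left (1/4))"
    proof (rule eventually_at_leftI[of 0])
      fix x :: real assume "x \<in> {0<..<1/4}"
      then have "norm x < fps_conv_radius (q_fps i j)" using q_fps_conv_radius[of x i j] by simp
      then show "(\<Sum>k\<le>N. poly (b k) x * eval_fps (q_fps i j) x ^ k) = 0"
        using eval_fps_polynomial[of x "q_fps i j" b N] rel by simp
    qed simp
  qed
qed

text \<open>
  If \<open>F\<close> were algebraic, then a differential field of finite dimension over \<open>\<rat>(t)\<close> would contain \<open>Q\<close>, and with it \<open>\<theta>^2 Q\<close>. This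
  reduces the claim from \<open>Q\<close>, whose values stay bounded at the singularity, to a series with visible logarithmic growth.
\<close>
lemma quadrant_plus_algebraic_transcendental:
  assumes F: "fps_to_fls F = c * fps_to_fls (Q_gf (int i) (int j)) + a" and c: "c \<in> Kt" "c \<noteq> 0"
    and S: "dfield S" "a \<in> S"
  shows "\<not> algebraic_series F"
proof
  assume "algebraic_series F"
  then obtain p where p: "\<And>k. coeff p k \<in> Kt" "p \<noteq> 0" "poly p (fps_to_fls F) = 0"
    by (auto simp: algebraic_series_def)
  have "poly_in S p" using p(1) S(1) by (auto simp: poly_in_def dfield_def)
  from dfield_adjoin[OF S(1) this p(2,3)] obtain S' where S': "dfield S'" "S \<subseteq> S'" "fps_to_fls F \<in> S'" by blast
  then have fld: "subfield_set S'" and K: "Kt \<subseteq> S'" and d: "\<And>x. x \<in> S' \<Longrightarrow> fls_deriv x \<in> S'"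
    by (auto simp: dfield_def)
  interpret S': subring_set S' by (rule subfield_imp_subring[OF fld])
  have X: "fls_X \<in> S'" using K rat_funs_gen by blast
  have "fps_to_fls (Q_gf (int i) (int j)) = (fps_to_fls F - a) / c" using F c by simp
  also have "\<dots> \<in> S'" using S' S(2) c K by (intro subfield_divide[OF fld] S'.diff_in) auto
  finally have Q0: "fps_to_fls (Q_euler i j 0) \<in> S'" by (simp add: Q_euler_0)
  have step: "fps_to_fls (Q_euler i j (Suc k)) \<in> S'" if "fps_to_fls (Q_euler i j k) \<in> S'" for k
  proof -
    have "fps_to_fls (Q_euler i j (Suc k)) = fls_X * fls_deriv (fps_to_fls (Q_euler i j k))"
      unfolding Q_euler_Suc[symmetric] fls_deriv_fps_to_fls by (simp add: fls_times_fps_to_fls)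
    then show ?thesis using S'.mult_in[OF X d[OF that]] by simp
  qed
  have "fps_to_fls (Q_euler i j 2) \<in> S'" using step[OF step[OF Q0]] by (simp add: numeral_2_eq_2)
  from dfield_imp_algebraic[OF S'(1) this] show False using Q_euler_transcendental by blast
qed

lemma fps_to_fls_third: "fps_to_fls (fps_const (1 / 3) * F :: rat fps) = (1 / 3) * fps_to_fls F"
proof -
  have "fls_const (1 / 3 :: rat) = of_rat (1 / 3)" by (rule fls_of_rat[symmetric])
  also have "\<dots> = 1 / 3" by (simp only: of_rat_divide of_rat_1 of_rat_numeral_eq)
  finally have a: "fls_const (1 / 3 :: rat) = 1 / 3" .
  show ?thesis unfolding fls_times_fps_to_fls fps_to_fls_const a ..
qed
lemma C_eq_quadrant_plus_algebraic: "fps_to_fls (C_gf (int i) (int j)) = (1 / 3) * fps_to_fls (Q_gf (int i) (int j)) + fps_to_fls (A_gf (int i) (int j))"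
proof -
  have o: "Q_gf (- int i - 2) (int j) = 0" "Q_gf (int i) (- int j - 2) = 0" by (rule Q_outside, simp)+
  have "C_gf (int i) (int j) = fps_const (1 / 3) * Q_gf (int i) (int j) + A_gf (int i) (int j)"
    unfolding A_gf_def Q_refl_def o by (simp only: diff_0_right add_diff_eq add_diff_cancel_left')
  then show ?thesis by (simp only: fps_to_fls_plus fps_to_fls_third)
qed

text \<open>
  For a negative abscissa only the copy of \<open>Q\<close> reflected in the line \<open>i = -1\<close> contributes.
\<close>
lemma C_eq_reflected_quadrant_plus_algebraic:
  assumes "i \<ge> 1"
  shows "fps_to_fls (C_gf (- int i) (int j)) = - (1 / 3) * fps_to_fls (Q_gf (int i - 2) (int j)) + fps_to_fls (A_gf (- int i) (int j))"
proof -
  have o: "Q_gf (- int i) (int j) = 0" "Q_gf (- int i) (- int j - 2) = 0" by (rule Q_outside, use assms in simp)+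
  have e: "- (- int i) - 2 = int i - 2" by simp
  have "C_gf (- int i) (int j) = - (fps_const (1 / 3) * Q_gf (int i - 2) (int j)) + A_gf (- int i) (int j)"
    unfolding A_gf_def Q_refl_def o e by algebra
  then show ?thesis by (simp only: fps_to_fls_plus fps_to_fls_uminus fps_to_fls_third mult_minus_left)
qed
theorem corollary2:
  shows "(\<forall>j::nat.
            (\<exists>R \<in> rat_funs (fps_to_fls Z_series).
               fps_to_fls (C_gf (-1) (int j)) = fls_X ^ (j + 1) * R) \<and>
            algebraic_series (C_gf (-1) (int j))) \<and>
         (\<forall>(i::nat) (j::nat). i \<ge> 1 \<longrightarrow>
            D_finite (C_gf (- int i) (int j)) \<and>
            (\<exists>R \<in> rat_funs (fps_to_fls Z_series).
               fps_to_fls (C_gf (- int i) (int j)) =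
                 - (1 / 3) * fps_to_fls (Q_gf (int i - 2) (int j)) + fls_X ^ (i + j) * R) \<and>
            (i \<ge> 2 \<longrightarrow> transcendental_series (C_gf (- int i) (int j)))) \<and>
         (\<forall>(i::nat) (j::nat).
            (\<exists>R \<in> rat_funs (fps_to_fls Z_series).
               fps_to_fls (C_gf (int i) (int j)) =
                 (1 / 3) * fps_to_fls (Q_gf (int i) (int j)) + fls_X ^ (i + j) * R) \<and>
            D_finite (C_gf (int i) (int j)) \<and>
            transcendental_series (C_gf (int i) (int j)))"
proof -
  obtain S where S: "dfield S" "Zfld \<subseteq> S" using Z_dfield by blast
  then have fld: "subfield_set S" and Kt: "Kt \<subseteq> S" by (auto simp: dfield_def)
  interpret S: subring_set S by (rule subfield_imp_subring[OF fld])
  interpret K: subring_set Kt by (rule subfield_imp_subring[OF rat_funs_subfield])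
  have tpow_S: "x \<in> S" if "x \<in> tpow a" for x a
    using that S(2) Kt rat_funs_gen[of "fls_X :: rat fls"]
    by (auto simp: tpow_def intro!: S.mult_in S.power_in)
  have third: "1 / 3 \<in> Kt" "- (1 / 3) \<in> Kt" "(0 :: rat fls) \<in> Kt"
    by (intro K.uminus_in K.zero_in subfield_divide[OF rat_funs_subfield] K.one_in K.numeral_in)+
  have neg: "\<exists>R \<in> Zfld. fps_to_fls (C_gf (- int i) (int j)) =
      - (1 / 3) * fps_to_fls (Q_gf (int i - 2) (int j)) + fls_X ^ (i + j) * R" if "i \<ge> 1" for i j
  proof -
    obtain R where R: "R \<in> Zfld" "fps_to_fls (A_gf (- int i) (int j)) = fls_X ^ (i + j) * R"
      using A_in_tpow(2)[of i j] unfolding tpow_def by blast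
    show ?thesis unfolding C_eq_reflected_quadrant_plus_algebraic[OF that] R(2) using R(1) by blast
  qed
  have nonneg: "\<exists>R \<in> Zfld. fps_to_fls (C_gf (int i) (int j)) =
      (1 / 3) * fps_to_fls (Q_gf (int i) (int j)) + fls_X ^ (i + j) * R" for i j
  proof -
    obtain R where R: "R \<in> Zfld" "fps_to_fls (A_gf (int i) (int j)) = fls_X ^ (i + j) * R"
      using A_in_tpow(1)[of i j] unfolding tpow_def by blast
    show ?thesis unfolding C_eq_quadrant_plus_algebraic R(2) using R(1) by blast
  qed
  have C1: "fps_to_fls (C_gf (- 1) (int j)) = fps_to_fls (A_gf (- 1) (int j))" for j
    using C_eq_reflected_quadrant_plus_algebraic[of 1 j] by (simp add: Q_gf_neg)
  have A1: "fps_to_fls (A_gf (- 1) (int j)) \<in> tpow (j + 1)" for j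
    using A_in_tpow(2)[of 1 j] by simp
  have C1_S: "fps_to_fls (C_gf (- 1) (int j)) \<in> S" for j
    unfolding C1 by (rule tpow_S[OF A1])
  have two: "int i - 2 = int (i - 2)" if "i \<ge> 2" for i using that by simp
  (* For i = 1 the quadrant series vanishes, so the series itself is the algebraic summand. *)
  have neg_D: "D_finite (C_gf (- int i) (int j))" if "i \<ge> 1" for i j
  proof (cases "i = 1")
    case True
    then show ?thesis
      using quadrant_plus_algebraic_D_finite[of "C_gf (- 1) (int j)" 0 0 0 "fps_to_fls (C_gf (- 1) (int j))" S]
        C1_S third S by simp
  next
    case False
    then have "i \<ge> 2" using that by simp
    then show ?thesis
      using quadrant_plus_algebraic_D_finite[OF C_eq_reflected_quadrant_plus_algebraic[OF that, unfolded two[OF \<open>i \<ge> 2\<close>]] third(2) S(1) tpow_S[OF A_in_tpow(2)]]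
      by simp
  qed
  have neg_T: "transcendental_series (C_gf (- int i) (int j))" if "i \<ge> 2" for i j
    using quadrant_plus_algebraic_transcendental[OF C_eq_reflected_quadrant_plus_algebraic[of i j, unfolded two[OF that]] third(2) _ S(1) tpow_S[OF A_in_tpow(2)]]
      that by simp
  have nonneg_D: "D_finite (C_gf (int i) (int j))" for i j
    by (rule quadrant_plus_algebraic_D_finite[OF C_eq_quadrant_plus_algebraic third(1) S(1) tpow_S[OF A_in_tpow(1)]])
  have nonneg_T: "transcendental_series (C_gf (int i) (int j))" for i j
    by (rule quadrant_plus_algebraic_transcendental[OF C_eq_quadrant_plus_algebraic third(1) _ S(1) tpow_S[OF A_in_tpow(1)]]) simp
  have "\<exists>R \<in> Zfld. fps_to_fls (C_gf (- 1) (int j)) = fls_X ^ (j + 1) * R" for j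
    using A1[of j] unfolding C1 tpow_def by blast
  moreover have "algebraic_series (C_gf (- 1) (int j))" for j
    by (rule dfield_imp_algebraic[OF S(1) C1_S])
  ultimately show ?thesis using neg nonneg neg_D neg_T nonneg_D nonneg_T by (intro conjI allI impI) simp_all
qed

end
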